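(* Let $T>0$, $\varepsilon>0$ and $M>0$ be fixed. Let $0<\alpha<1$ and $\beta=\frac{\varepsilon}{\varepsilon+1}$. Let $u$ be the weak solution, associated with the initial datum $u_0$, to $$\mathrm{i}^\alpha\partial_t^\alpha u(t)+Au(t)=0,\quad t\in(0,T),\qquad u(0)=u_0. \tag{P}$$ There exists a constant $C=C(\alpha)$, depending only on $\alpha$, such that $$\|u(0)\|\le C^\beta M^{1-\beta}\|u(T)\|^\beta$$ for all $u_0\in\mathcal{U}_{\varepsilon,M}:=\{u_0\in H_\varepsilon:\|u_0\|_\varepsilon\le M\}$.
   Context: $(H,\langle\cdot,\cdot\rangle)$ is a (complex) Hilbert space with norm $\|\cdot\|$; $A:D(A)\subset H\to H$ is a negative-definite self-adjoint operator with compact resolvent. The eigenvalues of $-A$ are $0<\lambda_1\le\lambda_2\le\cdots\to\infty$, with a corresponding Hilbert (orthonormal) basis of eigenvectors $\{\varphi_n\}_{n\ge1}\subset D(A)$. For $s\ge0$, $H_s=\{u\in H:\sum_n\lambda_n^{2s}|\langle u,\varphi_n\rangle|^2<\infty\}$ with $\|u\|_s^2=\sum_n\lambda_n^{2s}|\langle u,\varphi_n\rangle|^2$; $H_{-s}=H_s'$ is its dual (identifying $H=H'$) with norm $\|u\|_{-s}^2=\sum_n\lambda_n^{-2s}|\langle u,\varphi_n\rangle_{-s,s}|^2$, where $\langle\cdot,\cdot\rangle_{-s,s}$ is the duality bracket between $H_{-s}$ and $H_s$. For $u=\sum_nu_n\varphi_n\in H$, $Au=-\sum_n\lambda_nu_n\varphi_n$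 (as an element of a space $H_{-s}$). Powers: $\mathrm{i}^{\alpha}=e^{\mathrm{i}\pi\alpha/2}$, $\mathrm{i}^{-\alpha}=e^{-\mathrm{i}\pi\alpha/2}$. Caputo derivative for $0<\alpha<1$: $\partial_t^\alpha u(t)=\frac{1}{\Gamma(1-\alpha)}\int_0^t(t-s)^{-\alpha}\partial_su(s)\,\mathrm{d}s$, whenever the right-hand side is well-defined. Weak solution of (P) for $u_0\in H$: a function $u$ such that (1) $u\in C([0,T];H)$; (2) $\partial_t^\alpha u(t),Au(t)\in H_{-1/\alpha}$ for almost all $t\in(0,T)$ and the equation holds in $H_{-1/\alpha}$ for almost all $t\in(0,T)$; (3) $\lim_{t\to0^+}\|u(t)-u_0\|=0$. The weak solution is given by $u(t)=\sum_n\langle u_0,\varphi_n\rangle E_{\alpha,1}(\mathrm{i}^{-\alpha}\lambda_nt^\alpha)\varphi_n$, where $E_{\alpha,\beta}(z)=\sum_{k\ge0}z^k/\Gamma(\alpha k+\beta)$ is the Mittag-Leffler function.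
   Formalization: The constant C may depend on the fixed operator A (its eigenvalues) as well as on α, though not on T, ε, M or u_0; a constant depending on α alone for all A is impossible, as u_0 = kφ_1, M = λ_1^ε k with λ_1 < 1/C and T→0 shows. *)

theory Defs
  imports "HOL-Analysis.Analysis"
begin

section \<open>Complex Hilbert spaces\<close>

text \<open>The inner product is linear in the first argument, so that the coordinates of \<open>u\<close> in an
  orthonormal basis are \<open>cinner u (phi n)\<close>.\<close>

class complex_hilbert = banach +
  fixes scaleC :: "complex \<Rightarrow> 'a \<Rightarrow> 'a"  (infixr \<open>*\<^sub>C\<close> 75)
    and cinner :: "'a \<Rightarrow> 'a \<Rightarrow> complex"
  assumes scaleC_add_right: "a *\<^sub>C (x + y) = a *\<^sub>C x + a *\<^sub>C y"
    and scaleC_add_left: "(a + b) *\<^sub>C x = a *\<^sub>C x + b *\<^sub>C x"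
    and scaleC_scaleC: "a *\<^sub>C b *\<^sub>C x = (a * b) *\<^sub>C x"
    and scaleC_of_real: "complex_of_real r *\<^sub>C x = r *\<^sub>R x"
    and cinner_add_left: "cinner (x + y) z = cinner x z + cinner y z"
    and cinner_scaleC_left: "cinner (a *\<^sub>C x) y = a * cinner x y"
    and cinner_commute: "cinner x y = cnj (cinner y x)"
    and cinner_self: "cinner x x = complex_of_real ((norm x)\<^sup>2)"

section \<open>Unbounded operators\<close>

text \<open>An operator is a pair of a domain \<open>D\<close> and a map \<open>A\<close>, whose values outside \<open>D\<close> are irrelevant.\<close>

definition densely_defined_linear ::
    "'a::complex_hilbert set \<Rightarrow> ('a \<Rightarrow> 'a) \<Rightarrow> bool" where
  "densely_defined_linear D A \<longleftrightarrow>
     0 \<in> D \<and>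
     (\<forall>u\<in>D. \<forall>v\<in>D. u + v \<in> D \<and> A (u + v) = A u + A v) \<and>
     (\<forall>c. \<forall>u\<in>D. c *\<^sub>C u \<in> D \<and> A (c *\<^sub>C u) = c *\<^sub>C A u) \<and>
     closure D = UNIV"

text \<open>The right-hand side of the equivalence says that \<open>(v, w)\<close> belongs to the graph of the adjoint;
  hence the graphs of \<open>A\<close> and of its adjoint coincide, domains included.\<close>

definition self_adjoint :: "'a::complex_hilbert set \<Rightarrow> ('a \<Rightarrow> 'a) \<Rightarrow> bool" where
  "self_adjoint D A \<longleftrightarrow>
     densely_defined_linear D A \<and>
     (\<forall>v w. v \<in> D \<and> w = A v \<longleftrightarrow> (\<forall>u\<in>D. cinner (A u) v = cinner u w))"

definition negative_definite :: "'a::complex_hilbert set \<Rightarrow> ('a \<Rightarrow> 'a) \<Rightarrow> bool" where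
  "negative_definite D A \<longleftrightarrow> (\<forall>u\<in>D. u \<noteq> 0 \<longrightarrow> Re (cinner (A u) u) < 0)"

definition compact_resolvent :: "'a::complex_hilbert set \<Rightarrow> ('a \<Rightarrow> 'a) \<Rightarrow> bool" where
  "compact_resolvent D A \<longleftrightarrow>
     (\<exists>mu R. (\<forall>f. R f \<in> D \<and> mu *\<^sub>C R f - A (R f) = f) \<and>
             (\<forall>u\<in>D. R (mu *\<^sub>C u - A u) = u) \<and>
             (\<forall>S. bounded S \<longrightarrow> compact (closure (R ` S))))"

text \<open>\<open>ev\<close> lists the eigenvalues of \<open>-A\<close>, repeated according to multiplicity and indexed from 0.\<close>

definition eigenbasis ::
    "'a::complex_hilbert set \<Rightarrow> ('a \<Rightarrow> 'a) \<Rightarrow> (nat \<Rightarrow> real) \<Rightarrow> (nat \<Rightarrow> 'a) \<Rightarrow> bool" where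
  "eigenbasis D A ev phi \<longleftrightarrow>
     0 < ev 0 \<and> incseq ev \<and> filterlim ev at_top sequentially \<and>
     (\<forall>n. phi n \<in> D \<and> - A (phi n) = ev n *\<^sub>R phi n) \<and>
     (\<forall>m n. cinner (phi m) (phi n) = (if m = n then 1 else 0)) \<and>
     (\<forall>u. (\<lambda>n. cinner u (phi n) *\<^sub>C phi n) sums u)"

section \<open>The scale of spaces\<close>

definition Hs :: "(nat \<Rightarrow> real) \<Rightarrow> (nat \<Rightarrow> 'a::complex_hilbert) \<Rightarrow> real \<Rightarrow> 'a set" where
  "Hs ev phi s = {u. summable (\<lambda>n. ev n powr (2 * s) * (cmod (cinner u (phi n)))\<^sup>2)}"

definition Hs_norm :: "(nat \<Rightarrow> real) \<Rightarrow> (nat \<Rightarrow> 'a::complex_hilbert) \<Rightarrow> real \<Rightarrow> 'a \<Rightarrow> real" where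
  "Hs_norm ev phi s u = sqrt (\<Sum>n. ev n powr (2 * s) * (cmod (cinner u (phi n)))\<^sup>2)"

text \<open>The dual of \<open>Hs\<close>. Its elements are the bounded antilinear functionals on \<open>Hs\<close>, so that the
  identification of \<open>H\<close> with its own dual (\<open>Hneg_embed\<close>) is complex linear and the duality bracket of
  \<open>f\<close> with \<open>v\<close>, namely \<open>f v\<close>, extends \<open>cinner\<close>. Functionals are set to 0 outside \<open>Hs\<close>, so that equality
  in the dual is equality of functions, and the vector space operations are the pointwise ones.\<close>

definition Hneg ::
    "(nat \<Rightarrow> real) \<Rightarrow> (nat \<Rightarrow> 'a::complex_hilbert) \<Rightarrow> real \<Rightarrow> ('a \<Rightarrow> complex) set" where
  "Hneg ev phi s =
     {f. (\<forall>v\<in>Hs ev phi s. \<forall>w\<in>Hs ev phi s. f (v + w) = f v + f w) \<and>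
         (\<forall>c. \<forall>v\<in>Hs ev phi s. f (c *\<^sub>C v) = cnj c * f v) \<and>
         (\<exists>K. \<forall>v\<in>Hs ev phi s. cmod (f v) \<le> K * Hs_norm ev phi s v) \<and>
         (\<forall>v. v \<notin> Hs ev phi s \<longrightarrow> f v = 0)}"

definition Hneg_norm ::
    "(nat \<Rightarrow> real) \<Rightarrow> (nat \<Rightarrow> 'a::complex_hilbert) \<Rightarrow> real \<Rightarrow> ('a \<Rightarrow> complex) \<Rightarrow> real" where
  "Hneg_norm ev phi s f = sqrt (\<Sum>n. ev n powr (- 2 * s) * (cmod (f (phi n)))\<^sup>2)"

definition Hneg_embed ::
    "(nat \<Rightarrow> real) \<Rightarrow> (nat \<Rightarrow> 'a::complex_hilbert) \<Rightarrow> real \<Rightarrow> 'a \<Rightarrow> ('a \<Rightarrow> complex)" where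
  "Hneg_embed ev phi s u = (\<lambda>v. if v \<in> Hs ev phi s then cinner u v else 0)"

text \<open>\<open>Hneg_op ev phi s u y\<close> says that \<open>y\<close> is the sum, convergent in \<open>Hneg\<close>, of the series
  \<open>- (\<Sum>n. ev n * cinner u (phi n) * phi n)\<close>, that is, \<open>y = A u\<close> as an element of \<open>Hneg\<close>.\<close>

definition Hneg_op ::
    "(nat \<Rightarrow> real) \<Rightarrow> (nat \<Rightarrow> 'a::complex_hilbert) \<Rightarrow> real \<Rightarrow> 'a \<Rightarrow> ('a \<Rightarrow> complex) \<Rightarrow> bool" where
  "Hneg_op ev phi s u y \<longleftrightarrow>
     y \<in> Hneg ev phi s \<and>
     (\<lambda>N. Hneg_norm ev phi s
        (\<lambda>v. (- (\<Sum>n<N. complex_of_real (ev n) * cinner u (phi n) * Hneg_embed ev phi s (phi n) v))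
              - y v)) \<longlonglongrightarrow> 0"

section \<open>Calculus for functions with values in the dual\<close>

definition Hneg_has_derivative ::
    "(nat \<Rightarrow> real) \<Rightarrow> (nat \<Rightarrow> 'a::complex_hilbert) \<Rightarrow> real \<Rightarrow>
     (real \<Rightarrow> 'a \<Rightarrow> complex) \<Rightarrow> ('a \<Rightarrow> complex) \<Rightarrow> real \<Rightarrow> bool" where
  "Hneg_has_derivative ev phi s F g t \<longleftrightarrow>
     g \<in> Hneg ev phi s \<and>
     ((\<lambda>h. Hneg_norm ev phi s (\<lambda>v. (F (t + h) v - F t v) / complex_of_real h - g v)) \<longlongrightarrow> 0) (at 0)"

text \<open>Almost everywhere limit of simple functions.\<close>

definition Hneg_strongly_measurable ::
    "(nat \<Rightarrow> real) \<Rightarrow> (nat \<Rightarrow> 'a::complex_hilbert) \<Rightarrow> real \<Rightarrow>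
     real set \<Rightarrow> (real \<Rightarrow> 'a \<Rightarrow> complex) \<Rightarrow> bool" where
  "Hneg_strongly_measurable ev phi s S F \<longleftrightarrow>
     (\<exists>X :: nat \<Rightarrow> real \<Rightarrow> 'a \<Rightarrow> complex.
        (\<forall>k. finite (range (X k)) \<and> range (X k) \<subseteq> Hneg ev phi s \<and>
             (\<forall>g. X k -` {g} \<in> sets lebesgue)) \<and>
        (AE t in lebesgue. t \<in> S \<longrightarrow>
           (\<lambda>k. Hneg_norm ev phi s (\<lambda>v. X k t v - F t v)) \<longlonglongrightarrow> 0))"

text \<open>Bochner integral: \<open>F\<close> is Bochner integrable iff it is strongly measurable and its norm is
  integrable; the integral \<open>w\<close> then commutes with the bounded functionals \<open>f \<mapsto> f v\<close> and is
  determined by them. The library integral is not directly applicable since \<open>Hneg\<close>, which depends on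
  the operator and on \<open>s\<close>, is not a type.\<close>

definition Hneg_has_integral ::
    "(nat \<Rightarrow> real) \<Rightarrow> (nat \<Rightarrow> 'a::complex_hilbert) \<Rightarrow> real \<Rightarrow>
     real set \<Rightarrow> (real \<Rightarrow> 'a \<Rightarrow> complex) \<Rightarrow> ('a \<Rightarrow> complex) \<Rightarrow> bool" where
  "Hneg_has_integral ev phi s S F w \<longleftrightarrow>
     (AE t in lebesgue. t \<in> S \<longrightarrow> F t \<in> Hneg ev phi s) \<and>
     Hneg_strongly_measurable ev phi s S F \<and>
     set_integrable lebesgue S (\<lambda>t. Hneg_norm ev phi s (F t)) \<and>
     w \<in> Hneg ev phi s \<and>
     (\<forall>v. w v = set_lebesgue_integral lebesgue S (\<lambda>t. F t v))"

section \<open>The fractional equation\<close>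

text \<open>\<open>d\<close> is the Caputo derivative of \<open>F\<close> at \<open>t\<close>, in particular it is well-defined. The derivative
  \<open>G\<close> of \<open>F\<close> is taken almost everywhere, and \<open>F\<close> is required to be a primitive of \<open>G\<close> on the open
  interval (local absolute continuity): a pointwise almost everywhere derivative alone
  would not see singular parts of Cantor type, and the Cauchy problem would have no uniqueness.\<close>

definition has_caputo_derivative ::
    "(nat \<Rightarrow> real) \<Rightarrow> (nat \<Rightarrow> 'a::complex_hilbert) \<Rightarrow> real \<Rightarrow>
     real \<Rightarrow> (real \<Rightarrow> 'a \<Rightarrow> complex) \<Rightarrow> ('a \<Rightarrow> complex) \<Rightarrow> real \<Rightarrow> bool" where
  "has_caputo_derivative ev phi s \<alpha> F d t \<longleftrightarrow>
     (\<exists>G w. (AE r in lebesgue. 0 < r \<and> r < t \<longrightarrow> Hneg_has_derivative ev phi s F (G r) r) \<and>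
            (\<forall>a b. 0 < a \<and> a \<le> b \<and> b < t \<longrightarrow>
               Hneg_has_integral ev phi s {a..b} G (\<lambda>v. F b v - F a v)) \<and>
            Hneg_has_integral ev phi s {0<..<t}
              (\<lambda>r v. complex_of_real ((t - r) powr (- \<alpha>)) * G r v) w \<and>
            d = (\<lambda>v. complex_of_real (1 / Gamma (1 - \<alpha>)) * w v))"

definition i_power :: "real \<Rightarrow> complex" where
  "i_power \<alpha> = exp (\<i> * complex_of_real (pi * \<alpha> / 2))"

definition weak_solution ::
    "(nat \<Rightarrow> real) \<Rightarrow> (nat \<Rightarrow> 'a::complex_hilbert) \<Rightarrow> real \<Rightarrow> real \<Rightarrow> 'a \<Rightarrow> (real \<Rightarrow> 'a) \<Rightarrow> bool" where
  "weak_solution ev phi \<alpha> T u0 u \<longleftrightarrow>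
     continuous_on {0..T} u \<and>
     (AE t in lebesgue. 0 < t \<and> t < T \<longrightarrow>
        (\<exists>d y. has_caputo_derivative ev phi (1 / \<alpha>) \<alpha>
                  (\<lambda>r. Hneg_embed ev phi (1 / \<alpha>) (u r)) d t \<and>
               Hneg_op ev phi (1 / \<alpha>) (u t) y \<and>
               (\<lambda>v. i_power \<alpha> * d v + y v) = (\<lambda>v. 0))) \<and>
     ((\<lambda>t. norm (u t - u0)) \<longlongrightarrow> 0) (at_right 0)"

definition admissible_data ::
    "(nat \<Rightarrow> real) \<Rightarrow> (nat \<Rightarrow> 'a::complex_hilbert) \<Rightarrow> real \<Rightarrow> real \<Rightarrow> 'a set" where
  "admissible_data ev phi \<epsilon> M = {u0 \<in> Hs ev phi \<epsilon>. Hs_norm ev phi \<epsilon> u0 \<le> M}"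

end

theory Submission
  imports Defs "HOL-Complex_Analysis.Complex_Analysis" "HOL-Real_Asymp.Real_Asymp"
begin

text \<open>In the eigenbasis the equation decouples. With \<open>c = exp (- \<i> \<pi> \<alpha> / 2)\<close>, the coordinate belonging to
  the eigenvalue \<open>\<Lambda>\<close> solves the Volterra equation \<open>y = y 0 + c \<Lambda> J y\<close>, where \<open>J\<close> is the fractional
  integral of order \<open>\<alpha>\<close>; by uniqueness and scaling \<open>y t = y 0 * z (\<Lambda> powr (1 / \<alpha>) * t)\<close> for one function
  \<open>z\<close>, namely \<open>z t = E (c * t powr \<alpha>)\<close> with the Mittag-Leffler function \<open>E\<close> of parameter \<open>\<alpha>\<close>. If \<open>\<bar>z\<bar>\<close> is bounded
  below on the half line by some \<open>\<kappa> > 0\<close>, then \<open>\<kappa> * norm (u 0) \<le> norm (u T)\<close> by Parseval, and the claim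
  follows by interpolating this with the a priori bound \<open>norm (u 0) \<le> M / ev 0 powr \<epsilon>\<close>.

  The lower bound for \<open>z\<close> comes from \<open>z t = exp (- \<i> t) / \<alpha> - g t\<close>, where \<open>g t\<close> is the integral of
  \<open>exp (- t * exp x)\<close> against an explicit complex kernel. The signs of the kernel put \<open>g\<close> in the closed first
  quadrant, which \<open>exp (- \<i> t)\<close> does not meet for \<open>0 < t < 3 \<pi> / 2\<close>; for \<open>t \<ge> 3 \<pi> / 2\<close> the integral
  is already smaller than \<open>14 / (15 \<alpha>)\<close>. That \<open>z\<close> solves the Volterra equation is checked on Laplace
  transforms, where it becomes a Cauchy integral formula on the plane cut along the negative axis.\<close>

text \<open>The argument \<open>c * t powr \<alpha>\<close> lies on the ray that separates
  exponential growth of \<open>E\<close> from algebraic decay. There the exponential part has the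
  constant modulus \<open>1 / \<alpha>\<close>, so a lower bound uniform in all eigenvalues can
  hold. The splitting of \<open>z\<close> is what the inverse Laplace integral of
  \<open>s powr (\<alpha> - 1) / (s powr \<alpha> - c)\<close> yields when its contour is pushed
  onto the negative axis: the pole at \<open>s = - \<i>\<close> leaves
  \<open>exp (- \<i> t) / \<alpha>\<close>, the cut leaves \<open>g\<close>. The development runs
  this backwards: \<open>z\<close> is defined by the result and its transform is then verified. For
  small \<open>t\<close> and small \<open>\<alpha>\<close> the size estimates of \<open>g\<close> do
  not exclude a zero of \<open>z\<close>; there only signs help, and \<open>\<kappa>\<close> comes
  from compactness. A second obstacle is the notion of weak solution: the equation is known for
  almost every \<open>t\<close> only, and the derivative in it lives in a dual space and is a
  witness chosen anew for each \<open>t\<close>. Testing with eigenvectors makes it scalar; the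
  Volterra form removes the derivative altogether.\<close>

section \<open>Fractional integrals\<close>

text \<open>The Riemann--Liouville integral of order \<open>\<alpha>\<close>, rescaled to the unit interval (see \<open>frac_int_eq\<close>).\<close>

definition frac_int :: "real \<Rightarrow> (real \<Rightarrow> complex) \<Rightarrow> real \<Rightarrow> complex" where
  "frac_int \<alpha> f t = of_real (t powr \<alpha> / Gamma \<alpha>) *
     (LINT \<sigma>:{0<..<1}|lborel. of_real ((1 - \<sigma>) powr (\<alpha> - 1)) * f (t * \<sigma>))"

lemma frac_int_0 [simp]: "frac_int \<alpha> f 0 = 0"
  by (simp add: frac_int_def)

text \<open>Homogeneity of order \<open>\<alpha>\<close>: the time change \<open>\<nu> * t\<close>
  multiplies the coefficient of the Volterra equation by \<open>\<nu> powr \<alpha>\<close>. This is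
  how one function serves every eigenvalue.\<close>

lemma frac_int_scale:
  assumes "0 \<le> \<nu>"
  shows "frac_int \<alpha> (\<lambda>t. f (\<nu> * t)) t * of_real (\<nu> powr \<alpha>) = frac_int \<alpha> f (\<nu> * t)"
  using assms by (cases "0 \<le> t") (auto simp: frac_int_def powr_mult mult_ac)

lemma frac_int_cmult: "frac_int \<alpha> (\<lambda>t. c * f t) t = c * frac_int \<alpha> f t"
  by (simp add: frac_int_def mult.left_commute)

lemma frac_int_eq:
  assumes "0 < \<alpha>" "0 < t"
  shows "(LINT s:{0<..<t}|lborel. of_real ((t - s) powr (\<alpha> - 1)) * f s)
           = of_real (Gamma \<alpha>) * frac_int \<alpha> f t"
proof -
  have *: "indicat_real {0<..<t} (t * x) *\<^sub>R (of_real ((t - t * x) powr (\<alpha> - 1)) * f (t * x))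
         = of_real (t powr (\<alpha> - 1)) * (indicat_real {0<..<1} x *\<^sub>R (of_real ((1 - x) powr (\<alpha> - 1)) * f (t * x)))"
    for x
  proof -
    have "t - t * x = t * (1 - x)" by (simp add: algebra_simps)
    moreover have "t * x < t \<longleftrightarrow> x < 1" "0 < t * x \<longleftrightarrow> 0 < x"
      using assms by (auto simp: zero_less_mult_iff)
    ultimately show ?thesis using assms by (auto simp: indicator_def powr_mult)
  qed
  have "t * t powr (\<alpha> - 1) = t powr \<alpha>" using assms by (simp add: powr_diff)
  hence **: "of_real t * (of_real (t powr (\<alpha> - 1)) * w) = of_real (t powr \<alpha>) * w" for w :: complex
    by (metis mult.assoc of_real_mult)
  have "Gamma \<alpha> \<noteq> 0" using Gamma_real_pos[OF assms(1)] by simp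
  moreover have "(LINT x|lborel. indicat_real {0<..<t} (t * x) *\<^sub>R (of_real ((t - t * x) powr (\<alpha> - 1)) * f (t * x)))
    = of_real (t powr (\<alpha> - 1)) * (LINT x:{0<..<1}|lborel. of_real ((1 - x) powr (\<alpha> - 1)) * f (t * x))"
    unfolding set_lebesgue_integral_def by (subst integral_mult_right_zero[symmetric]) (simp only: *)
  ultimately show ?thesis
    unfolding set_lebesgue_integral_def[of _ "{0<..<t}"] frac_int_def
    using assms
    by (subst lborel_integral_real_affine[where c = t and t = 0])
       (simp_all add: ** scaleR_conv_of_real [of t])
qed

lemma integrable_frac_kernel:
  assumes "0 < (\<alpha> :: real)"
  shows "set_integrable lborel {0<..<1} (\<lambda>\<sigma>. (1 - \<sigma>) powr (\<alpha> - 1))"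
proof -
  have "set_integrable lborel {0..1} (\<lambda>t. t powr (1 - 1) * (1 - t) powr (\<alpha> - 1))"
    using assms by (intro integrable_Beta) auto
  then have "set_integrable lborel {0<..<1} (\<lambda>t. t powr (1 - 1) * (1 - t) powr (\<alpha> - 1))"
    by (rule set_integrable_subset) auto
  then show ?thesis
    by (rule set_integrable_cong[THEN iffD1, rotated -1]) auto
qed

lemma integrable_frac_kernel_times:
  assumes "0 < (\<alpha> :: real)" "f \<in> borel_measurable borel" "0 \<le> t"
    and "\<And>s. 0 \<le> s \<Longrightarrow> s \<le> t \<Longrightarrow> cmod (f s) \<le> B"
  shows "set_integrable lborel {0<..<1} (\<lambda>\<sigma>. of_real ((1 - \<sigma>) powr (\<alpha> - 1)) * f (t * \<sigma>))"
  unfolding set_integrable_def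
proof (rule Bochner_Integration.integrable_bound)
  show "integrable lborel (\<lambda>\<sigma>. B * (indicat_real {0<..<1} \<sigma> *\<^sub>R (1 - \<sigma>) powr (\<alpha> - 1)))"
    using integrable_frac_kernel[OF assms(1)] unfolding set_integrable_def by simp
  show "(\<lambda>\<sigma>. indicat_real {0<..<1} \<sigma> *\<^sub>R (complex_of_real ((1 - \<sigma>) powr (\<alpha> - 1)) * f (t * \<sigma>)))
          \<in> borel_measurable lborel"
    using assms(2) by measurable
  have "cmod (f (t * \<sigma>)) * (1 - \<sigma>) powr (\<alpha> - 1) \<le> \<bar>B\<bar> * (1 - \<sigma>) powr (\<alpha> - 1)" if "0 < \<sigma>" "\<sigma> < 1" for \<sigma>
    using that assms(3) by (intro mult_right_mono order_trans[OF assms(4) abs_ge_self]) (auto simp: mult_left_le)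
  then show "AE \<sigma> in lborel. norm (indicat_real {0<..<1} \<sigma> *\<^sub>R (complex_of_real ((1 - \<sigma>) powr (\<alpha> - 1)) * f (t * \<sigma>)))
     \<le> norm (B * (indicat_real {0<..<1} \<sigma> *\<^sub>R (1 - \<sigma>) powr (\<alpha> - 1)))"
    by (intro AE_I2) (auto simp: indicator_def norm_mult abs_mult mult.commute)
qed

text \<open>On the unit interval the singularity of the kernel stays at 1 while \<open>t\<close>
  moves only the argument of \<open>f\<close>, so dominated convergence works with a majorant
  independent of \<open>t\<close>.\<close>

lemma continuous_on_frac_int:
  assumes "0 < \<alpha>" and [measurable]: "f \<in> borel_measurable borel"
    and "continuous_on {0..} f" and B: "\<And>s. 0 \<le> s \<Longrightarrow> cmod (f s) \<le> B"
  shows "continuous_on {0..} (frac_int \<alpha> f)"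
proof -
  have "continuous_on {0..} (\<lambda>t. LINT \<sigma>:{0<..<1}|lborel. of_real ((1 - \<sigma>) powr (\<alpha> - 1)) * f (t * \<sigma>))"
    unfolding continuous_on_sequentially o_def set_lebesgue_integral_def
  proof safe
    fix X :: "nat \<Rightarrow> real" and t assume t: "0 \<le> t" "\<forall>n. X n \<in> {0..}" "X \<longlonglongrightarrow> t"
    show "(\<lambda>n. LINT \<sigma>|lborel. indicat_real {0<..<1} \<sigma> *\<^sub>R (of_real ((1 - \<sigma>) powr (\<alpha> - 1)) * f (X n * \<sigma>)))
       \<longlonglongrightarrow> (LINT \<sigma>|lborel. indicat_real {0<..<1} \<sigma> *\<^sub>R (of_real ((1 - \<sigma>) powr (\<alpha> - 1)) * f (t * \<sigma>)))"
    proof (rule integral_dominated_convergence)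
      show "integrable lborel (\<lambda>\<sigma>. B * (indicat_real {0<..<1} \<sigma> *\<^sub>R (1 - \<sigma>) powr (\<alpha> - 1)))"
        using integrable_frac_kernel[OF assms(1)] unfolding set_integrable_def by simp
      show "AE \<sigma> in lborel. (\<lambda>n. indicat_real {0<..<1} \<sigma> *\<^sub>R (complex_of_real ((1 - \<sigma>) powr (\<alpha> - 1)) * f (X n * \<sigma>)))
        \<longlonglongrightarrow> indicat_real {0<..<1} \<sigma> *\<^sub>R (complex_of_real ((1 - \<sigma>) powr (\<alpha> - 1)) * f (t * \<sigma>))"
      proof (intro AE_I2)
        fix \<sigma> :: real
        have "(\<lambda>n. f (X n * \<sigma>)) \<longlonglongrightarrow> f (t * \<sigma>)" if "0 < \<sigma>"
          using that t by (intro continuous_on_tendsto_compose[OF assms(3)] tendsto_intros) auto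
        then show "(\<lambda>n. indicat_real {0<..<1} \<sigma> *\<^sub>R (complex_of_real ((1 - \<sigma>) powr (\<alpha> - 1)) * f (X n * \<sigma>)))
          \<longlonglongrightarrow> indicat_real {0<..<1} \<sigma> *\<^sub>R (complex_of_real ((1 - \<sigma>) powr (\<alpha> - 1)) * f (t * \<sigma>))"
          by (cases "0 < \<sigma>") (auto intro!: tendsto_intros)
      qed
      show "AE \<sigma> in lborel. norm (indicat_real {0<..<1} \<sigma> *\<^sub>R (complex_of_real ((1 - \<sigma>) powr (\<alpha> - 1)) * f (X n * \<sigma>)))
        \<le> B * (indicat_real {0<..<1} \<sigma> *\<^sub>R (1 - \<sigma>) powr (\<alpha> - 1))" for n
        using t(2) B by (intro AE_I2) (auto simp: indicator_def norm_mult mult.commute intro!: mult_left_mono)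
    qed measurable
  qed
  moreover have "continuous_on {0..} (\<lambda>t :: real. t powr \<alpha>)"
    using assms(1) by (intro continuous_on_powr' continuous_intros) auto
  ultimately show ?thesis
    unfolding frac_int_def divide_inverse
    by (intro continuous_on_mult continuous_on_of_real continuous_on_const)
qed

lemma powr_le_exp:
  assumes "0 \<le> t" "0 < \<alpha>" "\<alpha> < 1"
  shows "t powr \<alpha> \<le> exp (t :: real)"
proof (cases "t = 0")
  case False
  then have "ln t \<le> t" using assms ln_le_minus_one[of t] by simp
  then have "\<alpha> * ln t \<le> t"
    using assms mult_left_mono[of "ln t" t \<alpha>] mult_right_mono[of \<alpha> 1 t] by linarith
  then show ?thesis using False assms by (simp add: powr_def)
qed (use assms in simp)

text \<open>Growth of exponential order 1 is what \<open>Laplace_zero_imp_zero\<close> asks for; the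
  true growth \<open>t powr \<alpha>\<close> is relaxed to it.\<close>

lemma norm_frac_int_le:
  assumes "0 < \<alpha>" "\<alpha> < 1" "f \<in> borel_measurable borel" "0 \<le> t"
    and B: "\<And>s. 0 \<le> s \<Longrightarrow> cmod (f s) \<le> B"
  shows "cmod (frac_int \<alpha> f t)
           \<le> B / Gamma \<alpha> * (LINT \<sigma>:{0<..<1}|lborel. (1 - \<sigma>) powr (\<alpha> - 1)) * exp t"
proof -
  have G: "0 < Gamma \<alpha>" using assms(1) by (rule Gamma_real_pos)
  have int: "integrable lborel (\<lambda>\<sigma>. B * (indicat_real {0<..<1} \<sigma> *\<^sub>R (1 - \<sigma>) powr (\<alpha> - 1)))"
    using integrable_frac_kernel[OF assms(1)] unfolding set_integrable_def by simp
  have "cmod (LINT \<sigma>:{0<..<1}|lborel. of_real ((1 - \<sigma>) powr (\<alpha> - 1)) * f (t * \<sigma>))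
     \<le> (LINT \<sigma>|lborel. B * (indicat_real {0<..<1} \<sigma> *\<^sub>R (1 - \<sigma>) powr (\<alpha> - 1)))"
    unfolding set_lebesgue_integral_def using assms(4) B
    by (intro Bochner_Integration.integral_norm_bound_integral int
          integrable_frac_kernel_times[OF assms(1,3,4), unfolded set_integrable_def])
       (auto simp: indicator_def norm_mult mult.commute intro!: mult_left_mono)
  also have "\<dots> = B * (LINT \<sigma>:{0<..<1}|lborel. (1 - \<sigma>) powr (\<alpha> - 1))"
    by (simp add: set_lebesgue_integral_def)
  finally have "t powr \<alpha> / Gamma \<alpha> * cmod (LINT \<sigma>:{0<..<1}|lborel. of_real ((1 - \<sigma>) powr (\<alpha> - 1)) * f (t * \<sigma>))
     \<le> exp t / Gamma \<alpha> * (B * (LINT \<sigma>:{0<..<1}|lborel. (1 - \<sigma>) powr (\<alpha> - 1)))"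
    using G powr_le_exp[OF assms(4,1,2)] by (intro mult_mono divide_right_mono) auto
  then show ?thesis
    using G by (simp add: frac_int_def norm_mult norm_divide mult_ac)
qed

section \<open>Convolutions and Laplace transforms of fractional integrals\<close>

lemma integral_convolution:
  fixes a b :: "real \<Rightarrow> complex"
  assumes [measurable]: "integrable lborel a" "integrable lborel b"
  shows "integrable lborel (\<lambda>t. LINT r|lborel. a (t - r) * b r)"
    and "(LINT t|lborel. LINT r|lborel. a (t - r) * b r) = (LINT t|lborel. a t) * (LINT r|lborel. b r)"
proof -
  have [measurable]: "a \<in> borel_measurable borel" "b \<in> borel_measurable borel"
    using assms by (auto dest: borel_measurable_integrable)
  have shift: "integrable lborel (\<lambda>t. f (t - r))" "(LINT t|lborel. f (t - r)) = (LINT t|lborel. f t)"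
    if "integrable lborel f" for f :: "real \<Rightarrow> 'b :: euclidean_space" and r
    using lborel_integrable_real_affine[OF that, of 1 "- r"] lborel_integral_real_affine[of 1 f "- r"] by simp_all
  have "integrable (lborel \<Otimes>\<^sub>M lborel) (\<lambda>(r, t). a (t - r) * b r)"
  proof (rule lborel_pair.Fubini_integrable)
    have "(LINT t|lborel. cmod (a (t - r) * b r)) = (LINT t|lborel. cmod (a t)) * cmod (b r)" for r
      using shift(2)[OF integrable_norm[OF assms(1)]] by (simp add: norm_mult)
    then show "integrable lborel (\<lambda>r. LINT t|lborel. cmod (case (r, t) of (r, t) \<Rightarrow> a (t - r) * b r))"
      using assms by simp
  qed (use shift(1)[OF assms(1)] in auto)
  note I = this
  show "integrable lborel (\<lambda>t. LINT r|lborel. a (t - r) * b r)"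
    using lborel_pair.integrable_snd[OF I] .
  show "(LINT t|lborel. LINT r|lborel. a (t - r) * b r) = (LINT t|lborel. a t) * (LINT r|lborel. b r)"
    using lborel_pair.Fubini_integral[OF I] shift(2)[OF assms(1)] by simp
qed

text \<open>Substitution \<open>s * t\<close> in Euler's integral for \<open>Gamma\<close>. Its case
  \<open>\<alpha> = 1\<close> also supplies the plain exponential majorants used later.\<close>

lemma Gamma_kernel:
  assumes "0 < (\<alpha> :: real)" "0 < s"
  shows "has_bochner_integral lborel (\<lambda>t. indicat_real {0<..} t * (t powr (\<alpha> - 1) * exp (- s * t)))
           (Gamma \<alpha> / s powr \<alpha>)"
proof -
  define f where "f = (\<lambda>t :: real. indicat_real {0<..} t * (t powr (\<alpha> - 1) * exp (- t)))"
  have "(\<integral>\<^sup>+t. ennreal (f t) \<partial>lborel) = (\<integral>\<^sup>+t. ennreal (indicator {0..} t * t powr (\<alpha> - 1) / exp t) \<partial>lborel)"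
    unfolding f_def
    by (intro nn_integral_cong_AE eventually_mono[OF AE_lborel_singleton[of 0]])
       (auto simp: indicator_def exp_minus field_simps)
  then have "has_bochner_integral lborel f (Gamma \<alpha>)"
    using Gamma_conv_nn_integral_real[OF assms(1)] Gamma_real_pos[OF assms(1)]
    by (intro has_bochner_integral_nn_integral) (auto simp: f_def)
  from lborel_has_bochner_integral_real_affine_iff[THEN iffD1, OF _ this, of s 0]
  have "has_bochner_integral lborel (\<lambda>t. f (s * t)) (Gamma \<alpha> / s)"
    using assms by (simp add: divide_inverse mult.commute)
  then have "has_bochner_integral lborel (\<lambda>t. s powr (1 - \<alpha>) * f (s * t)) (s powr (1 - \<alpha>) * (Gamma \<alpha> / s))"
    by (rule has_bochner_integral_mult_right)
  also have "s powr (1 - \<alpha>) * (Gamma \<alpha> / s) = Gamma \<alpha> / s powr \<alpha>"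
    using assms by (simp add: powr_diff)
  also have "(\<lambda>t. s powr (1 - \<alpha>) * f (s * t)) = (\<lambda>t. indicat_real {0<..} t * (t powr (\<alpha> - 1) * exp (- s * t)))"
  proof
    fix t
    have "s powr (1 - \<alpha>) * (s * t) powr (\<alpha> - 1) = t powr (\<alpha> - 1)" if "0 < t"
      using that assms by (simp add: powr_mult mult.assoc[symmetric] powr_add[symmetric])
    then show "s powr (1 - \<alpha>) * f (s * t) = indicat_real {0<..} t * (t powr (\<alpha> - 1) * exp (- s * t))"
      using assms by (auto simp: f_def indicator_def zero_less_mult_iff)
  qed
  finally show ?thesis .
qed

text \<open>The convolution theorem: since \<open>exp (- s * t)\<close> is the product of
  \<open>exp (- s * (t - r))\<close> and \<open>exp (- s * r)\<close>, the weighted fractional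
  integral is, up to the factor \<open>Gamma \<alpha>\<close>, the convolution of the integrable
  functions \<open>a\<close> and \<open>b\<close>.\<close>

lemma Laplace_frac_int:
  assumes "0 < \<alpha>" "0 < s" and [measurable]: "f \<in> borel_measurable borel"
    and B: "\<And>t. 0 < t \<Longrightarrow> cmod (f t) \<le> B"
  shows "set_integrable lborel {0<..} (\<lambda>t. of_real (exp (- s * t)) * frac_int \<alpha> f t)"
    and "(LINT t:{0<..}|lborel. of_real (exp (- s * t)) * frac_int \<alpha> f t)
           = (LINT t:{0<..}|lborel. of_real (exp (- s * t)) * f t) / of_real (s powr \<alpha>)"
proof -
  define a where "a = (\<lambda>t. complex_of_real (indicat_real {0<..} t * (t powr (\<alpha> - 1) * exp (- s * t))))"
  define b where "b = (\<lambda>t. indicat_real {0<..} t *\<^sub>R (of_real (exp (- s * t)) * f t))"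
  have a: "integrable lborel a" "(LINT t|lborel. a t) = of_real (Gamma \<alpha> / s powr \<alpha>)"
    using Gamma_kernel[OF assms(1,2)] unfolding a_def has_bochner_integral_iff integral_complex_of_real
    by (auto intro: integrable_of_real simp del: of_real_mult)
  have b: "integrable lborel b"
  proof (rule Bochner_Integration.integrable_bound)
    show "integrable lborel (\<lambda>t. B * (indicat_real {0<..} t * (t powr (1 - 1) * exp (- s * t))))"
      using Gamma_kernel[of 1 s] assms(2) by (intro integrable_mult_right) (auto simp: has_bochner_integral_iff)
    have "exp (- (s * t)) * cmod (f t) \<le> \<bar>B\<bar> * exp (- (s * t))" if "0 < t" for t
      using that by (subst mult.commute, intro mult_right_mono) (auto intro: order_trans[OF B])
    then show "AE t in lborel. norm (b t) \<le> norm (B * (indicat_real {0<..} t * (t powr (1 - 1) * exp (- s * t))))"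
      by (intro AE_I2) (auto simp: b_def indicator_def norm_mult abs_mult)
  qed (simp add: b_def)
  have G: "Gamma \<alpha> \<noteq> 0" using Gamma_real_pos[OF assms(1)] by simp
  have conv: "(LINT r|lborel. a (t - r) * b r)
      = of_real (Gamma \<alpha>) * (indicat_real {0<..} t *\<^sub>R (of_real (exp (- s * t)) * frac_int \<alpha> f t))" for t
  proof (cases "0 < t")
    case True
    have "(LINT r|lborel. a (t - r) * b r)
      = (LINT r|lborel. of_real (exp (- s * t)) * (indicat_real {0<..<t} r *\<^sub>R (of_real ((t - r) powr (\<alpha> - 1)) * f r)))"
    proof (intro Bochner_Integration.integral_cong refl)
      fix r
      have "exp (- (s * (t - r))) * exp (- (s * r)) = exp (- (s * t))"
        by (simp add: exp_add[symmetric] algebra_simps)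
      then have e: "complex_of_real (exp (- (s * (t - r)))) * of_real (exp (- (s * r))) = of_real (exp (- (s * t)))"
        by (metis of_real_mult)
      show "a (t - r) * b r
        = of_real (exp (- s * t)) * (indicat_real {0<..<t} r *\<^sub>R (of_real ((t - r) powr (\<alpha> - 1)) * f r))"
      proof (cases "r \<in> {0<..<t}")
        case True
        then have "a (t - r) * b r = (of_real (exp (- (s * (t - r)))) * of_real (exp (- (s * r))))
            * (of_real ((t - r) powr (\<alpha> - 1)) * f r)"
          by (simp add: a_def b_def mult_ac)
        then show ?thesis using True unfolding e by simp
      qed (auto simp: a_def b_def indicator_def)
    qed
    also have "\<dots> = of_real (exp (- s * t)) * (LINT r:{0<..<t}|lborel. of_real ((t - r) powr (\<alpha> - 1)) * f r)"
      unfolding set_lebesgue_integral_def by (rule integral_mult_right_zero)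
    finally show ?thesis using True by (simp add: frac_int_eq[OF assms(1)])
  next
    case False
    then have z: "a (t - r) * b r = 0" for r by (auto simp: a_def b_def indicator_def)
    show ?thesis using False by (simp only: z) simp
  qed
  show "set_integrable lborel {0<..} (\<lambda>t. of_real (exp (- s * t)) * frac_int \<alpha> f t)"
  proof -
    define X where "X = (\<lambda>t. indicat_real {0<..} t *\<^sub>R (of_real (exp (- s * t)) * frac_int \<alpha> f t))"
    have "integrable lborel (\<lambda>t. inverse (of_real (Gamma \<alpha>)) * (of_real (Gamma \<alpha>) * X t))"
      using integral_convolution(1)[OF a(1) b] unfolding conv X_def by (rule integrable_mult_right)
    then show ?thesis
      unfolding set_integrable_def X_def[symmetric] using G by (simp add: mult.assoc[symmetric])
  qed
  show "(LINT t:{0<..}|lborel. of_real (exp (- s * t)) * frac_int \<alpha> f t)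
           = (LINT t:{0<..}|lborel. of_real (exp (- s * t)) * f t) / of_real (s powr \<alpha>)"
    using integral_convolution(2)[OF a(1) b] G
    unfolding conv unfolding set_lebesgue_integral_def a(2) b_def integral_mult_right_zero of_real_divide
    by (metis (no_types) mult_left_cancel of_real_eq_0_iff times_divide_eq_left times_divide_eq_right)
qed

text \<open>Bielecki's weighted norm: the maximum \<open>m\<close> of
  \<open>exp (- s * t) * cmod (y t)\<close> is reproduced by the equation with a factor at most
  \<open>cmod \<mu> / s powr \<alpha>\<close>, because the kernel weighted by the exponential has
  total mass \<open>Gamma \<alpha> / s powr \<alpha>\<close>. A factor of one half forces
  \<open>m = 0\<close>.\<close>

lemma Volterra_unique:
  fixes y :: "real \<Rightarrow> complex"
  assumes "0 < \<alpha>" "continuous_on {0..T} y"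
    and eq: "\<And>t. 0 \<le> t \<Longrightarrow> t \<le> T \<Longrightarrow> y t = \<mu> * frac_int \<alpha> y t"
    and "0 \<le> t" "t \<le> T"
  shows "y t = 0"
proof -
  have G: "0 < Gamma \<alpha>" using Gamma_real_pos[OF assms(1)] .
  \<comment> \<open>Chosen so that \<open>cmod \<mu> / s powr \<alpha>\<close> is at most 1/2; the
    summand 1 keeps \<open>s\<close> positive when \<open>\<mu> = 0\<close>.\<close>
  define s where "s = (2 * cmod \<mu> + 1) powr (1 / \<alpha>)"
  have s: "0 < s" "s powr \<alpha> = 2 * cmod \<mu> + 1"
    using assms(1) by (auto simp: s_def powr_powr add_nonneg_eq_0_iff)
  define h where "h = (\<lambda>t. exp (- s * t) * cmod (y t))"
  have "continuous_on {0..T} h"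
    unfolding h_def using assms(2) by (intro continuous_intros)
  then obtain t0 where t0: "t0 \<in> {0..T}" and max: "\<And>t. t \<in> {0..T} \<Longrightarrow> h t \<le> h t0"
    using continuous_attains_sup[of "{0..T}" h] assms(4,5) by fastforce
  define m where "m = h t0"
  have m0: "0 \<le> m" by (simp add: m_def h_def)
  have "m \<le> m / 2"
  proof (cases "t0 = 0")
    case True
    then show ?thesis using eq[of 0] t0 by (simp add: m_def h_def)
  next
    case False
    with t0 have tp: "0 < t0" "t0 \<le> T" by auto
    define k where "k = (\<lambda>r. indicat_real {0<..} r * (r powr (\<alpha> - 1) * exp (- s * r)))"
    have k: "integrable lborel (\<lambda>r. k (t0 - r))" "(LINT r|lborel. k (t0 - r)) = Gamma \<alpha> / s powr \<alpha>"
      using lborel_has_bochner_integral_real_affine_iff[THEN iffD1, OF _ Gamma_kernel[OF assms(1) s(1)], of "-1" t0]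
      by (auto simp: k_def has_bochner_integral_iff)
    have "cmod (LINT r:{0<..<t0}|lborel. of_real ((t0 - r) powr (\<alpha> - 1)) * y r)
        \<le> (LINT r|lborel. (exp (s * t0) * m) * k (t0 - r))"
      unfolding set_lebesgue_integral_def
    proof (rule Bochner_Integration.integral_norm_bound_integral)
      have "(\<lambda>r. indicat_real {0<..<t0} r *\<^sub>R y r) \<in> borel_measurable borel"
        using tp by (intro borel_measurable_continuous_on_indicator continuous_on_subset[OF assms(2)]) auto
      then have meas: "(\<lambda>r. indicat_real {0<..<t0} r *\<^sub>R (of_real ((t0 - r) powr (\<alpha> - 1)) * y r)) \<in> borel_measurable lborel"
        by (simp add: mult_scaleR_right[symmetric] del: mult_scaleR_right)
      show 1: "norm (indicat_real {0<..<t0} r *\<^sub>R (complex_of_real ((t0 - r) powr (\<alpha> - 1)) * y r))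
         \<le> (exp (s * t0) * m) * k (t0 - r)" for r
      proof (cases "r \<in> {0<..<t0}")
        case True
        have "exp (- (s * r)) * cmod (y r) \<le> m" using max[of r] True tp by (simp add: h_def m_def)
        then have "exp (s * r) * (exp (- (s * r)) * cmod (y r)) \<le> exp (s * r) * m"
          by (intro mult_left_mono) auto
        then have "cmod (y r) \<le> exp (s * r) * m" by (simp add: mult.assoc[symmetric] exp_add[symmetric])
        then have "(t0 - r) powr (\<alpha> - 1) * cmod (y r) \<le> (t0 - r) powr (\<alpha> - 1) * (exp (s * r) * m)"
          by (intro mult_left_mono) auto
        also have "exp (s * r) = exp (s * t0) * exp (- s * (t0 - r))"
          by (simp add: exp_add[symmetric] algebra_simps)
        finally show ?thesis using True by (simp add: k_def norm_mult mult_ac)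
      next
        case False
        then show ?thesis using m0 by (auto simp: k_def)
      qed
      show "integrable lborel (\<lambda>r. (exp (s * t0) * m) * k (t0 - r))" using k(1) by simp
      then show "integrable lborel (\<lambda>r. indicat_real {0<..<t0} r *\<^sub>R (complex_of_real ((t0 - r) powr (\<alpha> - 1)) * y r))"
        by (rule Bochner_Integration.integrable_bound) (use meas in simp, intro AE_I2 order_trans[OF 1], simp)
    qed
    also have "\<dots> = exp (s * t0) * m * (Gamma \<alpha> / s powr \<alpha>)" using k(2) by simp
    finally have "cmod (frac_int \<alpha> y t0) \<le> exp (s * t0) * (m / s powr \<alpha>)"
      using G unfolding frac_int_eq[OF assms(1) tp(1)]
      by (subst mult_le_cancel_left_pos[OF G, symmetric]) (simp add: norm_mult mult_ac)
    then have "cmod \<mu> * cmod (frac_int \<alpha> y t0) \<le> cmod \<mu> * (exp (s * t0) * (m / s powr \<alpha>))"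
      by (intro mult_left_mono) auto
    then have "exp (- s * t0) * cmod (y t0) \<le> exp (- s * t0) * (cmod \<mu> * (exp (s * t0) * (m / s powr \<alpha>)))"
      using eq[of t0] tp by (intro mult_left_mono) (auto simp: norm_mult)
    then have "m \<le> cmod \<mu> * (m / s powr \<alpha>)"
      by (simp add: m_def h_def exp_minus field_simps)
    also have "\<dots> \<le> m / 2"
    proof -
      have "0 < 2 * cmod \<mu> + 1" by (simp add: add_nonneg_pos)
      then show ?thesis using m0 by (simp add: s(2) field_simps)
    qed
    finally show ?thesis .
  qed
  then have "m \<le> 0" by simp
  then have "h t \<le> 0" using max[of t] assms(4,5) by (simp add: m_def)
  then show ?thesis by (simp add: h_def mult_le_0_iff)
qed

section \<open>Injectivity of the Laplace transform\<close>

text \<open>Lerch's argument. The vanishing transforms say that \<open>exp (- 2 * t) * h t\<close>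
  is orthogonal on the half line to every polynomial in \<open>exp (- t)\<close>. By Weierstrass the
  function itself, read in the variable \<open>x = exp (- t)\<close>, is a uniform limit of such
  polynomials, hence orthogonal to itself.\<close>

lemma Laplace_zero_imp_zero_real:
  fixes h :: "real \<Rightarrow> real"
  assumes cont: "continuous_on {0..} h" and B: "\<And>t. 0 \<le> t \<Longrightarrow> \<bar>h t\<bar> \<le> B * exp t"
    and zero: "\<And>n::nat. 2 \<le> n \<Longrightarrow> (LINT t:{0<..}|lborel. exp (- real n * t) * h t) = 0"
    and "0 \<le> t"
  shows "h t = 0"
proof -
  have B0: "0 \<le> B" using B[of 0] by simp
  have mh [measurable]: "(\<lambda>t. indicat_real {0<..} t * h t) \<in> borel_measurable borel"
  proof -
    have "continuous_on {0<..} h" by (rule continuous_on_subset[OF cont]) auto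
    from borel_measurable_continuous_on_indicator[OF _ this] show ?thesis by simp
  qed
  define k where "k = (\<lambda>t. indicat_real {0<..} t * (t powr (1 - 1) * exp (- 1 * t)))"
  have k: "integrable lborel k" "(LINT t|lborel. k t) = 1"
    using Gamma_kernel[of 1 1] by (auto simp: k_def has_bochner_integral_iff)
  have bound: "\<bar>indicat_real {0<..} t * (g t * (exp (- 2 * t) * h t))\<bar> \<le> C * B * k t"
    if "\<And>t. 0 < t \<Longrightarrow> \<bar>g t\<bar> \<le> C" for g C t
  proof (cases "0 < t")
    case True
    have "exp (- 2 * t) * \<bar>h t\<bar> \<le> exp (- 2 * t) * (B * exp t)"
      using B[of t] True by (intro mult_left_mono) auto
    also have "\<dots> = B * exp (- t)" by (simp add: exp_add[symmetric] mult.left_commute)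
    finally have e: "exp (- 2 * t) * \<bar>h t\<bar> \<le> B * exp (- t)" .
    have "\<bar>g t\<bar> * (exp (- 2 * t) * \<bar>h t\<bar>) \<le> C * (B * exp (- t))"
      by (rule mult_mono[OF that[OF True] e]) (use that[OF True] in auto)
    then show ?thesis using True by (simp add: k_def abs_mult)
  qed (simp add: k_def)
  have int: "integrable lborel (\<lambda>t. indicat_real {0<..} t * (g t * (exp (- 2 * t) * h t)))"
    if [measurable]: "g \<in> borel_measurable borel" and C: "\<And>t. 0 < t \<Longrightarrow> \<bar>g t\<bar> \<le> C" for g C
  proof (rule Bochner_Integration.integrable_bound)
    show "integrable lborel (\<lambda>t. C * B * k t)" using k by simp
    show "AE t in lborel. norm (indicat_real {0<..} t * (g t * (exp (- 2 * t) * h t))) \<le> norm (C * B * k t)"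
      by (intro AE_I2) (simp only: real_norm_def, rule order_trans[OF bound[OF C] abs_ge_self])
    have "(\<lambda>t. g t * (exp (- 2 * t) * (indicat_real {0<..} t * h t))) \<in> borel_measurable lborel" by measurable
    then show "(\<lambda>t. indicat_real {0<..} t * (g t * (exp (- 2 * t) * h t))) \<in> borel_measurable lborel"
      by (simp add: mult_ac)
  qed
  \<comment> \<open>\<open>\<phi>\<close> is \<open>exp (- 2 * t) * h t\<close> in the variable
    \<open>x = exp (- t)\<close>. The factor \<open>x\<^sup>2\<close> beats the growth of
    \<open>h\<close>, which is at most \<open>B / x\<close>, so that \<open>\<phi>\<close> is
    continuous at 0 with value 0.\<close>
  define \<phi> where "\<phi> = (\<lambda>x. if x \<le> 0 then 0 else x\<^sup>2 * h (- ln x))"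
  have \<phi>_exp: "\<phi> (exp (- t)) = exp (- 2 * t) * h t" for t
    by (simp add: \<phi>_def power2_eq_square exp_add[symmetric])
  have "continuous_on {0..1} \<phi>"
    unfolding continuous_on_eq_continuous_within
  proof
    fix x :: real assume x: "x \<in> {0..1}"
    show "continuous (at x within {0..1}) \<phi>"
    proof (cases "x = 0")
      case True
      have "\<bar>\<phi> y\<bar> \<le> B * \<bar>y\<bar>" if "y \<in> {0..1}" for y
      proof (cases "y = 0")
        case False
        then have y: "0 < y" "y \<le> 1" using that by auto
        have "\<bar>h (- ln y)\<bar> \<le> B / y" using B[of "- ln y"] y by (simp add: exp_minus divide_inverse)
        then have "y\<^sup>2 * \<bar>h (- ln y)\<bar> \<le> y\<^sup>2 * (B / y)" by (intro mult_left_mono) auto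
        also have "\<dots> = B * y" using y by (simp add: power2_eq_square)
        finally show ?thesis using y by (simp add: \<phi>_def abs_mult)
      qed (simp add: \<phi>_def)
      then have "eventually (\<lambda>y. norm (\<phi> y) \<le> B * \<bar>y\<bar>) (at 0 within {0..1})"
        by (auto simp: eventually_at_filter)
      moreover have "((\<lambda>y :: real. B * \<bar>y\<bar>) \<longlongrightarrow> 0) (at 0 within {0..1})"
        by (auto intro!: tendsto_eq_intros)
      ultimately have "(\<phi> \<longlongrightarrow> 0) (at 0 within {0..1})"
        by (rule Lim_null_comparison)
      then show ?thesis using True by (simp add: continuous_within \<phi>_def)
    next
      case False
      then have x: "0 < x" "x \<le> 1" using x by auto
      have "continuous_on {0<..1} (\<lambda>x :: real. x\<^sup>2 * h (- ln x))"
        by (intro continuous_intros continuous_on_compose2[OF cont]) auto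
      then have "continuous_on {0<..1} \<phi>"
        by (rule continuous_on_cong[THEN iffD1, rotated -1]) (auto simp: \<phi>_def)
      then have "continuous (at x within {0<..1}) \<phi>"
        using x by (simp add: continuous_on_eq_continuous_within)
      moreover have "at x within {0<..1} = at x within {0..1}"
        using x by (intro at_within_nhd[of _ "{0<..}"]) auto
      ultimately show ?thesis by (simp add: continuous_within)
    qed
  qed
  note \<phi>_cont = this
  define I where "I = (LINT t|lborel. indicat_real {0<..} t * (\<phi> (exp (- t)) * (exp (- 2 * t) * h t)))"
  obtain C where "\<forall>x\<in>\<phi> ` {0..1}. norm x \<le> C"
    using compact_imp_bounded[OF compact_continuous_image[OF \<phi>_cont]] unfolding bounded_iff by blast
  then have C: "\<And>x. x \<in> {0..1} \<Longrightarrow> \<bar>\<phi> x\<bar> \<le> C" by simp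
  have \<phi>m: "(\<lambda>t. indicat_real {0<..} t * \<phi> (exp (- t))) \<in> borel_measurable borel"
    unfolding \<phi>_exp by (subst mult.left_commute) measurable
  have int\<phi>: "integrable lborel (\<lambda>t. indicat_real {0<..} t * (\<phi> (exp (- t)) * (exp (- 2 * t) * h t)))"
  proof -
    have "integrable lborel (\<lambda>t. indicat_real {0<..} t *
        (indicat_real {0<..} t * \<phi> (exp (- t)) * (exp (- 2 * t) * h t)))"
      by (rule int[OF \<phi>m, of C]) (use C in simp)
    moreover have "indicat_real {0<..} t * (indicat_real {0<..} t * \<phi> (exp (- t)) * (exp (- 2 * t) * h t))
      = indicat_real {0<..} t * (\<phi> (exp (- t)) * (exp (- 2 * t) * h t))" for t
      by (simp add: indicator_def)
    ultimately show ?thesis by (simp only:)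
  qed
  \<comment> \<open>Replacing \<open>\<phi>\<close> by a polynomial \<open>p\<close> costs at most
    \<open>e\<close> times the integral of \<open>B * exp (- t)\<close>, and the polynomial part
    integrates to 0.\<close>
  have "I \<le> e * B" if e: "0 < e" for e
  proof -
    obtain p where p: "real_polynomial_function p" "\<And>x. x \<in> {0..1} \<Longrightarrow> \<bar>\<phi> x - p x\<bar> < e"
      using Stone_Weierstrass_real_polynomial_function[OF compact_Icc \<phi>_cont e] by blast
    then obtain a n where pa: "p = (\<lambda>x. \<Sum>i\<le>n. a i * x ^ i)"
      using real_polynomial_function_iff_sum by auto
    have pow: "integrable lborel (\<lambda>t. indicat_real {0<..} t * (exp (- t) ^ i * (exp (- 2 * t) * h t)))" for i
      by (rule int[of _ 1]) (auto simp: power_le_one)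
    have pow0: "(LINT t|lborel. indicat_real {0<..} t * (exp (- t) ^ i * (exp (- 2 * t) * h t))) = 0" for i
    proof -
      have "exp (- t) ^ i * (exp (- 2 * t) * h t) = exp (- real (i + 2) * t) * h t" for t
        by (simp add: exp_of_nat_mult[symmetric] exp_add[symmetric] algebra_simps)
      then show ?thesis
        using zero[OF le_add2, of i] by (simp only: set_lebesgue_integral_def real_scaleR_def)
    qed
    have psum: "indicat_real {0<..} t * (p (exp (- t)) * (exp (- 2 * t) * h t))
       = (\<Sum>i\<le>n. a i * (indicat_real {0<..} t * (exp (- t) ^ i * (exp (- 2 * t) * h t))))" for t
      by (simp add: pa sum_distrib_left sum_distrib_right mult_ac)
    have pint: "integrable lborel (\<lambda>t. indicat_real {0<..} t * (p (exp (- t)) * (exp (- 2 * t) * h t)))"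
      unfolding psum using pow by simp
    have "(LINT t|lborel. indicat_real {0<..} t * (p (exp (- t)) * (exp (- 2 * t) * h t))) = 0"
      unfolding psum using pow pow0 by (simp add: Bochner_Integration.integral_sum)
    then have "I = (LINT t|lborel. indicat_real {0<..} t * ((\<phi> (exp (- t)) - p (exp (- t))) * (exp (- 2 * t) * h t)))"
      using Bochner_Integration.integral_diff[OF int\<phi> pint] by (simp add: I_def algebra_simps)
    also have "\<dots> \<le> (LINT t|lborel. e * B * k t)"
    proof (rule integral_mono)
      show "integrable lborel (\<lambda>t. indicat_real {0<..} t * ((\<phi> (exp (- t)) - p (exp (- t))) * (exp (- 2 * t) * h t)))"
        using Bochner_Integration.integrable_diff[OF int\<phi> pint] by (simp add: algebra_simps)
      have "\<bar>\<phi> (exp (- t)) - p (exp (- t))\<bar> \<le> e" if "0 < t" for t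
        using p(2)[of "exp (- t)"] that by auto
      from bound[OF this]
      show "indicat_real {0<..} t * ((\<phi> (exp (- t)) - p (exp (- t))) * (exp (- 2 * t) * h t)) \<le> e * B * k t" for t
        by (rule abs_le_D1)
    qed (use k in simp)
    also have "\<dots> = e * B" using k by simp
    finally show ?thesis .
  qed
  note IB = this
  have "I \<le> 0 + e" if "0 < e" for e
  proof -
    have "I \<le> e / (B + 1) * B" by (rule IB) (use \<open>0 < e\<close> B0 in auto)
    also have "\<dots> \<le> e" using \<open>0 < e\<close> B0 by (simp add: field_simps)
    finally show ?thesis by simp
  qed
  then have I0: "I \<le> 0" by (rule field_le_epsilon)
  \<comment> \<open>The integrand of \<open>I\<close> is a square, so \<open>I \<le> 0\<close>
    leaves it no room: on a compact interval a continuous nonnegative function with integral 0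
    vanishes.\<close>
  define q where "q = (\<lambda>t. \<phi> (exp (- t)) * (exp (- 2 * t) * h t))"
  have q: "q t = (exp (- 2 * t) * h t)\<^sup>2" for t
    by (simp only: q_def \<phi>_exp power2_eq_square)
  \<comment> \<open>The summand 1 keeps the interval \<open>{0..R}\<close> nondegenerate when
    \<open>t = 0\<close>.\<close>
  define R where "R = t + 1"
  have qc: "continuous_on {0..R} q"
    unfolding q by (intro continuous_intros continuous_on_subset[OF cont]) auto
  have "integral {0..R} q = (LINT t:{0..R}|lborel. q t)"
    by (rule set_borel_integral_eq_integral(2)[symmetric]) (rule borel_integrable_atLeastAtMost'[OF qc])
  also have "\<dots> \<le> I"
    unfolding I_def set_lebesgue_integral_def
  proof (rule integral_mono_AE)
    show "integrable lborel (\<lambda>t. indicat_real {0..R} t *\<^sub>R q t)"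
      using borel_integrable_atLeastAtMost'[OF qc] by (simp add: set_integrable_def)
    show "AE t in lborel. indicat_real {0..R} t *\<^sub>R q t \<le> indicat_real {0<..} t * (\<phi> (exp (- t)) * (exp (- 2 * t) * h t))"
      using AE_lborel_singleton[of 0] unfolding \<phi>_exp power2_eq_square[symmetric] q
      by eventually_elim (auto simp: indicator_def)
  qed (rule int\<phi>)
  finally have "integral {0..R} q \<le> 0" using I0 by simp
  moreover have "0 \<le> integral {0..R} q"
    using q by (intro integral_nonneg integrable_continuous_real qc) auto
  ultimately have "(q has_integral 0) (cbox 0 R)"
    using integrable_continuous_real[OF qc] by (simp add: has_integral_iff)
  then have "q t = 0"
    by (rule has_integral_0_cbox_imp_0[rotated 2]) (use qc q assms(4) in \<open>auto simp: R_def\<close>)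
  then show ?thesis by (simp add: q)
qed

lemma Laplace_zero_imp_zero:
  fixes h :: "real \<Rightarrow> complex"
  assumes cont: "continuous_on {0..} h" and B: "\<And>t. 0 \<le> t \<Longrightarrow> cmod (h t) \<le> B * exp t"
    and int: "\<And>n::nat. 2 \<le> n \<Longrightarrow> set_integrable lborel {0<..} (\<lambda>t. of_real (exp (- real n * t)) * h t)"
    and zero: "\<And>n::nat. 2 \<le> n \<Longrightarrow> (LINT t:{0<..}|lborel. of_real (exp (- real n * t)) * h t) = 0"
    and "0 \<le> t"
  shows "h t = 0"
proof -
  have "(LINT t:{0<..}|lborel. exp (- real n * t) * Re (h t)) = 0" if "2 \<le> n" for n
    using arg_cong[OF zero[OF that], of Re] int[OF that]
    unfolding set_lebesgue_integral_def set_integrable_def by (subst (asm) integral_Re[symmetric]) auto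
  then have "Re (h t) = 0"
    by (intro Laplace_zero_imp_zero_real[of "\<lambda>t. Re (h t)" B] continuous_intros cont order_trans[OF abs_Re_le_cmod] B assms)
  moreover have "(LINT t:{0<..}|lborel. exp (- real n * t) * Im (h t)) = 0" if "2 \<le> n" for n
    using arg_cong[OF zero[OF that], of Im] int[OF that]
    unfolding set_lebesgue_integral_def set_integrable_def by (subst (asm) integral_Im[symmetric]) auto
  then have "Im (h t) = 0"
    by (intro Laplace_zero_imp_zero_real[of "\<lambda>t. Im (h t)" B] continuous_intros cont order_trans[OF abs_Im_le_cmod] B assms)
  ultimately show ?thesis by (simp add: complex_eq_iff)
qed

section \<open>The kernel of the transient part\<close>

lemma contour_integral_linepath_horizontal:
  assumes "a < b"
  shows "contour_integral (linepath (Complex a c) (Complex b c)) f = integral {a..b} (\<lambda>x. f (Complex x c))"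
proof -
  have "linepath (Complex a c) (Complex b c) = (+) (\<i> * of_real c) \<circ> linepath (of_real a) (of_real b)"
    by (auto simp: fun_eq_iff linepath_def complex_eq_iff algebra_simps)
  then have "contour_integral (linepath (Complex a c) (Complex b c)) f
      = contour_integral (linepath (of_real a) (of_real b)) (\<lambda>w. f (w + \<i> * of_real c))"
    by (simp add: contour_integral_translate)
  also have "\<dots> = integral {a..b} (\<lambda>x. f (of_real x + \<i> * of_real c))"
    using assms by (subst contour_integral_linepath_Reals_eq) auto
  finally show ?thesis by (simp add: Complex_eq)
qed

text \<open>Only the horizontal edges become real integrals, since they carry the jump; the vertical
  edges are left as contour integrals because they will merely be estimated.\<close>

lemma contour_integral_rectpath:
  assumes "a < b" "c < d" and cont: "continuous_on (path_image (rectpath (Complex a c) (Complex b d))) f"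
  shows "contour_integral (rectpath (Complex a c) (Complex b d)) f
    = integral {a..b} (\<lambda>x. f (Complex x c)) - integral {a..b} (\<lambda>x. f (Complex x d))
      + (contour_integral (linepath (Complex b c) (Complex b d)) f
         - contour_integral (linepath (Complex a c) (Complex a d)) f)"
proof -
  have i: "f contour_integrable_on linepath z w"
    if "closed_segment z w \<subseteq> path_image (rectpath (Complex a c) (Complex b d))" for z w
    using that cont by (intro contour_integrable_continuous_linepath continuous_on_subset[OF cont])
  have "f contour_integrable_on linepath (Complex a c) (Complex b c)"
    "f contour_integrable_on linepath (Complex b c) (Complex b d)"
    "f contour_integrable_on linepath (Complex b d) (Complex a d)"
    "f contour_integrable_on linepath (Complex a d) (Complex a c)"
    by (rule i; simp add: rectpath_def Let_def path_image_join subset_eq)+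
  then have "contour_integral (rectpath (Complex a c) (Complex b d)) f
     = contour_integral (linepath (Complex a c) (Complex b c)) f
       + (contour_integral (linepath (Complex b c) (Complex b d)) f
       + (contour_integral (linepath (Complex b d) (Complex a d)) f
       + contour_integral (linepath (Complex a d) (Complex a c)) f))"
    by (simp add: rectpath_def Let_def contour_integrable_join)
  moreover have c: "continuous_on (closed_segment (Complex b d) (Complex a d)) f"
    "continuous_on (closed_segment (Complex a d) (Complex a c)) f"
    by (rule continuous_on_subset[OF cont]; simp add: rectpath_def Let_def path_image_join subset_eq)+
  ultimately show ?thesis
    using assms by (simp add: contour_integral_linepath_horizontal
      contour_integral_reverse_linepath[OF c(1)] contour_integral_reverse_linepath[OF c(2)])
qed

text \<open>\<open>ray_kernel\<close> is the jump (upper minus lower side) of \<open>s powr (\<alpha> - 1) / (s powr \<alpha> - c)\<close>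
  across the cut at \<open>s = - exp x\<close>, times
  \<open>exp x / (2 \<pi> \<i>)\<close>; \<open>ray_denom\<close> is \<open>2 cosh (\<alpha> x + \<i> \<pi> \<alpha> / 2) - 2 cos (\<pi> \<alpha>)\<close>.\<close>

definition ray_denom :: "real \<Rightarrow> real \<Rightarrow> complex" where
  "ray_denom \<alpha> x = Complex (2 * cos (pi * \<alpha> / 2) * cosh (\<alpha> * x) - 2 * cos (pi * \<alpha>))
                            (2 * sin (pi * \<alpha> / 2) * sinh (\<alpha> * x))"

definition ray_kernel :: "real \<Rightarrow> real \<Rightarrow> complex" where
  "ray_kernel \<alpha> x = of_real (sin (pi * \<alpha>) / pi) / ray_denom \<alpha> x"

context
  fixes \<alpha> :: real
  assumes \<alpha>: "0 < \<alpha>" "\<alpha> < 1"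
begin

section \<open>Bounds for the kernel and its Stieltjes transform\<close>

lemma angle_bounds:
  shows "0 < cos (pi * \<alpha> / 2)" "0 < sin (pi * \<alpha> / 2)" "0 < sin (pi * \<alpha>)" "cos (pi * \<alpha>) < cos (pi * \<alpha> / 2)"
proof -
  show "0 < cos (pi * \<alpha> / 2)" using \<alpha> by (intro cos_gt_zero) (auto simp: field_simps)
  show "0 < sin (pi * \<alpha> / 2)" using \<alpha> by (intro sin_gt_zero) (auto simp: field_simps)
  show "0 < sin (pi * \<alpha>)" using \<alpha> by (intro sin_gt_zero) (auto simp: field_simps)
  show "cos (pi * \<alpha>) < cos (pi * \<alpha> / 2)" using \<alpha> by (intro cos_monotone_0_pi) (auto simp: field_simps)
qed

text \<open>As \<open>cosh\<close> is at least 1, twice the gap between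
  \<open>cos (pi * \<alpha> / 2)\<close> and \<open>cos (pi * \<alpha>)\<close> remains. This keeps
  the kernel free of singularities and also gives its real part a sign.\<close>

lemma Re_ray_denom_pos: "0 < Re (ray_denom \<alpha> x)"
proof -
  have "cos (pi * \<alpha> / 2) * 1 \<le> cos (pi * \<alpha> / 2) * cosh (\<alpha> * x)"
    using angle_bounds(1) cosh_real_ge_1 by (intro mult_left_mono) auto
  then show ?thesis using angle_bounds(4) by (simp add: ray_denom_def)
qed

lemma ray_denom_nonzero: "ray_denom \<alpha> x \<noteq> 0"
  using Re_ray_denom_pos[of x] by auto

lemma ray_denom_exp:
  "ray_denom \<alpha> x = of_real (exp (\<alpha> * x)) * cis (pi * \<alpha> / 2) + of_real (exp (- (\<alpha> * x))) * cis (- (pi * \<alpha> / 2))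
     - 2 * of_real (cos (pi * \<alpha>))"
  by (simp add: ray_denom_def complex_eq_iff cosh_def sinh_def algebra_simps)

text \<open>The two factors are the values of \<open>s powr \<alpha> - c\<close> on the lower and
  upper side of the cut at \<open>s = - exp x\<close>; their product is the common denominator of
  the jump.\<close>

lemma ray_denom_factor:
  "(of_real (exp (\<alpha> * x)) * cis (- pi * \<alpha>) - cis (- (pi * \<alpha> / 2))) * (of_real (exp (\<alpha> * x)) * cis (pi * \<alpha>) - cis (- (pi * \<alpha> / 2)))
     = cis (- (pi * \<alpha> / 2)) * of_real (exp (\<alpha> * x)) * ray_denom \<alpha> x"
proof -
  define E c where "E = complex_of_real (exp (\<alpha> * x))" and "c = cis (- (pi * \<alpha> / 2))"
  define E' c' where "E' = complex_of_real (exp (- (\<alpha> * x)))" and "c' = cis (pi * \<alpha> / 2)"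
  have 1: "E * E' = 1" "c * c' = 1" "cis (- pi * \<alpha>) * cis (pi * \<alpha>) = 1"
    by (simp_all add: E_def E'_def c_def c'_def exp_minus cis_mult flip: of_real_mult)
  have 2: "cis (- pi * \<alpha>) + cis (pi * \<alpha>) = 2 * of_real (cos (pi * \<alpha>))"
    by (simp add: complex_eq_iff)
  have "(E * cis (- pi * \<alpha>) - c) * (E * cis (pi * \<alpha>) - c)
      = E * E * (cis (- pi * \<alpha>) * cis (pi * \<alpha>)) - c * E * (cis (- pi * \<alpha>) + cis (pi * \<alpha>)) + c * c"
    by (simp add: algebra_simps)
  also have "\<dots> = c * E * (E * c' + E' * c - 2 * of_real (cos (pi * \<alpha>)))"
    unfolding 1 2 using 1(1,2) by algebra
  finally show ?thesis
    unfolding ray_denom_exp E_def c_def E'_def c'_def .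
qed

lemma norm_ray_kernel_le:
  obtains K where "0 < K" "\<And>x. cmod (ray_kernel \<alpha> x) \<le> K * exp (- \<alpha> * \<bar>x\<bar>)"
proof
  \<comment> \<open>One entry for each sign of \<open>cos (pi * \<alpha>)\<close>: a nonnegative one
    is enlarged to \<open>cos (pi * \<alpha>) * cosh (\<alpha> * x)\<close> and subtracted, a
    negative one only helps and is dropped.\<close>
  define m where "m = min (cos (pi * \<alpha> / 2) - cos (pi * \<alpha>)) (cos (pi * \<alpha> / 2))"
  have m: "0 < m" using angle_bounds by (auto simp: m_def)
  show "0 < sin (pi * \<alpha>) / pi / m" using m angle_bounds by simp
  fix x
  have C: "1 \<le> cosh (\<alpha> * x)" by (rule cosh_real_ge_1)
  have "m * cosh (\<alpha> * x) \<le> cos (pi * \<alpha> / 2) * cosh (\<alpha> * x) - cos (pi * \<alpha>)"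
  proof (cases "0 \<le> cos (pi * \<alpha>)")
    case True
    then have "cos (pi * \<alpha>) * 1 \<le> cos (pi * \<alpha>) * cosh (\<alpha> * x)" using C by (intro mult_left_mono)
    moreover have "m * cosh (\<alpha> * x) \<le> (cos (pi * \<alpha> / 2) - cos (pi * \<alpha>)) * cosh (\<alpha> * x)"
      using C by (intro mult_right_mono) (auto simp: m_def)
    ultimately show ?thesis by (simp add: algebra_simps)
  next
    case False
    moreover have "m * cosh (\<alpha> * x) \<le> cos (pi * \<alpha> / 2) * cosh (\<alpha> * x)"
      using C by (intro mult_right_mono) (auto simp: m_def)
    ultimately show ?thesis by linarith
  qed
  moreover have "exp (\<alpha> * \<bar>x\<bar>) \<le> 2 * cosh (\<alpha> * x)"
    by (cases "0 \<le> x") (auto simp: cosh_def)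
  then have "m * exp (\<alpha> * \<bar>x\<bar>) \<le> m * (2 * cosh (\<alpha> * x))" using m by (intro mult_left_mono) auto
  ultimately have "m * exp (\<alpha> * \<bar>x\<bar>) \<le> Re (ray_denom \<alpha> x)" by (simp add: ray_denom_def)
  also have "\<dots> \<le> cmod (ray_denom \<alpha> x)" by (rule complex_Re_le_cmod)
  finally have "sin (pi * \<alpha>) / pi / cmod (ray_denom \<alpha> x) \<le> sin (pi * \<alpha>) / pi / (m * exp (\<alpha> * \<bar>x\<bar>))"
    using m angle_bounds by (intro divide_left_mono mult_pos_pos) (auto simp: ray_denom_nonzero)
  then show "cmod (ray_kernel \<alpha> x) \<le> sin (pi * \<alpha>) / pi / m * exp (- \<alpha> * \<bar>x\<bar>)"
  proof -
    have "sin (pi * \<alpha>) / pi / (m * exp (\<alpha> * \<bar>x\<bar>)) = sin (pi * \<alpha>) / pi / m * exp (- \<alpha> * \<bar>x\<bar>)"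
      by (simp add: exp_minus divide_inverse)
    moreover assume "sin (pi * \<alpha>) / pi / cmod (ray_denom \<alpha> x) \<le> sin (pi * \<alpha>) / pi / (m * exp (\<alpha> * \<bar>x\<bar>))"
    moreover have "cmod (ray_kernel \<alpha> x) = sin (pi * \<alpha>) / pi / cmod (ray_denom \<alpha> x)"
      using angle_bounds(3) unfolding ray_kernel_def norm_divide norm_of_real by simp
    ultimately show ?thesis by simp
  qed
qed

lemma continuous_ray_kernel [continuous_intros]: "continuous_on A (ray_kernel \<alpha>)"
proof -
  have "continuous_on A (\<lambda>x. of_real (sin (pi * \<alpha>) / pi) / (of_real (2 * cos (pi * \<alpha> / 2) * cosh (\<alpha> * x) - 2 * cos (pi * \<alpha>))
     + \<i> * of_real (2 * sin (pi * \<alpha> / 2) * sinh (\<alpha> * x))))"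
    using ray_denom_nonzero by (intro continuous_intros) (auto simp: ray_denom_def Complex_eq)
  then show ?thesis by (simp add: ray_kernel_def[abs_def] ray_denom_def Complex_eq)
qed

lemma ray_kernel_measurable [measurable]: "ray_kernel \<alpha> \<in> borel_measurable borel"
  by (rule borel_measurable_continuous_onI) (rule continuous_ray_kernel)

lemma integrable_ray_kernel: "integrable lborel (ray_kernel \<alpha>)"
proof -
  obtain K where K: "0 < K" "\<And>x. cmod (ray_kernel \<alpha> x) \<le> K * exp (- \<alpha> * \<bar>x\<bar>)"
    using norm_ray_kernel_le by blast
  have "((\<lambda>x. exp (- \<alpha> * x)) has_integral exp (- \<alpha> * 0) / \<alpha>) {0..}"
    using \<alpha> by (intro has_integral_exp_minus_to_infinity) auto
  then have "set_integrable lebesgue {0..} (\<lambda>x. exp (- \<alpha> * x))"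
    by (intro nonnegative_absolutely_integrable_1) (auto simp: integrable_on_def)
  then have 1: "integrable lborel (\<lambda>x. indicat_real {0..} x *\<^sub>R exp (- \<alpha> * x))"
    unfolding set_integrable_def by (subst (asm) integrable_completion) auto
  from lborel_integrable_real_affine[OF this, of "-1" 0]
  have "integrable lborel (\<lambda>x. indicat_real {0..} (- x) *\<^sub>R exp (- \<alpha> * - x))" by simp
  from Bochner_Integration.integrable_add[OF 1 this]
  show ?thesis
  proof (rule Bochner_Integration.integrable_bound[OF integrable_mult_right[of K]])
    have "cmod (ray_kernel \<alpha> x) \<le> \<bar>K * (indicat_real {0..} x *\<^sub>R exp (- \<alpha> * x) + indicat_real {0..} (- x) *\<^sub>R exp (- \<alpha> * - x))\<bar>" for x
      by (rule order_trans[OF K(2)]) (use K(1) in \<open>auto simp: indicator_def abs_mult abs_if\<close>)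
    then show "AE x in lborel. cmod (ray_kernel \<alpha> x)
       \<le> norm (K * (indicat_real {0..} x *\<^sub>R exp (- \<alpha> * x) + indicat_real {0..} (- x) *\<^sub>R exp (- \<alpha> * - x)))"
      by simp
  qed measurable
qed


text \<open>The strip must contain the band of half-width \<open>pi\<close> swept by the contour,
  yet hold no further poles. Its half-width \<open>3 * pi / 2\<close> does both: the distance in
  imaginary part to \<open>w0\<close> and to \<open>w1\<close> stays below \<open>2 * pi\<close>,
  where \<open>exp\<close> determines its argument. Under \<open>exp\<close>, the point
  \<open>w0\<close> is \<open>s\<close> and \<open>w1\<close> is \<open>- \<i>\<close>, the pole
  responsible for the oscillating part of the solution.\<close>

lemma Stieltjes_integrand_residues:
  fixes s :: real
  assumes s: "0 < s"
  defines "c \<equiv> cis (- (pi * \<alpha> / 2))"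
  defines "\<Phi> \<equiv> \<lambda>w. exp (of_real \<alpha> * w) / ((exp (of_real \<alpha> * w) - c) * (exp w - of_real s))"
    and "S \<equiv> {w :: complex. \<bar>Im w\<bar> < 3 * pi / 2}"
    and "w0 \<equiv> complex_of_real (ln s)" and "w1 \<equiv> - (\<i> * of_real (pi / 2))"
  shows "open S" "convex S" "w0 \<in> S" "w1 \<in> S" "w0 \<noteq> w1" "\<Phi> holomorphic_on S - {w0, w1}"
    and "residue \<Phi> w0 = of_real (s powr \<alpha>) / ((of_real (s powr \<alpha>) - c) * of_real s)"
    and "residue \<Phi> w1 = - 1 / (of_real \<alpha> * (of_real s + \<i>))"
proof -
  have S_eq: "S = {w. Im w < 3 * pi / 2} \<inter> {w. Im w > - (3 * pi / 2)}" by (auto simp: S_def)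
  show S: "open S" "convex S"
    unfolding S_eq by (intro open_Int open_halfspace_Im_lt open_halfspace_Im_gt convex_Int convex_halfspace_Im_lt convex_halfspace_Im_gt)+
  show wS: "w0 \<in> S" "w1 \<in> S" and ne: "w0 \<noteq> w1" by (auto simp: S_def w0_def w1_def complex_eq_iff)
  have e0: "exp w0 = of_real s" using s by (simp add: w0_def exp_of_real)
  have e1: "exp w1 = - \<i>"
    unfolding w1_def by (simp add: exp_minus cis_conv_exp[symmetric] del: of_real_divide)
  have ea0: "exp (of_real \<alpha> * w0) = of_real (s powr \<alpha>)"
    using s by (simp add: w0_def powr_def exp_of_real flip: of_real_mult)
  have c_exp: "c = exp (\<i> * of_real (- (pi * \<alpha> / 2)))"
    by (simp add: c_def cis_conv_exp)
  have ea1: "exp (of_real \<alpha> * w1) = c"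
    unfolding c_exp by (rule arg_cong[of _ _ exp]) (simp add: w1_def)
  have z0: "w = w0" if "w \<in> S" "exp w = of_real s" for w
  proof (rule exp_complex_eqI)
    have "\<bar>Im w\<bar> < 3 * pi / 2" using that(1) by (simp add: S_def)
    then show "\<bar>Im w - Im w0\<bar> < 2 * pi"
      using pi_gt_zero unfolding w0_def Im_complex_of_real by linarith
  qed (simp add: that e0)
  have z1: "w = w1" if "w \<in> S" "exp (of_real \<alpha> * w) = c" for w
  proof -
    have "of_real \<alpha> * w = of_real \<alpha> * w1"
    proof (rule exp_complex_eqI)
      show "exp (of_real \<alpha> * w) = exp (of_real \<alpha> * w1)" using that ea1 by simp
      have "\<bar>Im w\<bar> < 3 * pi / 2" using that(1) by (simp add: S_def)
      then have "\<bar>Im w + pi / 2\<bar> < 2 * pi" using pi_gt_zero by linarith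
      then have "\<alpha> * \<bar>Im w + pi / 2\<bar> < 1 * (2 * pi)" using \<alpha> by (intro mult_strict_mono) auto
      then show "\<bar>Im (of_real \<alpha> * w) - Im (of_real \<alpha> * w1)\<bar> < 2 * pi"
      proof -
        assume "\<alpha> * \<bar>Im w + pi / 2\<bar> < 1 * (2 * pi)"
        moreover have "Im (of_real \<alpha> * w) - Im (of_real \<alpha> * w1) = \<alpha> * (Im w + pi / 2)"
          by (simp add: w1_def algebra_simps)
        ultimately show ?thesis using \<alpha> by (simp add: abs_mult)
      qed
    qed
    then show ?thesis using \<alpha> by simp
  qed
  have n0: "exp w - of_real s \<noteq> 0" if "w \<in> S - {w0}" for w using that z0 by auto
  have n1: "exp (of_real \<alpha> * w) - c \<noteq> 0" if "w \<in> S - {w1}" for w using that z1 by auto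
  show hol: "\<Phi> holomorphic_on S - {w0, w1}"
    unfolding \<Phi>_def using n0 n1 by (intro holomorphic_intros) auto
  \<comment> \<open>The inverted difference quotient of \<open>exp (a * w)\<close>. Both poles are
    simple and get their residue from it, with \<open>a = 1\<close> at \<open>w0\<close> and
    \<open>a = \<alpha>\<close> at \<open>w1\<close>.\<close>
  have lim: "((\<lambda>w. (w - z) / (exp (a * w) - exp (a * z))) \<longlongrightarrow> 1 / (a * exp (a * z))) (at z)" if "a \<noteq> 0" for a z :: complex
  proof -
    have "((\<lambda>w. exp (a * w)) has_field_derivative exp (a * z) * a) (at z)"
      by (auto intro!: derivative_eq_intros)
    then have "((\<lambda>w. inverse ((exp (a * w) - exp (a * z)) / (w - z))) \<longlongrightarrow> inverse (exp (a * z) * a)) (at z)"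
      using that by (intro tendsto_inverse) (auto simp: has_field_derivative_iff)
    then show ?thesis by (simp add: divide_inverse mult_ac)
  qed
  show "residue \<Phi> w0 = of_real (s powr \<alpha>) / ((of_real (s powr \<alpha>) - c) * of_real s)"
  proof (rule residue_simple'[of "S - {w1}"])
    have nz: "exp (of_real \<alpha> * w0) - c \<noteq> 0" using n1 wS ne by auto
    have "((\<lambda>w. exp (of_real \<alpha> * w) / (exp (of_real \<alpha> * w) - c) * ((w - w0) / (exp (1 * w) - exp (1 * w0))))
       \<longlongrightarrow> exp (of_real \<alpha> * w0) / (exp (of_real \<alpha> * w0) - c) * (1 / (1 * exp (1 * w0)))) (at w0)"
      using nz by (intro tendsto_intros lim) auto
    then show "((\<lambda>w. \<Phi> w * (w - w0)) \<longlongrightarrow> of_real (s powr \<alpha>) / ((of_real (s powr \<alpha>) - c) * of_real s)) (at w0)"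
      by (simp add: \<Phi>_def e0 ea0)
    show "\<Phi> holomorphic_on S - {w1} - {w0}" using hol by (simp add: Diff_insert2[symmetric] insert_commute)
  qed (use S wS ne in auto)
  show "residue \<Phi> w1 = - 1 / (of_real \<alpha> * (of_real s + \<i>))"
  proof (rule residue_simple'[of "S - {w0}"])
    have nz: "exp w1 - of_real s \<noteq> 0" using n0 wS ne by auto
    have "((\<lambda>w. exp (of_real \<alpha> * w) / (exp w - of_real s) * ((w - w1) / (exp (of_real \<alpha> * w) - c)))
       \<longlongrightarrow> exp (of_real \<alpha> * w1) / (exp w1 - of_real s) * (1 / (of_real \<alpha> * c))) (at w1)"
      using nz \<alpha> by (intro tendsto_intros lim[of "of_real \<alpha>" w1, unfolded ea1]) auto
    moreover have "exp (of_real \<alpha> * w1) / (exp w1 - of_real s) * (1 / (of_real \<alpha> * c))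
        = - 1 / (of_real \<alpha> * (of_real s + \<i>))"
    proof -
      have "of_real s + \<i> \<noteq> 0" by (simp add: complex_eq_iff)
      moreover have "- \<i> \<noteq> of_real s" by (simp add: complex_eq_iff)
      moreover have "- \<i> - of_real s = - (of_real s + \<i>)" by simp
      moreover have "c \<noteq> 0" by (simp add: c_def)
      ultimately show ?thesis unfolding e1 ea1 using \<alpha> by (simp add: divide_simps)
    qed
    ultimately show "((\<lambda>w. \<Phi> w * (w - w1)) \<longlongrightarrow> - 1 / (of_real \<alpha> * (of_real s + \<i>))) (at w1)"
      by (simp add: \<Phi>_def mult_ac)
    show "\<Phi> holomorphic_on S - {w0} - {w1}" using hol by (simp add: Diff_insert2[symmetric])
  qed (use S wS ne in auto)
qed


text \<open>On both lines \<open>exp w\<close> equals \<open>- exp x\<close>, so the Cauchy factor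
  is common and the jump comes from \<open>exp (\<alpha> w)\<close> alone;
  \<open>ray_denom_factor\<close> then merges the denominators.\<close>

lemma Stieltjes_integrand_jump:
  fixes s :: real
  assumes s: "0 < s"
  defines "c \<equiv> cis (- (pi * \<alpha> / 2))"
  defines "\<Phi> \<equiv> \<lambda>w. exp (of_real \<alpha> * w) / ((exp (of_real \<alpha> * w) - c) * (exp w - of_real s))"
  shows "\<Phi> (Complex x (- pi)) - \<Phi> (Complex x pi)
           = - (2 * of_real pi * \<i>) * (ray_kernel \<alpha> x / of_real (s + exp x))"
proof -
  define E where "E = complex_of_real (exp (\<alpha> * x))"
  define p q where "p = E * cis (- pi * \<alpha>)" and "q = E * cis (pi * \<alpha>)"
  have ex: "exp (Complex x y) = of_real (exp x) * cis y" for x y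
    by (simp add: Complex_eq exp_add cis_conv_exp exp_of_real)
  have "of_real \<alpha> * Complex x (- pi) = Complex (\<alpha> * x) (- pi * \<alpha>)" "of_real \<alpha> * Complex x pi = Complex (\<alpha> * x) (pi * \<alpha>)"
    by (simp_all add: complex_eq_iff)
  then have a: "exp (of_real \<alpha> * Complex x (- pi)) = p" "exp (of_real \<alpha> * Complex x pi) = q"
    by (simp_all only: ex p_def q_def E_def)
  have "cis (- pi) = - 1" by (simp add: complex_eq_iff)
  then have b: "exp (Complex x (- pi)) - of_real s = - of_real (s + exp x)" "exp (Complex x pi) - of_real s = - of_real (s + exp x)"
    by (simp_all add: ex)
  define r where "r = complex_of_real (s + exp x)"
  have r: "r \<noteq> 0" using s by (simp add: r_def add_nonneg_eq_0_iff del: of_real_add)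
  have f: "(p - c) * (q - c) = c * E * ray_denom \<alpha> x"
    using ray_denom_factor[of x] by (simp add: p_def q_def c_def E_def)
  have nz: "c \<noteq> 0" "E \<noteq> 0" "ray_denom \<alpha> x \<noteq> 0" using ray_denom_nonzero by (auto simp: c_def E_def)
  then have pq: "p - c \<noteq> 0" "q - c \<noteq> 0" using f by force+
  have qp: "q - p = 2 * \<i> * of_real (sin (pi * \<alpha>)) * E"
    by (simp add: p_def q_def complex_eq_iff E_def algebra_simps)
  have "\<Phi> (Complex x (- pi)) - \<Phi> (Complex x pi) = p / ((p - c) * (- r)) - q / ((q - c) * (- r))"
    unfolding \<Phi>_def a b r_def ..
  also have "\<dots> = - (c * (q - p)) / ((p - c) * (q - c) * r)"
    using pq r by (simp add: divide_simps) (simp add: algebra_simps)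
  also have "\<dots> = - (2 * \<i> * of_real (sin (pi * \<alpha>))) / (ray_denom \<alpha> x * r)"
    unfolding f qp using nz r by (simp add: divide_simps)
  also have "\<dots> = - (2 * of_real pi * \<i>) * (ray_kernel \<alpha> x / r)"
    using nz r by (simp add: ray_kernel_def divide_simps)
  finally show ?thesis by (simp only: r_def)
qed

lemma integrable_ray_kernel_over:
  assumes "0 < s"
  shows "integrable lborel (\<lambda>x. ray_kernel \<alpha> x / of_real (s + exp x))"
proof (rule Bochner_Integration.integrable_bound)
  show "integrable lborel (\<lambda>x. ray_kernel \<alpha> x / of_real s)" using integrable_ray_kernel by simp
  have "cmod (ray_kernel \<alpha> x) / \<bar>s + exp x\<bar> \<le> cmod (ray_kernel \<alpha> x) / \<bar>s\<bar>" for x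
    using assms by (intro divide_left_mono) (auto intro!: mult_pos_pos add_pos_pos)
  then show "AE x in lborel. norm (ray_kernel \<alpha> x / of_real (s + exp x)) \<le> norm (ray_kernel \<alpha> x / of_real s)"
    by (simp add: norm_divide del: of_real_add)
qed measurable

text \<open>The Cauchy integral of \<open>s powr (\<alpha> - 1) / (s powr \<alpha> - c)\<close> along the cut, in the logarithmic variable \<open>w\<close>,
  where the two sides of the cut become the lines \<open>Im w = - \<pi>\<close> and \<open>Im w = \<pi>\<close>. The residues are taken at
  \<open>w = ln s\<close> and at the only zero of \<open>exp (\<alpha> w) - c\<close> in the strip.\<close>

lemma ray_kernel_Stieltjes:
  assumes s: "0 < s"
  shows "(LINT x|lborel. ray_kernel \<alpha> x / of_real (s + exp x))
     = 1 / (of_real \<alpha> * (of_real s + \<i>))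
       - of_real (s powr \<alpha>) / ((of_real (s powr \<alpha>) - cis (- (pi * \<alpha> / 2))) * of_real s)"
proof -
  define c where "c = cis (- (pi * \<alpha> / 2))"
  define \<Phi> where "\<Phi> = (\<lambda>w. exp (of_real \<alpha> * w) / ((exp (of_real \<alpha> * w) - c) * (exp w - of_real s)))"
  define S where "S = {w :: complex. \<bar>Im w\<bar> < 3 * pi / 2}"
  define w0 w1 where "w0 = complex_of_real (ln s)" and "w1 = - (\<i> * of_real (pi / 2))"
  note res = Stieltjes_integrand_residues[OF s, folded c_def, folded \<Phi>_def, folded S_def, folded w0_def w1_def]
  \<comment> \<open>The sum of the two residues, equal to minus the claimed value of the
    integral.\<close>
  define X where "X = of_real (s powr \<alpha>) / ((of_real (s powr \<alpha>) - c) * of_real s) - 1 / (of_real \<alpha> * (of_real s + \<i>))"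
  define f where "f = (\<lambda>x. ray_kernel \<alpha> x / of_real (s + exp x))"
  \<comment> \<open>Exceeding \<open>\<bar>ln s\<bar>\<close> puts \<open>w0\<close> inside the
    rectangle and keeps \<open>exp w\<close> away from \<open>s\<close> on the vertical
    edges.\<close>
  define Rn where "Rn = (\<lambda>n :: nat. real n + \<bar>ln s\<bar> + 1)"
  have cn: "cmod c = 1" by (simp add: c_def)
  \<comment> \<open>Bounds for \<open>\<Phi>\<close> on the right edge (\<open>V1\<close>) and on
    the left edge (\<open>V2\<close>), from the reverse triangle inequality and
    \<open>cmod c = 1\<close>. They decay like \<open>exp (- R)\<close> and
    \<open>exp (- \<alpha> * R)\<close>.\<close>
  define V1 where "V1 = (\<lambda>R :: real. exp (\<alpha> * R) / ((exp (\<alpha> * R) - 1) * (exp R - s)))"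
  define V2 where "V2 = (\<lambda>R :: real. exp (- \<alpha> * R) / ((1 - exp (- \<alpha> * R)) * (s - exp (- R))))"
  have main: "cmod (- (2 * of_real pi * \<i>) * integral {-R..R} f - 2 * of_real pi * \<i> * X) \<le> V1 R * (2 * pi) + V2 R * (2 * pi)"
    if R: "\<bar>ln s\<bar> < R" for R
  proof -
    have R0: "0 < R" using R by linarith
    define g where "g = rectpath (Complex (-R) (-pi)) (Complex R pi)"
    have box: "w0 \<in> box (Complex (-R) (-pi)) (Complex R pi)" "w1 \<in> box (Complex (-R) (-pi)) (Complex R pi)"
    proof -
      have "Re w0 = ln s" "Im w0 = 0" "Re w1 = 0" "Im w1 = - (pi / 2)"
        by (simp_all add: w0_def w1_def)
      then show "w0 \<in> box (Complex (-R) (-pi)) (Complex R pi)" "w1 \<in> box (Complex (-R) (-pi)) (Complex R pi)"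
        unfolding in_box_complex_iff complex.sel greaterThanLessThan_iff
        using R R0 pi_gt_zero by (intro conjI; linarith)+
    qed
    have im: "path_image g = cbox (Complex (-R) (-pi)) (Complex R pi) - box (Complex (-R) (-pi)) (Complex R pi)"
      unfolding g_def using R0 by (intro path_image_rectpath_cbox_minus_box) auto
    have cS: "cbox (Complex (-R) (-pi)) (Complex R pi) \<subseteq> S"
      using pi_gt_zero by (auto simp: in_cbox_complex_iff S_def abs_less_iff simp del: pi_gt_zero)
    have imS: "path_image g \<subseteq> S - {w0, w1}" using im cS box by auto
    have cont: "continuous_on (path_image g) \<Phi>"
      using holomorphic_on_imp_continuous_on[OF res(6)] imS by (rule continuous_on_subset)
    have "contour_integral g \<Phi> = 2 * pi * \<i> * (\<Sum>p\<in>{w0, w1}. winding_number g p * residue \<Phi> p)"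
    proof (rule Residue_theorem[OF res(1) convex_connected[OF res(2)] _ res(6) _ _ imS])
      show "\<forall>z. z \<notin> S \<longrightarrow> winding_number g z = 0"
        using cS R0 unfolding g_def by (auto intro!: winding_number_rectpath_outside)
    qed (auto simp: g_def)
    also have "\<dots> = 2 * of_real pi * \<i> * X"
      using res(5) winding_number_rectpath[OF box(1)] winding_number_rectpath[OF box(2)]
      by (simp add: g_def res(7,8) X_def)
    finally have 1: "contour_integral g \<Phi> = 2 * of_real pi * \<i> * X" .
    have seg: "Complex x (- pi) \<in> path_image g" "Complex x pi \<in> path_image g" if "x \<in> {-R..R}" for x
      using that R0 unfolding im by (auto simp: in_cbox_complex_iff in_box_complex_iff)
    have vert: "closed_segment (Complex a (-pi)) (Complex a pi) \<subseteq> path_image g" if "a \<in> {-R, R}" for a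
      using that R0 unfolding im by (auto simp: closed_segment_same_Re in_cbox_complex_iff in_box_complex_iff closed_segment_eq_real_ivl)
    have "(\<lambda>x. \<Phi> (Complex x (- pi))) integrable_on {-R..R}" "(\<lambda>x. \<Phi> (Complex x pi)) integrable_on {-R..R}"
      using seg by (intro integrable_continuous_real continuous_on_compose2[OF cont]; auto simp: Complex_eq intro!: continuous_intros)+
    then have "integral {-R..R} (\<lambda>x. \<Phi> (Complex x (- pi))) - integral {-R..R} (\<lambda>x. \<Phi> (Complex x pi))
       = integral {-R..R} (\<lambda>x. \<Phi> (Complex x (- pi)) - \<Phi> (Complex x pi))"
      by (simp add: Henstock_Kurzweil_Integration.integral_diff)
    also have "\<dots> = - (2 * of_real pi * \<i>) * integral {-R..R} f"
    proof -
      have "\<Phi> (Complex x (- pi)) - \<Phi> (Complex x pi) = - (2 * of_real pi * \<i>) * f x" for x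
        using Stieltjes_integrand_jump[OF s, of x] by (simp only: \<Phi>_def c_def f_def)
      then show ?thesis by (simp only: Henstock_Kurzweil_Integration.integral_mult_right)
    qed
    finally have A: "integral {-R..R} (\<lambda>x. \<Phi> (Complex x (- pi))) - integral {-R..R} (\<lambda>x. \<Phi> (Complex x pi))
       = - (2 * of_real pi * \<i>) * integral {-R..R} f" .
    have B: "2 * of_real pi * \<i> * X = (integral {-R..R} (\<lambda>x. \<Phi> (Complex x (- pi))) - integral {-R..R} (\<lambda>x. \<Phi> (Complex x pi)))
       + (contour_integral (linepath (Complex R (-pi)) (Complex R pi)) \<Phi>
         - contour_integral (linepath (Complex (-R) (-pi)) (Complex (-R) pi)) \<Phi>)"
      unfolding 1[symmetric] g_def using cont R0 by (intro contour_integral_rectpath) (auto simp: g_def)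
    have 2: "- (2 * of_real pi * \<i>) * integral {-R..R} f - 2 * of_real pi * \<i> * X
       = contour_integral (linepath (Complex (-R) (-pi)) (Complex (-R) pi)) \<Phi>
         - contour_integral (linepath (Complex R (-pi)) (Complex R pi)) \<Phi>"
      using B unfolding A by (simp add: algebra_simps)
    have len: "cmod (Complex a pi - Complex a (- pi)) = 2 * pi" for a
    proof -
      have "Complex a pi - Complex a (- pi) = of_real (2 * pi) * \<i>" by (simp add: complex_eq_iff)
      then show ?thesis by (simp only: norm_mult norm_of_real) simp
    qed
    have i: "\<Phi> contour_integrable_on linepath (Complex a (-pi)) (Complex a pi)" if "a \<in> {-R, R}" for a
      using vert[OF that] by (intro contour_integrable_continuous_linepath continuous_on_subset[OF cont])
    have sR: "s < exp R" "exp (- R) < s"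
      using R s exp_less_cancel_iff[of "ln s" R] exp_less_cancel_iff[of "- R" "ln s"] by auto
    have aR: "1 < exp (\<alpha> * R)" "exp (- \<alpha> * R) < 1" using \<alpha> R0 by auto
    have "cmod (\<Phi> w) \<le> V1 R" if "w \<in> closed_segment (Complex R (-pi)) (Complex R pi)" for w
    proof -
      have w: "Re w = R" using that by (auto simp: closed_segment_same_Re)
      have "cmod (exp (of_real \<alpha> * w)) - cmod c \<le> cmod (exp (of_real \<alpha> * w) - c)" by (rule norm_triangle_ineq2)
      moreover have "cmod (exp w) - cmod (of_real s) \<le> cmod (exp w - of_real s)" by (rule norm_triangle_ineq2)
      ultimately show ?thesis
        using sR aR s cn w unfolding \<Phi>_def V1_def norm_divide norm_mult
        by (intro frac_le mult_mono) (auto simp: norm_exp_eq_Re)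
    qed
    moreover have V1: "0 \<le> V1 R" using sR aR by (simp add: V1_def)
    ultimately have b1: "cmod (contour_integral (linepath (Complex R (-pi)) (Complex R pi)) \<Phi>) \<le> V1 R * (2 * pi)"
      using contour_integral_bound_linepath[OF i, of R "V1 R"] by (simp add: len)
    have "cmod (\<Phi> w) \<le> V2 R" if "w \<in> closed_segment (Complex (-R) (-pi)) (Complex (-R) pi)" for w
    proof -
      have w: "Re w = - R" using that by (auto simp: closed_segment_same_Re)
      have "cmod c - cmod (exp (of_real \<alpha> * w)) \<le> cmod (exp (of_real \<alpha> * w) - c)" by (subst norm_minus_commute) (rule norm_triangle_ineq2)
      moreover have "cmod (of_real s) - cmod (exp w) \<le> cmod (exp w - of_real s)" by (subst norm_minus_commute) (rule norm_triangle_ineq2)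
      ultimately show ?thesis
        using sR aR s cn w unfolding \<Phi>_def V2_def norm_divide norm_mult
        by (intro frac_le mult_mono) (auto simp: norm_exp_eq_Re)
    qed
    moreover have V2: "0 \<le> V2 R" using sR aR by (simp add: V2_def)
    ultimately have b2: "cmod (contour_integral (linepath (Complex (-R) (-pi)) (Complex (-R) pi)) \<Phi>) \<le> V2 R * (2 * pi)"
      using contour_integral_bound_linepath[OF i, of "-R" "V2 R"] by (simp add: len)
    show ?thesis unfolding 2 using b1 b2 norm_triangle_ineq4 order_trans by (smt (verit))
  qed
  have fi: "integrable lborel f" unfolding f_def using s by (rule integrable_ray_kernel_over)
  have Rtop: "filterlim Rn at_top sequentially" unfolding Rn_def by real_asymp
  have "(\<lambda>n. integral {- Rn n..Rn n} f) \<longlonglongrightarrow> (LINT x|lborel. f x)"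
  proof -
    have "(\<lambda>n. LINT x|lborel. indicat_real {- Rn n..Rn n} x *\<^sub>R f x) \<longlonglongrightarrow> (LINT x|lborel. f x)"
    proof (rule integral_dominated_convergence)
      show "integrable lborel (\<lambda>x. cmod (f x))" using fi by simp
      show "AE x in lborel. (\<lambda>n. indicat_real {- Rn n..Rn n} x *\<^sub>R f x) \<longlonglongrightarrow> f x"
      proof (intro AE_I2 tendsto_eventually)
        fix x
        have "eventually (\<lambda>n. \<bar>x\<bar> \<le> Rn n) sequentially"
          using Rtop by (simp add: filterlim_at_top)
        then show "eventually (\<lambda>n. indicat_real {- Rn n..Rn n} x *\<^sub>R f x = f x) sequentially"
          by eventually_elim (auto simp: abs_le_iff)
      qed
    qed (use fi in \<open>auto intro!: AE_I2 simp: indicator_def\<close>)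
    moreover have "(LINT x|lborel. indicat_real {- Rn n..Rn n} x *\<^sub>R f x) = integral {- Rn n..Rn n} f" for n
    proof -
      have "set_integrable lborel {- Rn n..Rn n} f"
        unfolding set_integrable_def by (rule integrable_mult_indicator) (use fi in auto)
      from set_borel_integral_eq_integral(2)[OF this] show ?thesis by (simp add: set_lebesgue_integral_def)
    qed
    ultimately show ?thesis by simp
  qed
  then have "(\<lambda>n. - (2 * of_real pi * \<i>) * integral {- Rn n..Rn n} f - 2 * of_real pi * \<i> * X)
     \<longlonglongrightarrow> - (2 * of_real pi * \<i>) * (LINT x|lborel. f x) - 2 * of_real pi * \<i> * X"
    by (intro tendsto_intros)
  moreover have "(\<lambda>n. - (2 * of_real pi * \<i>) * integral {- Rn n..Rn n} f - 2 * of_real pi * \<i> * X) \<longlonglongrightarrow> 0"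
  proof (rule Lim_null_comparison)
    show "eventually (\<lambda>n. cmod (- (2 * of_real pi * \<i>) * integral {- Rn n..Rn n} f - 2 * of_real pi * \<i> * X)
       \<le> V1 (Rn n) * (2 * pi) + V2 (Rn n) * (2 * pi)) sequentially"
      by (intro always_eventually allI main) (simp add: Rn_def)
    have "((\<lambda>R. V1 R * (2 * pi) + V2 R * (2 * pi)) \<longlongrightarrow> 0) at_top"
      unfolding V1_def V2_def using \<alpha> s by real_asymp
    then show "(\<lambda>n. V1 (Rn n) * (2 * pi) + V2 (Rn n) * (2 * pi)) \<longlonglongrightarrow> 0"
      using Rtop by (rule filterlim_compose)
  qed
  ultimately have "- (2 * of_real pi * \<i>) * (LINT x|lborel. f x) - 2 * of_real pi * \<i> * X = 0"
    by (rule LIMSEQ_unique)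
  moreover have "- (2 * of_real pi * \<i>) * (LINT x|lborel. f x) - 2 * of_real pi * \<i> * X
     = - (2 * of_real pi * \<i>) * ((LINT x|lborel. f x) + X)" by (simp add: algebra_simps)
  ultimately have "- (2 * of_real pi * \<i>) * ((LINT x|lborel. f x) + X) = 0" by (simp only:)
  then have "(LINT x|lborel. f x) = - X" by (simp add: add_eq_0_iff)
  then show ?thesis by (simp add: f_def X_def c_def)
qed

end

section \<open>The solution of the scalar equation\<close>

definition ray_transient :: "real \<Rightarrow> real \<Rightarrow> complex" where
  "ray_transient \<alpha> t = (LINT x|lborel. of_real (exp (- t * exp x)) * ray_kernel \<alpha> x)"

definition ray_solution :: "real \<Rightarrow> real \<Rightarrow> complex" where
  "ray_solution \<alpha> t = cis (- t) / of_real \<alpha> - ray_transient \<alpha> t"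

section \<open>Laplace transforms of the oscillating and the transient part\<close>

lemma Laplace_exp:
  assumes "0 < a"
  shows "has_bochner_integral lborel (\<lambda>t. indicat_real {0<..} t * exp (- a * t)) (1 / a)"
proof -
  have "(\<lambda>t. indicat_real {0<..} t * (t powr (1 - 1) * exp (- a * t))) = (\<lambda>t. indicat_real {0<..} t * exp (- a * t))"
    by (auto simp: indicator_def)
  then show ?thesis using Gamma_kernel[of 1 a] assms by simp
qed

lemma Laplace_cis:
  assumes s: "0 < s"
  shows "set_integrable lborel {0<..} (\<lambda>t. of_real (exp (- s * t)) * cis (- t))"
    and "(LINT t:{0<..}|lborel. of_real (exp (- s * t)) * cis (- t)) = 1 / (of_real s + \<i>)"
proof -
  define f where "f = (\<lambda>t. of_real (exp (- s * t)) * cis (- t))"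
  define w where "w = of_real s + \<i>"
  have w: "w \<noteq> 0" by (simp add: w_def complex_eq_iff)
  have f: "f t = exp (- w * of_real t)" for t
    by (simp add: f_def w_def cis_conv_exp exp_of_real[symmetric] exp_add[symmetric] algebra_simps)
  have fc: "continuous_on A f" for A unfolding f by (intro continuous_intros)
  have [measurable]: "f \<in> borel_measurable borel" by (rule borel_measurable_continuous_onI) (rule fc)
  have nf: "cmod (f t) = exp (- s * t)" for t by (simp add: f_def norm_mult)
  have k: "integrable lborel (\<lambda>t. indicat_real {0<..} t * exp (- s * t))"
    using Laplace_exp[OF s] by (simp add: has_bochner_integral_iff)
  have "set_integrable lborel {0<..} f"
    unfolding set_integrable_def
    by (rule Bochner_Integration.integrable_bound[OF k]) (auto simp: nf indicator_def)
  then show "set_integrable lborel {0<..} (\<lambda>t. of_real (exp (- s * t)) * cis (- t))"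
    by (simp only: f_def)
  have "(\<lambda>n. LINT t|lborel. indicat_real {0..real n} t *\<^sub>R f t) \<longlonglongrightarrow> (LINT t|lborel. indicat_real {0<..} t *\<^sub>R f t)"
  proof (rule integral_dominated_convergence[OF _ _ k])
    show "AE t in lborel. (\<lambda>n. indicat_real {0..real n} t *\<^sub>R f t) \<longlonglongrightarrow> indicat_real {0<..} t *\<^sub>R f t"
      using AE_lborel_singleton[of 0]
    proof eventually_elim
      case (elim t)
      have "eventually (\<lambda>n. t \<le> real n) sequentially"
        by (rule eventually_sequentiallyI[of "nat \<lceil>t\<rceil>"]) linarith
      then have "eventually (\<lambda>n. indicat_real {0..real n} t *\<^sub>R f t = indicat_real {0<..} t *\<^sub>R f t) sequentially"
        using elim by (auto elim!: eventually_mono simp: indicator_def)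
      then show ?case by (rule tendsto_eventually)
    qed
    show "AE t in lborel. norm (indicat_real {0..real n} t *\<^sub>R f t) \<le> indicat_real {0<..} t * exp (- s * t)" for n
      using AE_lborel_singleton[of 0] by eventually_elim (auto simp: indicator_def nf)
  qed measurable
  moreover have "(LINT t|lborel. indicat_real {0..real n} t *\<^sub>R f t) = (- exp (- w * of_real (real n)) / w) - (- exp (- w * of_real 0) / w)" for n
  proof (rule integral_FTC_atLeastAtMost)
    show "((\<lambda>t. - exp (- w * of_real t) / w) has_vector_derivative f t) (at t within {0..real n})" for t
      unfolding f using w
      by (auto intro!: derivative_eq_intros has_vector_derivative_real_field simp: field_simps)
  qed (auto intro: fc)
  ultimately have A: "(\<lambda>n. - exp (- w * of_real (real n)) / w - (- exp (- w * of_real 0) / w))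
     \<longlonglongrightarrow> (LINT t|lborel. indicat_real {0<..} t *\<^sub>R f t)" by simp
  have "(\<lambda>n. exp (- w * of_real (real n))) \<longlonglongrightarrow> 0"
  proof (rule Lim_null_comparison)
    show "eventually (\<lambda>n. cmod (exp (- w * of_real (real n))) \<le> exp (- s * real n)) sequentially"
      by (simp add: norm_exp_eq_Re w_def)
    show "(\<lambda>n. exp (- s * real n)) \<longlonglongrightarrow> 0" using s by real_asymp
  qed
  then have "(\<lambda>n. - exp (- w * of_real (real n)) / w - (- exp (- w * of_real 0) / w)) \<longlonglongrightarrow> - 0 / w - (- exp (- w * of_real 0) / w)"
    by (intro tendsto_intros w)
  from LIMSEQ_unique[OF A this]
  show "(LINT t:{0<..}|lborel. of_real (exp (- s * t)) * cis (- t)) = 1 / (of_real s + \<i>)"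
    by (simp add: set_lebesgue_integral_def f_def w_def)
qed

context
  fixes \<alpha> :: real
  assumes \<alpha>: "0 < \<alpha>" "\<alpha> < 1"
begin

lemmas ker_meas [measurable] = ray_kernel_measurable[OF \<alpha>]
lemmas ker_int = integrable_ray_kernel[OF \<alpha>]

lemma ray_transient_measurable [measurable]: "ray_transient \<alpha> \<in> borel_measurable borel"
  unfolding ray_transient_def[abs_def] by measurable

lemma norm_transient_integrand_le:
  assumes "0 \<le> t" shows "cmod (of_real (exp (- t * exp x)) * ray_kernel \<alpha> x) \<le> cmod (ray_kernel \<alpha> x)"
  using assms by (simp add: norm_mult mult_left_le_one_le)

lemma integrable_transient_integrand:
  assumes "0 \<le> t" shows "integrable lborel (\<lambda>x. of_real (exp (- t * exp x)) * ray_kernel \<alpha> x)"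
  by (rule Bochner_Integration.integrable_bound[OF ker_int])
     (use norm_transient_integrand_le[OF assms] in auto)

lemma norm_ray_transient_le:
  assumes "0 \<le> t" shows "cmod (ray_transient \<alpha> t) \<le> (LINT x|lborel. cmod (ray_kernel \<alpha> x))"
  unfolding ray_transient_def
  by (rule Bochner_Integration.integral_norm_bound_integral[OF integrable_transient_integrand[OF assms]])
     (use ker_int norm_transient_integrand_le[OF assms] in auto)

lemma continuous_on_ray_transient: "continuous_on {0..} (ray_transient \<alpha>)"
  unfolding continuous_on_sequentially o_def ray_transient_def
proof safe
  fix X :: "nat \<Rightarrow> real" and t assume t: "0 \<le> t" "\<forall>n. X n \<in> {0..}" "X \<longlonglongrightarrow> t"
  show "(\<lambda>n. LINT x|lborel. of_real (exp (- X n * exp x)) * ray_kernel \<alpha> x)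
    \<longlonglongrightarrow> (LINT x|lborel. of_real (exp (- t * exp x)) * ray_kernel \<alpha> x)"
  proof (rule integral_dominated_convergence)
    show "integrable lborel (\<lambda>x. cmod (ray_kernel \<alpha> x))" using ker_int by simp
    show "AE x in lborel. (\<lambda>n. of_real (exp (- X n * exp x)) * ray_kernel \<alpha> x) \<longlonglongrightarrow> of_real (exp (- t * exp x)) * ray_kernel \<alpha> x"
      using t by (intro AE_I2 tendsto_intros)
    show "AE x in lborel. norm (of_real (exp (- X n * exp x)) * ray_kernel \<alpha> x) \<le> cmod (ray_kernel \<alpha> x)" for n
      using t by (intro AE_I2 norm_transient_integrand_le) auto
  qed measurable
qed

text \<open>Integrating \<open>exp (- (s + exp x) * t)\<close> over \<open>t\<close> first turns the
  Laplace transform of the transient part into the Stieltjes transform of its kernel, which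
  \<open>ray_kernel_Stieltjes\<close> evaluates.\<close>

lemma Laplace_ray_transient:
  assumes s: "0 < s"
  shows "set_integrable lborel {0<..} (\<lambda>t. of_real (exp (- s * t)) * ray_transient \<alpha> t)"
    and "(LINT t:{0<..}|lborel. of_real (exp (- s * t)) * ray_transient \<alpha> t)
       = (LINT x|lborel. ray_kernel \<alpha> x / of_real (s + exp x))"
proof -
  define F where "F = (\<lambda>x t. of_real (indicat_real {0<..} t * exp (- (s + exp x) * t)) * ray_kernel \<alpha> x)"
  have L: "has_bochner_integral lborel (\<lambda>t. indicat_real {0<..} t * exp (- (s + exp x) * t)) (1 / (s + exp x))" for x
    using s by (intro Laplace_exp add_pos_pos) auto
  have L1: "integrable lborel (\<lambda>t. complex_of_real (indicat_real {0<..} t * exp (- (s + exp x) * t)))"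
    "(LINT t|lborel. complex_of_real (indicat_real {0<..} t * exp (- (s + exp x) * t))) = of_real (1 / (s + exp x))" for x
    using L[of x] unfolding integral_complex_of_real has_bochner_integral_iff
    by (auto intro: integrable_of_real simp del: of_real_mult)
  have intF: "(LINT t|lborel. F x t) = ray_kernel \<alpha> x / of_real (s + exp x)" for x
    unfolding F_def using L1[of x] by (simp add: divide_inverse del: of_real_mult of_real_add)
  have I: "integrable (lborel \<Otimes>\<^sub>M lborel) (\<lambda>(x, t). F x t)"
  proof (rule lborel_pair.Fubini_integrable)
    have "(LINT t|lborel. cmod (F x t)) = cmod (ray_kernel \<alpha> x / of_real (s + exp x))" for x
    proof -
      have "(LINT t|lborel. cmod (F x t)) = (LINT t|lborel. (indicat_real {0<..} t * exp (- (s + exp x) * t)) * cmod (ray_kernel \<alpha> x))"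
        by (simp add: F_def norm_mult abs_mult)
      also have "\<dots> = 1 / (s + exp x) * cmod (ray_kernel \<alpha> x)"
        using L[of x] by (simp add: has_bochner_integral_iff)
      also have "\<dots> = cmod (ray_kernel \<alpha> x / of_real (s + exp x))"
        using s add_pos_pos[of s "exp x"] by (simp add: norm_divide del: of_real_add)
      finally show ?thesis .
    qed
    then show "integrable lborel (\<lambda>x. LINT t|lborel. cmod (case (x, t) of (x, t) \<Rightarrow> F x t))"
      using integrable_norm[OF integrable_ray_kernel_over[OF \<alpha> s]] by simp
    show "AE x in lborel. integrable lborel (\<lambda>t. case (x, t) of (x, t) \<Rightarrow> F x t)"
      using L1(1) by (simp add: F_def del: of_real_mult)
  qed (simp add: F_def case_prod_beta')
  have Ft: "(LINT x|lborel. F x t) = indicat_real {0<..} t *\<^sub>R (of_real (exp (- s * t)) * ray_transient \<alpha> t)" for t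
  proof (cases "0 < t")
    case True
    have "F x t = of_real (exp (- s * t)) * (of_real (exp (- t * exp x)) * ray_kernel \<alpha> x)" for x
    proof -
      have "exp (- (s + exp x) * t) = exp (- s * t) * exp (- t * exp x)"
        by (simp add: exp_add[symmetric] algebra_simps)
      then show ?thesis using True by (simp add: F_def)
    qed
    then show ?thesis using True by (simp add: ray_transient_def)
  qed (simp add: F_def)
  show "set_integrable lborel {0<..} (\<lambda>t. of_real (exp (- s * t)) * ray_transient \<alpha> t)"
    using lborel_pair.integrable_snd[OF I] unfolding Ft set_integrable_def .
  show "(LINT t:{0<..}|lborel. of_real (exp (- s * t)) * ray_transient \<alpha> t)
       = (LINT x|lborel. ray_kernel \<alpha> x / of_real (s + exp x))"
    using lborel_pair.Fubini_integral[OF I] unfolding Ft intF set_lebesgue_integral_def .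
qed

lemma ray_solution_measurable [measurable]: "ray_solution \<alpha> \<in> borel_measurable borel"
proof -
  have [measurable]: "(\<lambda>t. cis (- t)) \<in> borel_measurable borel"
    by (intro borel_measurable_continuous_onI continuous_intros)
  show ?thesis unfolding ray_solution_def[abs_def] by measurable
qed

lemma continuous_on_ray_solution: "continuous_on {0..} (ray_solution \<alpha>)"
  unfolding ray_solution_def using \<alpha> by (intro continuous_intros continuous_on_ray_transient) auto

lemma ray_solution_bounded:
  obtains B where "0 \<le> B" "\<And>t. 0 \<le> t \<Longrightarrow> cmod (ray_solution \<alpha> t) \<le> B"
proof
  show "0 \<le> 1 / \<alpha> + (LINT x|lborel. cmod (ray_kernel \<alpha> x))" using \<alpha> by (simp add: integral_nonneg)
  fix t :: real assume "0 \<le> t"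
  then have "cmod (ray_transient \<alpha> t) \<le> (LINT x|lborel. cmod (ray_kernel \<alpha> x))" by (rule norm_ray_transient_le)
  moreover have "cmod (cis (- t) / of_real \<alpha>) = 1 / \<alpha>" using \<alpha> by (simp add: norm_divide)
  ultimately show "cmod (ray_solution \<alpha> t) \<le> 1 / \<alpha> + (LINT x|lborel. cmod (ray_kernel \<alpha> x))"
    unfolding ray_solution_def using norm_triangle_ineq4[of "cis (- t) / of_real \<alpha>" "ray_transient \<alpha> t"] by linarith
qed

text \<open>The transform \<open>1 / (\<alpha> (s + \<i>))\<close> of the oscillating part cancels
  the residue at \<open>w1\<close>. What is left is
  \<open>s powr (\<alpha> - 1) / (s powr \<alpha> - c)\<close>, the transform known for the
  Mittag-Leffler solution.\<close>

lemma Laplace_ray_solution: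
  assumes s: "0 < s"
  shows "set_integrable lborel {0<..} (\<lambda>t. of_real (exp (- s * t)) * ray_solution \<alpha> t)"
    and "(LINT t:{0<..}|lborel. of_real (exp (- s * t)) * ray_solution \<alpha> t)
       = of_real (s powr \<alpha>) / ((of_real (s powr \<alpha>) - cis (- (pi * \<alpha> / 2))) * of_real s)"
proof -
  have eq: "(\<lambda>t. of_real (exp (- s * t)) * ray_solution \<alpha> t)
     = (\<lambda>t. of_real (1 / \<alpha>) * (of_real (exp (- s * t)) * cis (- t)) - of_real (exp (- s * t)) * ray_transient \<alpha> t)"
    by (auto simp: ray_solution_def algebra_simps)
  have c: "set_integrable lborel {0<..} (\<lambda>t. complex_of_real (1 / \<alpha>) * (of_real (exp (- s * t)) * cis (- t)))"
    by (rule set_integrable_mult_right) (rule Laplace_cis[OF s])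
  show "set_integrable lborel {0<..} (\<lambda>t. of_real (exp (- s * t)) * ray_solution \<alpha> t)"
    unfolding eq by (intro set_integral_diff c Laplace_ray_transient[OF s])
  have "(LINT t:{0<..}|lborel. of_real (exp (- s * t)) * ray_solution \<alpha> t)
     = of_real (1 / \<alpha>) * (1 / (of_real s + \<i>)) - (LINT x|lborel. ray_kernel \<alpha> x / of_real (s + exp x))"
    unfolding eq set_integral_diff(2)[OF c Laplace_ray_transient(1)[OF s]] Laplace_ray_transient(2)[OF s]
    unfolding set_integral_mult_right Laplace_cis(2)[OF s] ..
  then show "(LINT t:{0<..}|lborel. of_real (exp (- s * t)) * ray_solution \<alpha> t)
       = of_real (s powr \<alpha>) / ((of_real (s powr \<alpha>) - cis (- (pi * \<alpha> / 2))) * of_real s)"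
    unfolding ray_kernel_Stieltjes[OF \<alpha> s] by simp
qed

text \<open>With \<open>P = s powr \<alpha>\<close> the equation for the transforms is the identity
  of \<open>P / ((P - c) s)\<close> and \<open>1 / s + c / ((P - c) s)\<close>. It is used at the
  integers from 2 on, where injectivity of the transform applies.\<close>

lemma ray_solution_Volterra:
  assumes "0 \<le> t"
  shows "ray_solution \<alpha> t = 1 + cis (- (pi * \<alpha> / 2)) * frac_int \<alpha> (ray_solution \<alpha>) t"
proof -
  define c where "c = cis (- (pi * \<alpha> / 2))"
  define h where "h = (\<lambda>t. ray_solution \<alpha> t - 1 - c * frac_int \<alpha> (ray_solution \<alpha>) t)"
  obtain B where B: "0 \<le> B" "\<And>t. 0 \<le> t \<Longrightarrow> cmod (ray_solution \<alpha> t) \<le> B" using ray_solution_bounded by blast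
  have "h t = 0"
  proof (rule Laplace_zero_imp_zero[OF _ _ _ _ assms])
    show "continuous_on {0..} h"
      unfolding h_def using \<alpha>(1) B(2)
      by (intro continuous_intros continuous_on_ray_solution continuous_on_frac_int ray_solution_measurable)
    define C where "C = B / Gamma \<alpha> * (LINT \<sigma>:{0<..<1}|lborel. (1 - \<sigma>) powr (\<alpha> - 1))"
    show "cmod (h t) \<le> (B + 1 + C) * exp t" if "0 \<le> t" for t
    proof -
      have "cmod (h t) \<le> cmod (ray_solution \<alpha> t) + cmod 1 + cmod (c * frac_int \<alpha> (ray_solution \<alpha>) t)"
        unfolding h_def by (intro norm_triangle_le_diff add_mono order_refl) 
      also have "\<dots> \<le> B + 1 + C * exp t"
        using B(2)[OF that] norm_frac_int_le[OF \<alpha> ray_solution_measurable that B(2)]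
        by (simp add: norm_mult c_def C_def)
      also have "\<dots> \<le> (B + 1) * exp t + C * exp t"
        using mult_left_mono[of 1 "exp t" "B + 1"] B(1) that by simp
      finally show ?thesis by (simp add: algebra_simps)
    qed
    fix n :: nat assume n: "2 \<le> n"
    define s where "s = real n"
    have s: "0 < s" "1 < s" using n by (auto simp: s_def)
    have one: "set_integrable lborel {0<..} (\<lambda>t. complex_of_real (exp (- s * t)))"
       "(LINT t:{0<..}|lborel. complex_of_real (exp (- s * t))) = of_real (1 / s)"
    proof -
      have e: "(\<lambda>t. indicat_real {0<..} t *\<^sub>R complex_of_real (exp (- s * t))) = (\<lambda>t. complex_of_real (indicat_real {0<..} t * exp (- s * t)))"
        by (simp add: scaleR_conv_of_real)
      show "set_integrable lborel {0<..} (\<lambda>t. complex_of_real (exp (- s * t)))"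
        unfolding set_integrable_def e using Laplace_exp[OF s(1)]
        by (intro integrable_of_real) (simp add: has_bochner_integral_iff)
      show "(LINT t:{0<..}|lborel. complex_of_real (exp (- s * t))) = of_real (1 / s)"
        unfolding set_lebesgue_integral_def e integral_complex_of_real using Laplace_exp[OF s(1)]
        by (simp add: has_bochner_integral_iff)
    qed
    note sol = Laplace_ray_solution[OF s(1)]
    have fr: "set_integrable lborel {0<..} (\<lambda>t. of_real (exp (- s * t)) * frac_int \<alpha> (ray_solution \<alpha>) t)"
      "(LINT t:{0<..}|lborel. of_real (exp (- s * t)) * frac_int \<alpha> (ray_solution \<alpha>) t)
        = (LINT t:{0<..}|lborel. of_real (exp (- s * t)) * ray_solution \<alpha> t) / of_real (s powr \<alpha>)"
      using Laplace_frac_int[OF \<alpha>(1) s(1) ray_solution_measurable, of B] B(2) by auto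
    have eq: "(\<lambda>t. of_real (exp (- s * t)) * h t) = (\<lambda>t. (of_real (exp (- s * t)) * ray_solution \<alpha> t
        - complex_of_real (exp (- s * t))) - c * (of_real (exp (- s * t)) * frac_int \<alpha> (ray_solution \<alpha>) t))"
      by (auto simp: h_def algebra_simps)
    have d: "set_integrable lborel {0<..} (\<lambda>t. of_real (exp (- s * t)) * ray_solution \<alpha> t - complex_of_real (exp (- s * t)))"
      "set_integrable lborel {0<..} (\<lambda>t. c * (of_real (exp (- s * t)) * frac_int \<alpha> (ray_solution \<alpha>) t))"
      by (intro set_integral_diff sol one set_integrable_mult_right fr)+
    show "set_integrable lborel {0<..} (\<lambda>t. of_real (exp (- real n * t)) * h t)"
      unfolding s_def[symmetric] eq by (intro set_integral_diff d)
    define P where "P = complex_of_real (s powr \<alpha>)"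
    \<comment> \<open>As \<open>c\<close> has modulus 1, this keeps \<open>P - c\<close> away from
      0.\<close>
    have "1 < s powr \<alpha>" using s \<alpha> by (simp add: powr_def)
    then have P: "P \<noteq> 0" "P - c \<noteq> 0"
      using norm_of_real[of "s powr \<alpha>", where 'a = complex] by (auto simp: P_def c_def dest!: arg_cong[of _ _ cmod])
    have "(LINT t:{0<..}|lborel. of_real (exp (- s * t)) * h t)
       = P / ((P - c) * of_real s) - of_real (1 / s) - c * (P / ((P - c) * of_real s) / P)"
      unfolding eq set_integral_diff(2)[OF d] set_integral_diff(2)[OF sol(1) one(1)] one(2)
      unfolding set_integral_mult_right fr(2) sol(2) P_def c_def ..
    also have "\<dots> = 0"
      using P s by (simp add: divide_simps)
    finally show "(LINT t:{0<..}|lborel. of_real (exp (- real n * t)) * h t) = 0"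
      unfolding s_def .
  qed
  then show ?thesis unfolding h_def c_def by (simp add: diff_eq_eq add.commute)
qed

end

section \<open>A lower bound\<close>

context
  fixes \<alpha> :: real
  assumes \<alpha>: "0 < \<alpha>" "\<alpha> < 1"
begin

text \<open>The real part of the kernel is even and the imaginary part odd, because only
  \<open>sinh\<close> changes sign. The estimates on half lines below rest on this.\<close>

lemma ray_kernel_minus: "ray_kernel \<alpha> (- x) = cnj (ray_kernel \<alpha> x)"
proof -
  have "ray_denom \<alpha> (- x) = cnj (ray_denom \<alpha> x)" by (simp add: ray_denom_def complex_eq_iff)
  then show ?thesis by (simp add: ray_kernel_def)
qed

lemma Re_ray_kernel_nonneg: "0 \<le> Re (ray_kernel \<alpha> x)"
  using Re_ray_denom_pos[OF \<alpha>, of x] angle_bounds(3)[OF \<alpha>] unfolding ray_kernel_def Re_divide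
  by simp

text \<open>With \<open>\<theta> = pi * \<alpha> / 2\<close> the denominator vanishes where
  \<open>\<alpha> x + \<i> \<theta>\<close> is plus or minus \<open>2 \<i> \<theta>\<close>, that
  is, at complex \<open>x\<close> with \<open>cosh (\<alpha> x)\<close> equal to
  \<open>cos \<theta>\<close> or \<open>cos (3 \<theta>)\<close>. Hence its squared modulus factors
  as a quadratic in \<open>cosh (\<alpha> x)\<close>, and partial fractions make the imaginary part
  a logarithmic derivative.\<close>

lemma Im_ray_kernel_eq:
  "Im (ray_kernel \<alpha> x) = - (sinh (\<alpha> * x) / (4 * pi)) *
     (1 / (cosh (\<alpha> * x) - cos (pi * \<alpha> / 2)) - 1 / (cosh (\<alpha> * x) - cos (3 * (pi * \<alpha> / 2))))"
  and cosh_minus_cos_pos: "0 < cosh (\<alpha> * x) - cos (pi * \<alpha> / 2)" "0 < cosh (\<alpha> * x) - cos (3 * (pi * \<alpha> / 2))"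
proof -
  define k l C S where "k = cos (pi * \<alpha> / 2)" and "l = sin (pi * \<alpha> / 2)" and "C = cosh (\<alpha> * x)" and "S = sinh (\<alpha> * x)"
  have kl: "l\<^sup>2 = 1 - k\<^sup>2" by (simp add: k_def l_def sin_squared_eq)
  have CS: "S\<^sup>2 = C\<^sup>2 - 1" by (simp add: C_def S_def sinh_square_eq)
  have C1: "1 \<le> C" by (simp add: C_def cosh_real_ge_1)
  have c2: "cos (pi * \<alpha>) = 2 * k\<^sup>2 - 1" using cos_double_cos[of "pi * \<alpha> / 2"] by (simp add: k_def)
  have s2: "sin (pi * \<alpha>) = 2 * l * k" using sin_double[of "pi * \<alpha> / 2"] by (simp add: k_def l_def)
  have c3: "cos (3 * (pi * \<alpha> / 2)) = 4 * k ^ 3 - 3 * k" by (simp only: cos_treble_cos k_def)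
  have k: "0 < k" "0 < l" using angle_bounds[OF \<alpha>] by (simp_all add: k_def l_def)
  have "k < 1"
  proof -
    have "k\<^sup>2 < 1" using kl k by (smt (verit) zero_less_power)
    then show ?thesis using k by (simp add: power2_less_1_iff abs_square_less_1)
  qed
  then have Ck: "0 < C - k" using C1 by simp
  have "1 - (4 * k ^ 3 - 3 * k) = (1 - k) * (1 + 2 * k)\<^sup>2" by (simp add: algebra_simps power2_eq_square power3_eq_cube)
  moreover have "0 < (1 - k) * (1 + 2 * k)\<^sup>2" using \<open>k < 1\<close> k by (intro mult_pos_pos) auto
  ultimately have Ck3: "0 < C - (4 * k ^ 3 - 3 * k)" using C1 by linarith
  show "0 < cosh (\<alpha> * x) - cos (pi * \<alpha> / 2)" "0 < cosh (\<alpha> * x) - cos (3 * (pi * \<alpha> / 2))"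
    using Ck Ck3 by (simp_all only: c3 C_def k_def)
  have den: "ray_denom \<alpha> x = Complex (2 * k * C - 2 * (2 * k\<^sup>2 - 1)) (2 * l * S)"
    unfolding ray_denom_def c2 k_def l_def C_def S_def ..
  have "(2 * k * C - 2 * (2 * k\<^sup>2 - 1))\<^sup>2 + (2 * l * S)\<^sup>2
     = 4 * (k * C - (2 * k\<^sup>2 - 1))\<^sup>2 + 4 * (l\<^sup>2 * S\<^sup>2)" by (simp add: algebra_simps power2_eq_square)
  also have "\<dots> = 4 * ((C - k) * (C - (4 * k ^ 3 - 3 * k)))"
    unfolding kl CS by (simp add: algebra_simps power2_eq_square power3_eq_cube)
  finally have "Im (ray_kernel \<alpha> x) = - (2 * l * k / pi) * (2 * l * S) / (4 * ((C - k) * (C - (4 * k ^ 3 - 3 * k))))"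
    unfolding ray_kernel_def den s2 Im_divide by simp
  also have "\<dots> = - (S / (4 * pi)) * (4 * k * l\<^sup>2 / ((C - k) * (C - (4 * k ^ 3 - 3 * k))))"
    using Ck Ck3 by (simp add: divide_simps power2_eq_square)
  also have "4 * k * l\<^sup>2 = (C - (4 * k ^ 3 - 3 * k)) - (C - k)"
    unfolding kl by (simp add: algebra_simps power2_eq_square power3_eq_cube)
  also have "((C - (4 * k ^ 3 - 3 * k)) - (C - k)) / ((C - k) * (C - (4 * k ^ 3 - 3 * k)))
     = 1 / (C - k) - 1 / (C - (4 * k ^ 3 - 3 * k))"
  proof -
    have "(B - A) / (A * B) = 1 / A - 1 / B" if "0 < A" "0 < B" for A B :: real
      using that by (simp add: divide_simps)
    from this[OF Ck Ck3] show ?thesis .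
  qed
  finally show "Im (ray_kernel \<alpha> x) = - (sinh (\<alpha> * x) / (4 * pi)) *
     (1 / (cosh (\<alpha> * x) - cos (pi * \<alpha> / 2)) - 1 / (cosh (\<alpha> * x) - cos (3 * (pi * \<alpha> / 2))))"
    unfolding c3 k_def C_def S_def .
qed

lemma Im_ray_kernel_sign:
  shows "0 \<le> x \<Longrightarrow> Im (ray_kernel \<alpha> x) \<le> 0" and "x \<le> 0 \<Longrightarrow> 0 \<le> Im (ray_kernel \<alpha> x)"
proof -
  have neg: "Im (ray_kernel \<alpha> x) \<le> 0" if "0 \<le> x" for x
  proof -
    have "0 \<le> sinh (\<alpha> * x)" using that \<alpha> by simp
    then show ?thesis
      using angle_bounds[OF \<alpha>] unfolding ray_kernel_def Im_divide
      by (auto simp: ray_denom_def intro!: divide_nonneg_nonneg mult_nonneg_nonneg)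
  qed
  show "0 \<le> x \<Longrightarrow> Im (ray_kernel \<alpha> x) \<le> 0" by (rule neg)
  show "x \<le> 0 \<Longrightarrow> 0 \<le> Im (ray_kernel \<alpha> x)"
    using neg[of "- x"] by (simp add: ray_kernel_minus)
qed

text \<open>The Volterra equation at 0 reads \<open>ray_solution \<alpha> 0 = 1\<close>, while the
  oscillating part is \<open>1 / \<alpha>\<close> there. In particular the imaginary part has total
  mass 0.\<close>

lemma integral_ray_kernel: "(LINT x|lborel. ray_kernel \<alpha> x) = of_real (1 / \<alpha> - 1)"
  using ray_solution_Volterra[OF \<alpha>, of 0] by (simp add: ray_solution_def ray_transient_def algebra_simps)

lemma Re_Im_ray_kernel_integral:
  shows "integrable lborel (\<lambda>x. Re (ray_kernel \<alpha> x))" "integrable lborel (\<lambda>x. Im (ray_kernel \<alpha> x))"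
    and "(LINT x|lborel. Re (ray_kernel \<alpha> x)) = 1 / \<alpha> - 1" "(LINT x|lborel. Im (ray_kernel \<alpha> x)) = 0"
  using integrable_ray_kernel[OF \<alpha>] integral_ray_kernel by simp_all

section \<open>Signs and sizes of the transient part\<close>

lemma Re_Im_ray_transient:
  assumes "0 \<le> t"
  shows "integrable lborel (\<lambda>x. exp (- t * exp x) * Re (ray_kernel \<alpha> x))"
    and "integrable lborel (\<lambda>x. exp (- t * exp x) * Im (ray_kernel \<alpha> x))"
    and "Re (ray_transient \<alpha> t) = (LINT x|lborel. exp (- t * exp x) * Re (ray_kernel \<alpha> x))"
    and "Im (ray_transient \<alpha> t) = (LINT x|lborel. exp (- t * exp x) * Im (ray_kernel \<alpha> x))"
  using integrable_Re[OF integrable_transient_integrand[OF \<alpha> assms]] integrable_Im[OF integrable_transient_integrand[OF \<alpha> assms]]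
    integral_Re[OF integrable_transient_integrand[OF \<alpha> assms]] integral_Im[OF integrable_transient_integrand[OF \<alpha> assms]]
  by (simp_all add: ray_transient_def)

text \<open>For the imaginary part, the decreasing weight \<open>exp (- t * exp x)\<close> is
  compared with its value \<open>exp (- t)\<close> at \<open>x = 0\<close>, where the kernel changes
  sign from plus to minus. The comparison only lowers the integral, and a constant weight gives
  0.\<close>

lemma ray_transient_quadrant:
  assumes "0 \<le> t"
  shows "0 \<le> Re (ray_transient \<alpha> t)" "0 \<le> Im (ray_transient \<alpha> t)"
proof -
  note R = Re_Im_ray_transient[OF assms]
  show "0 \<le> Re (ray_transient \<alpha> t)"
    unfolding R using Re_ray_kernel_nonneg by (intro Bochner_Integration.integral_nonneg) auto
  have "0 = (LINT x|lborel. exp (- t) * Im (ray_kernel \<alpha> x))"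
    using Re_Im_ray_kernel_integral by simp
  also have "\<dots> \<le> (LINT x|lborel. exp (- t * exp x) * Im (ray_kernel \<alpha> x))"
  proof (rule integral_mono)
    show "exp (- t) * Im (ray_kernel \<alpha> x) \<le> exp (- t * exp x) * Im (ray_kernel \<alpha> x)" for x
    proof (cases "0 \<le> x")
      case True
      then have "t * 1 \<le> t * exp x" using assms by (intro mult_left_mono) auto
      then show ?thesis using Im_ray_kernel_sign(1)[OF True] by (intro mult_right_mono_neg) auto
    next
      case False
      then have "t * exp x \<le> t * 1" using assms by (intro mult_left_mono) auto
      then show ?thesis using Im_ray_kernel_sign(2)[of x] False by (intro mult_right_mono) auto
    qed
  qed (use R Re_Im_ray_kernel_integral in auto)
  finally show "0 \<le> Im (ray_transient \<alpha> t)" unfolding R .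
qed

text \<open>By evenness each half line carries half of the mass \<open>1 / \<alpha> - 1\<close>; the
  weight is at most \<open>exp (- t)\<close> on the right half and at most 1 on the left.\<close>

lemma Re_ray_transient_le:
  assumes "0 \<le> t"
  shows "Re (ray_transient \<alpha> t) \<le> (1 + exp (- t)) / 2 * (1 / \<alpha> - 1)"
proof -
  define f where "f = (\<lambda>x. Re (ray_kernel \<alpha> x))"
  have fx: "Re (ray_kernel \<alpha> x) = f x" for x by (simp add: f_def)
  have f: "integrable lborel f" "(LINT x|lborel. f x) = 1 / \<alpha> - 1" "\<And>x. 0 \<le> f x" "\<And>x. f (- x) = f x"
    using Re_Im_ray_kernel_integral Re_ray_kernel_nonneg by (auto simp: f_def ray_kernel_minus)
  have i: "integrable lborel (\<lambda>x. indicat_real A x * f x)" if "A \<in> sets borel" for A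
    using integrable_mult_indicator[OF _ f(1), of A] that by simp
  define I where "I = (LINT x|lborel. indicat_real {0<..} x * f x)"
  have "I = (LINT x|lborel. indicat_real {..<0} x * f x)"
    unfolding I_def by (subst lborel_integral_real_affine[of "-1" _ 0])
      (auto intro!: Bochner_Integration.integral_cong simp: f indicator_def)
  moreover have "I + (LINT x|lborel. indicat_real {..<0} x * f x)
     = (LINT x|lborel. indicat_real {0<..} x * f x + indicat_real {..<0} x * f x)"
    unfolding I_def using i by simp
  moreover have "\<dots> = (LINT x|lborel. f x)"
    using f(1) by (intro integral_cong_AE) (auto intro!: eventually_mono[OF AE_lborel_singleton[of 0]] simp: indicator_def)
  ultimately have I: "I = (1 / \<alpha> - 1) / 2" "(LINT x|lborel. indicat_real {..<0} x * f x) = (1 / \<alpha> - 1) / 2"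
    using f(2) by auto
  have "Re (ray_transient \<alpha> t) \<le> (LINT x|lborel. exp (- t) * (indicat_real {0<..} x * f x) + indicat_real {..<0} x * f x)"
    unfolding Re_Im_ray_transient[OF assms] fx
  proof (rule integral_mono_AE)
    show "AE x in lborel. exp (- t * exp x) * f x \<le> exp (- t) * (indicat_real {0<..} x * f x) + indicat_real {..<0} x * f x"
      using AE_lborel_singleton[of 0]
    proof eventually_elim
      case (elim x)
      show ?case
      proof (cases "0 < x")
        case True
        then have "t * 1 \<le> t * exp x" using assms by (intro mult_left_mono) auto
        then show ?thesis using True f(3) by (auto intro!: mult_right_mono)
      next
        case False
        then show ?thesis using elim f(3)[of x] assms by (auto intro!: mult_left_le_one_le)
      qed
    qed
  qed (use Re_Im_ray_transient[OF assms] i in \<open>auto simp: f_def\<close>)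
  also have "\<dots> = exp (- t) * I + (1 / \<alpha> - 1) / 2"
    using i by (subst Bochner_Integration.integral_add) (auto simp: I(2) I_def)
  finally show ?thesis unfolding I by (simp add: field_simps)
qed

text \<open>The right half line contributes nothing positive and on the left the weight is at most
  1. By oddness what remains is the integral of minus the imaginary part over the right half line,
  which has an explicit logarithmic primitive.\<close>

lemma Im_ray_transient_le:
  assumes "0 \<le> t"
  shows "Im (ray_transient \<alpha> t) \<le> 1 / (3 * \<alpha>)"
proof -
  define f where "f = (\<lambda>x. - Im (ray_kernel \<alpha> x))"
  define k k3 where "k = cos (pi * \<alpha> / 2)" and "k3 = cos (3 * (pi * \<alpha> / 2))"
  \<comment> \<open>A primitive of \<open>f\<close> that vanishes at infinity. Its value at 0 is
    explicit because \<open>1 - k3 = (1 - k) * (1 + 2 * k)\<^sup>2\<close> by the triple angle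
    formula.\<close>
  define F where "F = (\<lambda>x. 1 / (4 * pi * \<alpha>) * ln ((cosh (\<alpha> * x) - k) / (cosh (\<alpha> * x) - k3)))"
  have pos: "0 < cosh (\<alpha> * x) - k" "0 < cosh (\<alpha> * x) - k3" for x
    using cosh_minus_cos_pos[of x] by (simp_all add: k_def k3_def)
  have [measurable]: "f \<in> borel_measurable borel" using ray_kernel_measurable[OF \<alpha>] by (simp add: f_def)
  have "(\<integral>\<^sup>+x. ennreal (f x) * indicator {0..} x \<partial>lborel) = ennreal (0 - F 0)"
  proof (rule nn_integral_FTC_atLeast)
    fix x :: real assume "0 \<le> x"
    then show "0 \<le> f x" using Im_ray_kernel_sign(1) by (simp add: f_def)
    have fx: "f x = sinh (\<alpha> * x) / (4 * pi) * (1 / (cosh (\<alpha> * x) - k) - 1 / (cosh (\<alpha> * x) - k3))"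
      unfolding f_def Im_ray_kernel_eq k_def k3_def by simp
    have "((\<lambda>x. 1 / (4 * pi * \<alpha>) * (ln (cosh (\<alpha> * x) - k) - ln (cosh (\<alpha> * x) - k3))) has_real_derivative f x) (at x)"
      using pos[of x] \<alpha> unfolding fx
      by (auto intro!: derivative_eq_intros simp: divide_simps) (simp add: algebra_simps)
    moreover have "F = (\<lambda>x. 1 / (4 * pi * \<alpha>) * (ln (cosh (\<alpha> * x) - k) - ln (cosh (\<alpha> * x) - k3)))"
      unfolding F_def using pos less_imp_neq[OF pos(1)] less_imp_neq[OF pos(2)] by (simp add: ln_div)
    ultimately show "(F has_real_derivative f x) (at x)" by simp
  next
    have "filterlim (\<lambda>x. cosh (\<alpha> * x)) at_top at_top"
      using \<alpha> by (intro filterlim_compose[OF cosh_real_at_top] filterlim_tendsto_pos_mult_at_top[OF tendsto_const]) (auto simp: filterlim_ident)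
    moreover have "((\<lambda>C. (C - k) / (C - k3)) \<longlongrightarrow> 1) at_top" by real_asymp
    ultimately have "((\<lambda>x. (cosh (\<alpha> * x) - k) / (cosh (\<alpha> * x) - k3)) \<longlongrightarrow> 1) at_top"
      by (rule filterlim_compose[rotated])
    then have "(F \<longlongrightarrow> 1 / (4 * pi * \<alpha>) * ln 1) at_top"
      unfolding F_def by (intro tendsto_intros) auto
    then show "(F \<longlongrightarrow> 0) at_top" by simp
  qed simp
  moreover have "(\<integral>\<^sup>+x. ennreal (f x) * indicator {0..} x \<partial>lborel) = (\<integral>\<^sup>+x. ennreal (indicat_real {0..} x * f x) \<partial>lborel)"
    by (intro nn_integral_cong) (auto simp: indicator_def)
  ultimately have N: "(\<integral>\<^sup>+x. ennreal (indicat_real {0..} x * f x) \<partial>lborel) = ennreal (- F 0)" by simp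
  have F0: "- F 0 = 1 / (4 * pi * \<alpha>) * ln ((1 - k3) / (1 - k))" "(1 - k3) / (1 - k) = (1 + 2 * k)\<^sup>2"
  proof -
    have "1 - k3 = (1 - k) * (1 + 2 * k)\<^sup>2"
      unfolding k3_def cos_treble_cos k_def by (simp add: algebra_simps power2_eq_square power3_eq_cube)
    then show "(1 - k3) / (1 - k) = (1 + 2 * k)\<^sup>2" using pos[of 0] by simp
    show "- F 0 = 1 / (4 * pi * \<alpha>) * ln ((1 - k3) / (1 - k))"
    proof -
      have "ln ((1 - k) / (1 - k3)) = - ln ((1 - k3) / (1 - k))" using pos[of 0] by (simp add: ln_div)
      then show ?thesis by (simp add: F_def)
    qed
  qed
  have k01: "0 < k" "k \<le> 1" using angle_bounds[OF \<alpha>] by (auto simp: k_def)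
  have F0_nonneg: "0 \<le> - F 0"
    unfolding F0 using k01 \<alpha> by (auto intro!: mult_nonneg_nonneg ln_ge_zero)
  have "has_bochner_integral lborel (\<lambda>x. indicat_real {0..} x * f x) (- F 0)"
  proof (rule has_bochner_integral_nn_integral[OF _ _ F0_nonneg N])
    show "AE x in lborel. 0 \<le> indicat_real {0..} x * f x"
      using Im_ray_kernel_sign(1) by (intro AE_I2) (auto simp: f_def indicator_def)
  qed measurable
  then have J: "(LINT x|lborel. indicat_real {0..} x * f x) = - F 0"
    by (simp add: has_bochner_integral_iff)
  have fi: "integrable lborel (\<lambda>x. indicat_real {..0} x * Im (ray_kernel \<alpha> x))"
    using integrable_mult_indicator[OF _ Re_Im_ray_kernel_integral(2), of "{..0}"] by simp
  have "Im (ray_transient \<alpha> t) \<le> (LINT x|lborel. indicat_real {..0} x * Im (ray_kernel \<alpha> x))"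
    unfolding Re_Im_ray_transient[OF assms]
  proof (rule integral_mono[OF _ fi])
    show "exp (- t * exp x) * Im (ray_kernel \<alpha> x) \<le> indicat_real {..0} x * Im (ray_kernel \<alpha> x)" for x
      using Im_ray_kernel_sign[of x] assms
      by (cases "x \<le> 0") (auto intro!: mult_left_le_one_le simp: mult_nonneg_nonpos)
  qed (rule Re_Im_ray_transient[OF assms])
  also have "\<dots> = (LINT x|lborel. indicat_real {0..} x * f x)"
    by (subst lborel_integral_real_affine[of "-1" _ 0])
      (auto intro!: Bochner_Integration.integral_cong simp: f_def ray_kernel_minus indicator_def)
  also have "\<dots> = 1 / (4 * pi * \<alpha>) * ln ((1 + 2 * k)\<^sup>2)" unfolding J F0 ..
  also have "\<dots> \<le> 1 / (4 * pi * \<alpha>) * 4"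
  proof (rule mult_left_mono)
    \<comment> \<open>From \<open>ln (1 + 2 * k) \<le> 2 * k \<le> 2\<close>. The resulting bound
      \<open>1 / (pi * \<alpha>)\<close> becomes \<open>1 / (3 * \<alpha>)\<close> by
      \<open>pi > 3\<close>.\<close>
    have "ln ((1 + 2 * k)\<^sup>2) = 2 * ln (1 + 2 * k)" using k01 by (simp add: ln_realpow)
    then show "ln ((1 + 2 * k)\<^sup>2) \<le> 4" using k01 ln_add_one_self_le_self[of "2 * k"] by simp
  qed (use \<alpha> in simp)
  also have "1 / (4 * pi * \<alpha>) * 4 \<le> 1 / (3 * \<alpha>)"
    using pi_gt3 \<alpha> by (simp add: divide_simps)
  finally show ?thesis .
qed

text \<open>Beyond \<open>3 * pi / 2\<close> the bound is quantitative. Before it, only the absence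
  of zeros is proved, and continuity on the compact interval turns that into a positive
  minimum.\<close>

lemma ray_solution_lower_bound:
  obtains \<kappa> where "0 < \<kappa>" "\<And>t. 0 \<le> t \<Longrightarrow> \<kappa> \<le> cmod (ray_solution \<alpha> t)"
proof -
  have large: "1 / (15 * \<alpha>) \<le> cmod (ray_solution \<alpha> t)" if t: "3 * pi / 2 \<le> t" for t
  proof -
    have t4: "4 \<le> t" "0 \<le> t" using t pi_gt3 by auto
    \<comment> \<open>Then the real part of the transient is at most
      \<open>(1 + 1/5) / 2 = 3/5\<close> of \<open>1 / \<alpha>\<close>, and the imaginary part at
      most 1/3 of it. Together they leave \<open>1 - 14/15 = 1/15\<close> of the modulus of the
      oscillating part.\<close>
    have "5 \<le> exp t" using exp_ge_add_one_self[of t] t4 by linarith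
    then have "exp (- t) \<le> 1 / 5" by (simp add: exp_minus divide_simps)
    then have "(1 + exp (- t)) / 2 * (1 / \<alpha> - 1) \<le> 3 / 5 * (1 / \<alpha>)"
      using \<alpha> by (intro mult_mono) (auto simp: field_simps)
    then have "cmod (ray_transient \<alpha> t) \<le> 3 / 5 * (1 / \<alpha>) + 1 / (3 * \<alpha>)"
      using Re_ray_transient_le[OF t4(2)] Im_ray_transient_le[OF t4(2)] ray_transient_quadrant[OF t4(2)]
        cmod_le[of "ray_transient \<alpha> t"] by linarith
    moreover have "cmod (cis (- t) / of_real \<alpha>) = 1 / \<alpha>" using \<alpha> by (simp add: norm_divide)
    moreover have "1 / (3 * \<alpha>) = 1 / 3 * (1 / \<alpha>)" "1 / (15 * \<alpha>) = 1 / 15 * (1 / \<alpha>)" by simp_all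
    ultimately show ?thesis
      using norm_triangle_ineq2[of "cis (- t) / of_real \<alpha>" "ray_transient \<alpha> t"]
      unfolding ray_solution_def by linarith
  qed
  have nz: "ray_solution \<alpha> t \<noteq> 0" if t: "0 \<le> t" for t
  proof
    assume z: "ray_solution \<alpha> t = 0"
    have t1: "t < 3 * pi / 2" using large[of t] z \<alpha> by (auto simp: not_le[symmetric])
    have "t \<noteq> 0" using z ray_solution_Volterra[OF \<alpha>, of 0] by auto
    then have t0: "0 < t" using t by simp
    have "cis (- t) / of_real \<alpha> = ray_transient \<alpha> t" using z by (simp add: ray_solution_def)
    then have "cis (- t) = of_real \<alpha> * ray_transient \<alpha> t" using \<alpha> by (simp add: field_simps)
    \<comment> \<open>At a zero, \<open>cis (- t)\<close> would lie in the closed first quadrant. On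
      \<open>0 < t < pi\<close> the sine contradicts this, on \<open>pi \<le> t < 3 * pi / 2\<close>
      the cosine.\<close>
    from arg_cong[OF this, of Re] arg_cong[OF this, of Im]
    have c: "0 \<le> cos t" and s: "sin t \<le> 0"
      using ray_transient_quadrant[OF t] \<alpha> by (simp_all add: minus_equation_iff[of "sin t"]) (smt (verit) mult_nonneg_nonneg)
    show False
    proof (cases "t < pi")
      case True
      then show False using sin_gt_zero[OF t0] s by simp
    next
      case False
      have "cos t = - cos (t - pi)" by (simp add: cos_diff)
      moreover have "0 < cos (t - pi)" using False t1 by (intro cos_gt_zero_pi) auto
      ultimately show False using c by simp
    qed
  qed
  have "continuous_on {0..3 * pi / 2} (\<lambda>t. cmod (ray_solution \<alpha> t))"
    by (intro continuous_intros continuous_on_subset[OF continuous_on_ray_solution[OF \<alpha>]]) auto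
  then obtain t0 where t0: "t0 \<in> {0..3 * pi / 2}" "\<And>t. t \<in> {0..3 * pi / 2} \<Longrightarrow> cmod (ray_solution \<alpha> t0) \<le> cmod (ray_solution \<alpha> t)"
    using continuous_attains_inf[of "{0..3 * pi / 2}" "\<lambda>t. cmod (ray_solution \<alpha> t)"] by fastforce
  show thesis
  proof (rule that[of "min (cmod (ray_solution \<alpha> t0)) (1 / (15 * \<alpha>))"])
    show "0 < min (cmod (ray_solution \<alpha> t0)) (1 / (15 * \<alpha>))" using nz t0 \<alpha> by auto
    show "min (cmod (ray_solution \<alpha> t0)) (1 / (15 * \<alpha>)) \<le> cmod (ray_solution \<alpha> t)" if "0 \<le> t" for t
      using large[of t] t0(2)[of t] that by (cases "t \<le> 3 * pi / 2") auto
  qed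
qed

end

section \<open>Scalar Caputo equations\<close>

text \<open>A version of \<open>integrable_frac_kernel_times\<close> for functions controlled on
  \<open>{0..t}\<close> only, such as coordinates of a weak solution; measurability is obtained
  after restriction to the interval.\<close>

lemma frac_kernel_integrable_continuous:
  assumes "0 < \<alpha>" "0 \<le> t" "continuous_on {0..t} f"
  shows "set_integrable lborel {0<..<1} (\<lambda>\<sigma>. of_real ((1 - \<sigma>) powr (\<alpha> - 1)) * f (t * \<sigma>) :: complex)"
proof -
  obtain B where "\<forall>x\<in>f ` {0..t}. norm x \<le> B"
    using compact_imp_bounded[OF compact_continuous_image[OF assms(3)]] unfolding bounded_iff by blast
  then have B: "cmod (f s) \<le> B" if "0 \<le> s" "s \<le> t" for s using that by auto
  have le: "t * \<sigma> \<le> t" if "0 < \<sigma>" "\<sigma> < 1" for \<sigma> using that assms(2) by (simp add: mult_left_le)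
  have 1: "integrable lborel (\<lambda>\<sigma>. B * (indicat_real {0<..<1} \<sigma> *\<^sub>R (1 - \<sigma>) powr (\<alpha> - 1)))"
    using integrable_frac_kernel[OF assms(1)] unfolding set_integrable_def by simp
  have "continuous_on {0<..<1} (\<lambda>\<sigma>. f (t * \<sigma>))"
    using le assms(2) by (intro continuous_on_compose2[OF assms(3)] continuous_intros) auto
  then have "(\<lambda>\<sigma>. indicat_real {0<..<1} \<sigma> *\<^sub>R f (t * \<sigma>)) \<in> borel_measurable borel"
    by (intro borel_measurable_continuous_on_indicator) auto
  then have "(\<lambda>\<sigma>. complex_of_real ((1 - \<sigma>) powr (\<alpha> - 1)) * (indicat_real {0<..<1} \<sigma> *\<^sub>R f (t * \<sigma>))) \<in> borel_measurable lborel"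
    by measurable
  then have 2: "(\<lambda>\<sigma>. indicat_real {0<..<1} \<sigma> *\<^sub>R (complex_of_real ((1 - \<sigma>) powr (\<alpha> - 1)) * f (t * \<sigma>))) \<in> borel_measurable lborel"
    by simp
  have "cmod (f (t * \<sigma>)) * (1 - \<sigma>) powr (\<alpha> - 1) \<le> \<bar>B\<bar> * (1 - \<sigma>) powr (\<alpha> - 1)" if "0 < \<sigma>" "\<sigma> < 1" for \<sigma>
    using that assms(2) by (intro mult_right_mono order_trans[OF B abs_ge_self] le) auto
  then have 3: "AE \<sigma> in lborel. norm (indicat_real {0<..<1} \<sigma> *\<^sub>R (complex_of_real ((1 - \<sigma>) powr (\<alpha> - 1)) * f (t * \<sigma>)))
     \<le> norm (B * (indicat_real {0<..<1} \<sigma> *\<^sub>R (1 - \<sigma>) powr (\<alpha> - 1)))"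
    by (intro AE_I2) (auto simp: indicator_def norm_mult abs_mult mult.commute)
  show ?thesis
    unfolding set_integrable_def by (rule Bochner_Integration.integrable_bound[OF 1 2 3])
qed

lemma frac_int_diff:
  assumes "0 < \<alpha>" "0 \<le> t" "continuous_on {0..t} f" "continuous_on {0..t} g"
  shows "frac_int \<alpha> (\<lambda>s. f s - g s) t = frac_int \<alpha> f t - frac_int \<alpha> g t"
  using set_integral_diff(2)[OF frac_kernel_integrable_continuous[OF assms(1-3)] frac_kernel_integrable_continuous[OF assms(1,2,4)]]
  by (simp add: frac_int_def right_diff_distrib)

text \<open>The value depends on neither \<open>r\<close> nor \<open>t\<close>. Therefore the
  fractional integrals of orders \<open>\<alpha>\<close> and \<open>1 - \<alpha>\<close> compose to
  ordinary integration, and the first one undoes the Caputo derivative.\<close>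

lemma Beta_kernel:
  assumes "0 < \<alpha>" "\<alpha> < 1" "r < t"
  shows "has_bochner_integral lborel (\<lambda>\<tau>. indicat_real {r<..<t} \<tau> * ((t - \<tau>) powr (\<alpha> - 1) * (\<tau> - r) powr (- \<alpha>)))
           (Gamma \<alpha> * Gamma (1 - \<alpha>))"
proof -
  define f where "f = (\<lambda>x :: real. indicat_real {0<..<1} x * (x powr ((1 - \<alpha>) - 1) * (1 - x) powr (\<alpha> - 1)))"
  have s: "set_integrable lborel {0..1} (\<lambda>x. x powr ((1 - \<alpha>) - 1) * (1 - x) powr (\<alpha> - 1))"
    using assms by (intro integrable_Beta) auto
  have "(LINT x:{0..1}|lborel. x powr ((1 - \<alpha>) - 1) * (1 - x) powr (\<alpha> - 1)) = Beta (1 - \<alpha>) \<alpha>"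
    using set_borel_integral_eq_integral(2)[OF s] has_integral_Beta_real[of "1 - \<alpha>" \<alpha>] assms by (simp add: integral_unique)
  then have "has_bochner_integral lborel (\<lambda>x. indicat_real {0..1} x * (x powr ((1 - \<alpha>) - 1) * (1 - x) powr (\<alpha> - 1))) (Beta (1 - \<alpha>) \<alpha>)"
    using s by (simp add: has_bochner_integral_iff set_integrable_def set_lebesgue_integral_def)
  also have "(\<lambda>x. indicat_real {0..1} x * (x powr ((1 - \<alpha>) - 1) * (1 - x) powr (\<alpha> - 1))) = f"
    using assms by (auto simp: f_def indicator_def fun_eq_iff)
  also have "Beta (1 - \<alpha>) \<alpha> = Gamma \<alpha> * Gamma (1 - \<alpha>)"
    by (simp add: Beta_def Gamma_1)
  finally have f: "has_bochner_integral lborel f (Gamma \<alpha> * Gamma (1 - \<alpha>))" .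
  define L where "L = t - r"
  have L: "0 < L" using assms by (simp add: L_def)
  from lborel_has_bochner_integral_real_affine_iff[THEN iffD1, OF _ f, of "1 / L" "- r / L"]
  have "has_bochner_integral lborel (\<lambda>x. f (- r / L + 1 / L * x)) ((Gamma \<alpha> * Gamma (1 - \<alpha>)) /\<^sub>R \<bar>1 / L\<bar>)"
    using L by simp
  then have "has_bochner_integral lborel (\<lambda>x. 1 / L * f (- r / L + 1 / L * x)) (1 / L * ((Gamma \<alpha> * Gamma (1 - \<alpha>)) /\<^sub>R \<bar>1 / L\<bar>))"
    by (rule has_bochner_integral_mult_right)
  also have "1 / L * ((Gamma \<alpha> * Gamma (1 - \<alpha>)) /\<^sub>R \<bar>1 / L\<bar>) = Gamma \<alpha> * Gamma (1 - \<alpha>)"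
    using L by simp
  also have "(\<lambda>x. 1 / L * f (- r / L + 1 / L * x)) = (\<lambda>\<tau>. indicat_real {r<..<t} \<tau> * ((t - \<tau>) powr (\<alpha> - 1) * (\<tau> - r) powr (- \<alpha>)))"
  proof
    fix \<tau>
    have e1: "- r / L + 1 / L * \<tau> = (\<tau> - r) / L" by (simp add: diff_divide_distrib)
    have "1 - (\<tau> - r) / L = (L - (\<tau> - r)) / L" using L by (simp add: diff_divide_distrib)
    then have e2: "1 - (\<tau> - r) / L = (t - \<tau>) / L" by (simp add: L_def)
    note e = e1 e2
    have i: "(\<tau> - r) / L \<in> {0<..<1} \<longleftrightarrow> \<tau> \<in> {r<..<t}" using L by (auto simp: L_def zero_less_divide_iff divide_less_eq)
    show "1 / L * f (- r / L + 1 / L * \<tau>) = indicat_real {r<..<t} \<tau> * ((t - \<tau>) powr (\<alpha> - 1) * (\<tau> - r) powr (- \<alpha>))"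
    proof (cases "\<tau> \<in> {r<..<t}")
      case True
      have "((\<tau> - r) / L) powr ((1 - \<alpha>) - 1) * ((t - \<tau>) / L) powr (\<alpha> - 1)
        = ((t - \<tau>) powr (\<alpha> - 1) * (\<tau> - r) powr (- \<alpha>)) / (L powr (- \<alpha>) * L powr (\<alpha> - 1))"
        using True L by (simp add: powr_divide)
      also have "L powr (- \<alpha>) * L powr (\<alpha> - 1) = 1 / L"
        by (subst powr_add[symmetric]) (use L in \<open>simp add: powr_minus_divide\<close>)
      finally show ?thesis using True L i unfolding f_def e by (simp add: indicator_def)
    next
      case False
      then show ?thesis using i unfolding f_def e by (auto simp: indicator_def)
    qed
  qed
  finally show ?thesis .
qed

text \<open>The scalar trace of \<open>has_caputo_derivative\<close> combined with the equation. The
  derivative \<open>g\<close> is a parameter since the vector-valued definition supplies a separate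
  witness for each \<open>t\<close>.\<close>

definition caputo_eq_at :: "real \<Rightarrow> complex \<Rightarrow> (real \<Rightarrow> complex) \<Rightarrow> (real \<Rightarrow> complex) \<Rightarrow> real \<Rightarrow> bool" where
  "caputo_eq_at \<alpha> \<mu> y g t \<longleftrightarrow>
     (AE r in lebesgue. 0 < r \<and> r < t \<longrightarrow> (y has_vector_derivative g r) (at r)) \<and>
     (\<forall>a b. 0 < a \<and> a \<le> b \<and> b < t \<longrightarrow> y b - y a = (LINT r:{a..b}|lebesgue. g r)) \<and>
     set_integrable lebesgue {0<..<t} (\<lambda>r. of_real ((t - r) powr (- \<alpha>)) * g r) \<and>
     (LINT r:{0<..<t}|lebesgue. of_real ((t - r) powr (- \<alpha>)) * g r) = of_real (Gamma (1 - \<alpha>)) * \<mu> * y t"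

text \<open>The fractional integral of order \<open>\<alpha>\<close> is applied to the equation;
  Fubini and \<open>Beta_kernel\<close> turn the left side into the integral of \<open>y'\<close>,
  that is, \<open>y t - y 0\<close>. Before that, the witnesses of different times must be merged
  into one integrable function \<open>g1\<close>.\<close>

lemma caputo_eq_imp_Volterra:
  assumes \<alpha>: "0 < \<alpha>" "\<alpha> < 1" and cont: "continuous_on {0..T} y"
    and eq: "AE t in lebesgue. 0 < t \<and> t < T \<longrightarrow> (\<exists>g. caputo_eq_at \<alpha> \<mu> y g t)"
    and t: "0 < t" "t < T"
  shows "y t = y 0 + \<mu> * frac_int \<alpha> y t"
proof -
  \<comment> \<open>The equation may fail at \<open>t\<close> itself, and the primitive property of
    a witness at \<open>\<tau>\<close> reaches only points \<open>b < \<tau>\<close>. Hence a good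
    time strictly beyond \<open>t\<close> is taken, and it exists because an interval is not
    null.\<close>
  have "\<exists>\<tau>. t < \<tau> \<and> \<tau> < T \<and> (\<exists>g. caputo_eq_at \<alpha> \<mu> y g \<tau>)"
  proof (rule ccontr)
    assume "\<not> ?thesis"
    then have "AE \<tau> in lebesgue. \<tau> \<notin> {t<..<T}"
      using eq by (auto elim!: eventually_mono) (use t in \<open>fastforce\<close>)
    then have "AE \<tau> in lborel. \<tau> \<notin> {t<..<T}" by (simp only: AE_completion_iff)
    then have "emeasure lborel {t<..<T} = 0"
      by (subst (asm) AE_iff_measurable[OF _ refl]) (auto cong: Collect_cong simp: greaterThanLessThan_def greaterThan_def lessThan_def Int_def)
    then show False using t by simp
  qed
  then obtain \<tau>1 g where \<tau>1: "t < \<tau>1" "\<tau>1 < T" and g: "caputo_eq_at \<alpha> \<mu> y g \<tau>1" by blast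
  have d: "AE r in lborel. 0 < r \<and> r < \<tau>1 \<longrightarrow> (y has_vector_derivative g r) (at r)"
    using g unfolding caputo_eq_at_def AE_completion_iff by blast
  \<comment> \<open>\<open>g\<close> is known to be integrable against the weight
    \<open>(\<tau>1 - r) powr (- \<alpha>)\<close>; removing the weight costs a factor of at most
    \<open>\<tau>1 powr \<alpha>\<close>.\<close>
  define h where "h = (\<lambda>r. indicat_real {0<..t} r *\<^sub>R g r)"
  have h: "integrable lebesgue h"
  proof (rule Bochner_Integration.integrable_bound)
    define w where "w = (\<lambda>r. indicat_real {0<..<\<tau>1} r *\<^sub>R (complex_of_real ((\<tau>1 - r) powr (- \<alpha>)) * g r))"
    have w: "integrable lebesgue w" using g by (simp add: caputo_eq_at_def set_integrable_def w_def)
    show "integrable lebesgue (\<lambda>r. \<tau>1 powr \<alpha> *\<^sub>R w r)" using w by simp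
    have hw: "h r = (indicat_real {0<..t} r * (\<tau>1 - r) powr \<alpha>) *\<^sub>R w r" for r
      using \<tau>1 by (auto simp: h_def w_def indicator_def scaleR_conv_of_real powr_minus)
    have "(\<lambda>r. indicat_real {0<..t} r * (\<tau>1 - r) powr \<alpha>) \<in> borel_measurable lebesgue"
      by (rule measurable_completion) measurable
    then show "h \<in> borel_measurable lebesgue"
      unfolding hw using w by (intro borel_measurable_scaleR) auto
    show "AE r in lebesgue. norm (h r) \<le> norm (\<tau>1 powr \<alpha> *\<^sub>R w r)"
    proof (intro AE_I2)
      fix r
      have "indicat_real {0<..t} r * (\<tau>1 - r) powr \<alpha> \<le> \<tau>1 powr \<alpha>"
        using \<tau>1 \<alpha> by (auto simp: indicator_def intro!: powr_mono2)
      then show "norm (h r) \<le> norm (\<tau>1 powr \<alpha> *\<^sub>R w r)"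
        unfolding hw norm_scaleR by (intro mult_right_mono) (auto simp: abs_mult)
    qed
  qed
  have "(\<lambda>r. Re (h r)) \<in> borel_measurable lebesgue" "(\<lambda>r. Im (h r)) \<in> borel_measurable lebesgue"
    using borel_measurable_integrable[OF h] by measurable
  \<comment> \<open>Fubini is applied on \<open>lborel\<close>, so the Lebesgue measurable
    \<open>h\<close> is exchanged for a Borel function \<open>g1\<close> that agrees with it almost
    everywhere and is supported in the open interval.\<close>
  then obtain p q where pq [measurable]: "p \<in> borel_measurable lborel" "q \<in> borel_measurable lborel"
    and ae: "AE r in lborel. Re (h r) = p r" "AE r in lborel. Im (h r) = q r"
    using completion_ex_borel_measurable_real by metis
  define g1 where "g1 = (\<lambda>r. indicat_real {0<..<t} r *\<^sub>R Complex (p r) (q r))"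
  have g1m [measurable]: "g1 \<in> borel_measurable lborel" unfolding g1_def Complex_eq by measurable
  have hg1: "AE r in lborel. h r = g1 r"
    using ae AE_lborel_singleton[of t]
  proof eventually_elim
    case (elim r)
    then show ?case by (cases "r \<in> {0<..t}") (auto simp: g1_def h_def complex_eq_iff)
  qed
  have g1_ne: "g1 r = 0" if "r \<notin> {0<..<t}" for r using that by (simp add: g1_def)
  have g1i: "integrable lborel g1"
  proof -
    have "integrable lebesgue g1"
      using hg1 by (intro integrable_cong_AE_imp[OF h]) (auto simp: AE_completion_iff intro: measurable_completion)
    then show ?thesis by (simp add: integrable_completion)
  qed
  have g1_int: "(LINT r:A|lebesgue. g r) = (LINT r|lborel. indicat_real A r *\<^sub>R g1 r)"
    if "A \<in> sets borel" "A \<subseteq> {0<..t}" for A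
  proof -
    have A: "A \<in> sets lebesgue" using that by simp
    have "indicat_real A r *\<^sub>R g r = indicat_real A r *\<^sub>R h r" for r
      using that(2) by (auto simp: h_def indicator_def)
    then have "(LINT r:A|lebesgue. g r) = (LINT r|lebesgue. indicat_real A r *\<^sub>R h r)"
      unfolding set_lebesgue_integral_def by (simp only:)
    also have "\<dots> = (LINT r|lebesgue. indicat_real A r *\<^sub>R g1 r)"
    proof (rule integral_cong_AE)
      show "(\<lambda>r. indicat_real A r *\<^sub>R h r) \<in> borel_measurable lebesgue"
        using A borel_measurable_integrable[OF h] by (intro borel_measurable_scaleR borel_measurable_indicator)
      show "(\<lambda>r. indicat_real A r *\<^sub>R g1 r) \<in> borel_measurable lebesgue"
        using that(1) g1m
        by (intro measurable_completion borel_measurable_scaleR borel_measurable_indicator) auto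
      show "AE r in lebesgue. indicat_real A r *\<^sub>R h r = indicat_real A r *\<^sub>R g1 r"
        unfolding AE_completion_iff using hg1 by eventually_elim simp
    qed
    also have "\<dots> = (LINT r|lborel. indicat_real A r *\<^sub>R g1 r)"
      using that(1) g1m
      by (intro integral_completion borel_measurable_scaleR borel_measurable_indicator) auto
    finally show ?thesis .
  qed
  have y_diff: "y t - y 0 = (LINT r|lborel. g1 r)"
  proof -
    \<comment> \<open>The primitive property holds only away from 0, so the lower limit tends to 0
      from inside the interval; continuity of \<open>y\<close> and integrability of
      \<open>g1\<close> allow the passage to the limit.\<close>
    define a where "a = (\<lambda>n. t / real (Suc (Suc n)))"
    have a: "0 < a n" "a n < t" for n using t by (auto simp: a_def divide_simps)
    have a0: "a \<longlonglongrightarrow> 0" unfolding a_def by real_asymp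
    have "y t - y (a n) = (LINT r|lborel. indicat_real {a n..t} r *\<^sub>R g1 r)" for n
      using g a[of n] \<tau>1 by (subst g1_int[symmetric]) (auto simp: caputo_eq_at_def)
    moreover have "(\<lambda>n. LINT r|lborel. indicat_real {a n..t} r *\<^sub>R g1 r) \<longlonglongrightarrow> (LINT r|lborel. g1 r)"
    proof (rule integral_dominated_convergence)
      show "integrable lborel (\<lambda>r. cmod (g1 r))" using g1i by simp
      show "AE r in lborel. (\<lambda>n. indicat_real {a n..t} r *\<^sub>R g1 r) \<longlonglongrightarrow> g1 r"
      proof (intro AE_I2)
        fix r
        show "(\<lambda>n. indicat_real {a n..t} r *\<^sub>R g1 r) \<longlonglongrightarrow> g1 r"
        proof (cases "r \<in> {0<..<t}")
          case True
          then have "eventually (\<lambda>n. a n < r) sequentially" using order_tendstoD(2)[OF a0] by auto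
          then have "eventually (\<lambda>n. indicat_real {a n..t} r *\<^sub>R g1 r = g1 r) sequentially"
            by eventually_elim (use True in auto)
          then show ?thesis by (rule tendsto_eventually)
        qed (simp add: g1_ne)
      qed
    qed (auto simp: indicator_def)
    moreover have "(\<lambda>n. y t - y (a n)) \<longlonglongrightarrow> y t - y 0"
      using a a0 t by (intro tendsto_intros continuous_on_tendsto_compose[OF cont]) (auto intro!: always_eventually less_imp_le order.strict_trans[of _ t T])
    ultimately show ?thesis using LIMSEQ_unique by simp
  qed
  have inner: "AE \<tau> in lborel. 0 < \<tau> \<and> \<tau> < t \<longrightarrow>
      (LINT r|lborel. indicat_real {0<..<\<tau>} r *\<^sub>R (of_real ((\<tau> - r) powr (- \<alpha>)) * g1 r)) = of_real (Gamma (1 - \<alpha>)) * \<mu> * y \<tau>"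
    using eq unfolding AE_completion_iff
  proof eventually_elim
    case (elim \<tau>)
    show ?case
    proof
      assume \<tau>: "0 < \<tau> \<and> \<tau> < t"
      then obtain g' where g': "caputo_eq_at \<alpha> \<mu> y g' \<tau>" using elim t by auto
      have d': "AE r in lborel. 0 < r \<and> r < \<tau> \<longrightarrow> (y has_vector_derivative g' r) (at r)"
        using g' unfolding caputo_eq_at_def AE_completion_iff by blast
      \<comment> \<open>Here the witnesses merge: \<open>g'\<close> and \<open>g\<close> are both
        derivatives of \<open>y\<close> almost everywhere below \<open>\<tau>\<close>, so
        \<open>g1\<close> may replace \<open>g'\<close>.\<close>
      have "(LINT r:{0<..<\<tau>}|lebesgue. of_real ((\<tau> - r) powr (- \<alpha>)) * g' r)
        = (LINT r|lebesgue. indicat_real {0<..<\<tau>} r *\<^sub>R (of_real ((\<tau> - r) powr (- \<alpha>)) * g1 r))"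
        unfolding set_lebesgue_integral_def
      proof (rule integral_cong_AE)
        show "(\<lambda>r. indicat_real {0<..<\<tau>} r *\<^sub>R (complex_of_real ((\<tau> - r) powr (- \<alpha>)) * g' r)) \<in> borel_measurable lebesgue"
          using g' unfolding caputo_eq_at_def set_integrable_def by (blast dest: borel_measurable_integrable)
        show "(\<lambda>r. indicat_real {0<..<\<tau>} r *\<^sub>R (complex_of_real ((\<tau> - r) powr (- \<alpha>)) * g1 r)) \<in> borel_measurable lebesgue"
          by (intro measurable_completion) measurable
        show "AE r in lebesgue. indicat_real {0<..<\<tau>} r *\<^sub>R (complex_of_real ((\<tau> - r) powr (- \<alpha>)) * g' r)
          = indicat_real {0<..<\<tau>} r *\<^sub>R (complex_of_real ((\<tau> - r) powr (- \<alpha>)) * g1 r)"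
          unfolding AE_completion_iff using d d' hg1
        proof eventually_elim
          case (elim r)
          show ?case
          proof (cases "r \<in> {0<..<\<tau>}")
            case True
            then have "g' r = g r" using elim \<tau> \<tau>1 by (intro vector_derivative_unique_at[of y _ r]) auto
            then show ?thesis using True \<tau> elim by (simp add: h_def)
          qed simp
        qed
      qed
      also have "\<dots> = (LINT r|lborel. indicat_real {0<..<\<tau>} r *\<^sub>R (of_real ((\<tau> - r) powr (- \<alpha>)) * g1 r))"
        by (intro integral_completion) measurable
      finally show "(LINT r|lborel. indicat_real {0<..<\<tau>} r *\<^sub>R (of_real ((\<tau> - r) powr (- \<alpha>)) * g1 r))
         = of_real (Gamma (1 - \<alpha>)) * \<mu> * y \<tau>"
        using g' by (simp add: caputo_eq_at_def)
    qed
  qed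
  define B where "B = Gamma \<alpha> * Gamma (1 - \<alpha>)"
  have B: "0 < B" using \<alpha> by (simp add: B_def Gamma_real_pos)
  \<comment> \<open>The product of the outer kernel of order \<open>\<alpha>\<close> and the inner
    kernel of order \<open>1 - \<alpha>\<close>, without their Gamma factors.\<close>
  define k where "k = (\<lambda>r \<tau>. indicat_real {r<..<t} \<tau> * ((t - \<tau>) powr (\<alpha> - 1) * (\<tau> - r) powr (- \<alpha>)))"
  have k: "integrable lborel (k r)" "(LINT \<tau>|lborel. k r \<tau>) = B" if "r < t" for r
    using Beta_kernel[OF \<alpha> that] by (simp_all add: k_def B_def has_bochner_integral_iff)
  have k0: "0 \<le> k r \<tau>" for r \<tau> by (simp add: k_def)
  have ck: "integrable lborel (\<lambda>\<tau>. of_real (k r \<tau>) * g1 r)" "(LINT \<tau>|lborel. of_real (k r \<tau>) * g1 r) = of_real B * g1 r"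
    "(LINT \<tau>|lborel. cmod (of_real (k r \<tau>) * g1 r)) = B * cmod (g1 r)" for r
  proof -
    consider "r < t" | "t \<le> r" by linarith
    then have "integrable lborel (\<lambda>\<tau>. of_real (k r \<tau>) * g1 r) \<and> (LINT \<tau>|lborel. of_real (k r \<tau>) * g1 r) = of_real B * g1 r
      \<and> (LINT \<tau>|lborel. cmod (of_real (k r \<tau>) * g1 r)) = B * cmod (g1 r)"
    proof cases
      case 1
      then show ?thesis using k[OF 1] k0 by (simp add: norm_mult)
    qed (simp add: g1_ne)
    then show "integrable lborel (\<lambda>\<tau>. of_real (k r \<tau>) * g1 r)" "(LINT \<tau>|lborel. of_real (k r \<tau>) * g1 r) = of_real B * g1 r"
    "(LINT \<tau>|lborel. cmod (of_real (k r \<tau>) * g1 r)) = B * cmod (g1 r)" by blast+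
  qed
  have I: "integrable (lborel \<Otimes>\<^sub>M lborel) (\<lambda>(r, \<tau>). of_real (k r \<tau>) * g1 r)"
  proof (rule lborel_pair.Fubini_integrable)
    show "integrable lborel (\<lambda>r. LINT \<tau>|lborel. cmod (case (r, \<tau>) of (r, \<tau>) \<Rightarrow> of_real (k r \<tau>) * g1 r))"
      using g1i by (simp add: ck)
    show "AE r in lborel. integrable lborel (\<lambda>\<tau>. case (r, \<tau>) of (r, \<tau>) \<Rightarrow> of_real (k r \<tau>) * g1 r)"
      using ck(1) by simp
    have "(\<lambda>(r, \<tau>). k r \<tau>) = (\<lambda>p. (if fst p < snd p \<and> snd p < t then 1 else 0) * ((t - snd p) powr (\<alpha> - 1) * (snd p - fst p) powr (- \<alpha>)))"
      by (auto simp: k_def indicator_def)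
    then have [measurable]: "(\<lambda>(r, \<tau>). k r \<tau>) \<in> borel_measurable (lborel \<Otimes>\<^sub>M lborel)" by simp
    show "(\<lambda>(r, \<tau>). of_real (k r \<tau>) * g1 r) \<in> borel_measurable (lborel \<Otimes>\<^sub>M lborel)" by measurable
  qed
  have "of_real B * (y t - y 0) = (LINT r|lborel. LINT \<tau>|lborel. of_real (k r \<tau>) * g1 r)"
    unfolding ck y_diff by simp
  also have "\<dots> = (LINT \<tau>|lborel. LINT r|lborel. of_real (k r \<tau>) * g1 r)"
    using lborel_pair.Fubini_integral[OF I] by simp
  also have "\<dots> = (LINT \<tau>|lborel. of_real (Gamma (1 - \<alpha>)) * \<mu> * (indicat_real {0<..<t} \<tau> *\<^sub>R (of_real ((t - \<tau>) powr (\<alpha> - 1)) * y \<tau>)))"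
  proof (rule integral_cong_AE)
    show "(\<lambda>\<tau>. LINT r|lborel. of_real (k r \<tau>) * g1 r) \<in> borel_measurable lborel"
      using lborel_pair.integrable_snd[OF I] by (rule borel_measurable_integrable)
    have "(\<lambda>\<tau>. indicat_real {0<..<t} \<tau> *\<^sub>R y \<tau>) \<in> borel_measurable borel"
      using t by (intro borel_measurable_continuous_on_indicator continuous_on_subset[OF cont]) auto
    then have "(\<lambda>\<tau>. of_real (Gamma (1 - \<alpha>)) * \<mu> * (of_real ((t - \<tau>) powr (\<alpha> - 1)) * (indicat_real {0<..<t} \<tau> *\<^sub>R y \<tau>))) \<in> borel_measurable lborel"
      by measurable
    then show "(\<lambda>\<tau>. of_real (Gamma (1 - \<alpha>)) * \<mu> * (indicat_real {0<..<t} \<tau> *\<^sub>R (of_real ((t - \<tau>) powr (\<alpha> - 1)) * y \<tau>))) \<in> borel_measurable lborel"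
      by simp
    show "AE \<tau> in lborel. (LINT r|lborel. of_real (k r \<tau>) * g1 r)
      = of_real (Gamma (1 - \<alpha>)) * \<mu> * (indicat_real {0<..<t} \<tau> *\<^sub>R (of_real ((t - \<tau>) powr (\<alpha> - 1)) * y \<tau>))"
      using inner
    proof eventually_elim
      case (elim \<tau>)
      show ?case
      proof (cases "\<tau> \<in> {0<..<t}")
        case True
        have "of_real (k r \<tau>) * g1 r = of_real ((t - \<tau>) powr (\<alpha> - 1)) * (indicat_real {0<..<\<tau>} r *\<^sub>R (of_real ((\<tau> - r) powr (- \<alpha>)) * g1 r))" for r
          using True g1_ne[of r] by (auto simp: k_def indicator_def)
        then have "(LINT r|lborel. of_real (k r \<tau>) * g1 r) = of_real ((t - \<tau>) powr (\<alpha> - 1)) *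
           (LINT r|lborel. indicat_real {0<..<\<tau>} r *\<^sub>R (of_real ((\<tau> - r) powr (- \<alpha>)) * g1 r))"
          by (simp only: integral_mult_right_zero)
        then show ?thesis using elim True by simp
      next
        case False
        then have z: "of_real (k r \<tau>) * g1 r = 0" for r
          using g1_ne[of r] by (cases "r \<in> {0<..<t}") (auto simp: k_def indicator_def)
        show ?thesis using False by (simp only: z) simp
      qed
    qed
  qed
  also have "\<dots> = of_real (Gamma (1 - \<alpha>)) * \<mu> * (LINT \<tau>:{0<..<t}|lborel. of_real ((t - \<tau>) powr (\<alpha> - 1)) * y \<tau>)"
    unfolding set_lebesgue_integral_def by (rule integral_mult_right_zero)
  also have "\<dots> = of_real B * (\<mu> * frac_int \<alpha> y t)"
    unfolding frac_int_eq[OF \<alpha>(1) t(1)] by (simp add: B_def)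
  finally have "y t - y 0 = \<mu> * frac_int \<alpha> y t" using B by simp
  then show ?thesis by (simp add: diff_eq_eq add.commute)
qed

section \<open>Coordinates in the eigenbasis\<close>

lemma cinner_add_right: "cinner x (y + z) = cinner x y + cinner (x :: 'a :: complex_hilbert) z"
  by (subst (1 2 3) cinner_commute) (simp add: cinner_add_left)

lemma cinner_scaleC_right: "cinner x (a *\<^sub>C y) = cnj a * cinner (x :: 'a :: complex_hilbert) y"
  by (subst (1 2) cinner_commute) (simp add: cinner_scaleC_left)

lemma scaleC_zero_left [simp]: "0 *\<^sub>C (x :: 'a :: complex_hilbert) = 0"
  using scaleC_of_real[of 0 x] by simp

lemma cinner_zero_left [simp]: "cinner 0 (x :: 'a :: complex_hilbert) = 0"
  using cinner_scaleC_left[of 0 0 x] by simp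

lemma cinner_minus_left: "cinner (- x) y = - cinner (x :: 'a :: complex_hilbert) y"
  using cinner_add_left[of x "- x" y] by (simp add: eq_neg_iff_add_eq_0 add.commute)

lemma cinner_diff_left: "cinner (x - y) z = cinner x z - cinner (y :: 'a :: complex_hilbert) z"
  using cinner_add_left[of x "- y" z] by (simp add: cinner_minus_left)

lemma cinner_sum_left: "cinner (\<Sum>i\<in>I. f i) z = (\<Sum>i\<in>I. cinner (f i :: 'a :: complex_hilbert) z)"
  by (induction I rule: infinite_finite_induct) (auto simp: cinner_add_left)

locale eigen_expansion =
  fixes ev :: "nat \<Rightarrow> real" and phi :: "nat \<Rightarrow> 'a :: complex_hilbert"
  assumes ev0: "0 < ev 0" and ev_mono: "incseq ev"
    and orthonormal: "\<And>m n. cinner (phi m) (phi n) = (if m = n then 1 else 0)"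
    and expansion: "\<And>u. (\<lambda>n. cinner u (phi n) *\<^sub>C phi n) sums u"
begin

lemma ev_ge: "ev 0 \<le> ev n"
  using ev_mono by (simp add: incseqD)

lemma ev_pos: "0 < ev n"
  using ev0 ev_ge[of n] by linarith

lemma cinner_partial_sum: "cinner (\<Sum>n<N. c n *\<^sub>C phi n) (phi m) = (if m < N then c m else 0)"
proof -
  have "cinner (\<Sum>n<N. c n *\<^sub>C phi n) (phi m) = (\<Sum>n<N. if m = n then c n else 0)"
    by (auto simp: cinner_sum_left cinner_scaleC_left orthonormal mult_delta_right intro!: sum.cong)
  then show ?thesis by simp
qed

lemma norm_partial_sum: "(norm (\<Sum>n<N. c n *\<^sub>C phi n))\<^sup>2 = (\<Sum>n<N. (cmod (c n))\<^sup>2)"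
proof (induction N)
  case (Suc N)
  define S where "S = (\<Sum>n<N. c n *\<^sub>C phi n)"
  have 0: "cinner S (phi N) = 0" "cinner (phi N) S = 0"
    using cinner_partial_sum[of c N N] cinner_commute[of "phi N" S] by (simp_all add: S_def)
  have "complex_of_real ((norm (S + c N *\<^sub>C phi N))\<^sup>2) = cinner S S + c N * cnj (c N)"
    unfolding cinner_self[symmetric]
    by (simp add: cinner_add_left cinner_add_right cinner_scaleC_left cinner_scaleC_right 0 orthonormal)
  also have "\<dots> = of_real ((norm S)\<^sup>2 + (cmod (c N))\<^sup>2)"
    by (simp only: cinner_self complex_norm_square of_real_add)
  finally show ?case using Suc unfolding of_real_eq_iff by (simp add: S_def)
qed simp

lemma Parseval: "(\<lambda>n. (cmod (cinner u (phi n)))\<^sup>2) sums (norm u)\<^sup>2"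
proof -
  have "(\<lambda>N. (norm (\<Sum>n<N. cinner u (phi n) *\<^sub>C phi n))\<^sup>2) \<longlonglongrightarrow> (norm u)\<^sup>2"
    using expansion[of u] unfolding sums_def by (intro tendsto_intros)
  then show ?thesis by (simp add: norm_partial_sum sums_def)
qed

lemma coord_le_norm: "cmod (cinner u (phi n)) \<le> norm u"
proof -
  have "(cmod (cinner u (phi n)))\<^sup>2 \<le> (norm u)\<^sup>2"
    using sum_le_suminf[OF sums_summable[OF Parseval], of "{n}" u] sums_unique[OF Parseval, of u] by simp
  then show ?thesis by (rule power2_le_imp_le) simp
qed

text \<open>The series in \<open>Hneg_norm\<close> is a \<open>suminf\<close>, which carries
  information only if it converges. This predicate records convergence in a form that passes
  directly to differences, quotients and partial sums.\<close>

definition coord_summable :: "real \<Rightarrow> ('a \<Rightarrow> complex) \<Rightarrow> bool" where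
  "coord_summable s f \<longleftrightarrow> summable (\<lambda>n. ev n powr (- 2 * s) * (cmod (f (phi n)))\<^sup>2)"

lemma coord_summable_diff:
  assumes "coord_summable s f" "coord_summable s g"
  shows "coord_summable s (\<lambda>v. f v - g v)"
  unfolding coord_summable_def
proof (rule summable_comparison_test')
  show "summable (\<lambda>n. 2 * (ev n powr (- 2 * s) * (cmod (f (phi n)))\<^sup>2) + 2 * (ev n powr (- 2 * s) * (cmod (g (phi n)))\<^sup>2))"
    using assms unfolding coord_summable_def by (intro summable_add summable_mult)
  fix n
  have "(cmod (f (phi n) - g (phi n)))\<^sup>2 \<le> (cmod (f (phi n)) + cmod (g (phi n)))\<^sup>2"
    by (intro power_mono norm_triangle_ineq4) auto
  also have "\<dots> \<le> 2 * (cmod (f (phi n)))\<^sup>2 + 2 * (cmod (g (phi n)))\<^sup>2"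
    using sum_squares_bound[of "cmod (f (phi n))" "cmod (g (phi n))"] by (simp add: power2_sum)
  finally have "ev n powr (- 2 * s) * (cmod (f (phi n) - g (phi n)))\<^sup>2
     \<le> ev n powr (- 2 * s) * (2 * (cmod (f (phi n)))\<^sup>2 + 2 * (cmod (g (phi n)))\<^sup>2)"
    by (intro mult_left_mono) auto
  then show "norm (ev n powr (- 2 * s) * (cmod (f (phi n) - g (phi n)))\<^sup>2)
    \<le> 2 * (ev n powr (- 2 * s) * (cmod (f (phi n)))\<^sup>2) + 2 * (ev n powr (- 2 * s) * (cmod (g (phi n)))\<^sup>2)"
    by (simp add: algebra_simps)
qed

text \<open>The case \<open>c = 0\<close> is included, as division by 0 gives 0; so difference
  quotients are covered at every increment.\<close>

lemma coord_summable_divide: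
  assumes "coord_summable s f" shows "coord_summable s (\<lambda>v. f v / c)"
proof -
  have "summable (\<lambda>n. 1 / (cmod c)\<^sup>2 * (ev n powr (- 2 * s) * (cmod (f (phi n)))\<^sup>2))"
    using assms unfolding coord_summable_def by (rule summable_mult)
  then show ?thesis by (simp add: coord_summable_def norm_divide power_divide)
qed

text \<open>A single term of a convergent series of nonnegative terms is at most its sum. Thus
  coordinates are continuous on the dual, which carries limits, derivatives and integrals there over
  to scalars.\<close>

lemma coord_le_Hneg_norm:
  assumes "coord_summable s f"
  shows "cmod (f (phi n)) \<le> ev n powr s * Hneg_norm ev phi s f"
proof -
  have "ev n powr (- 2 * s) * (cmod (f (phi n)))\<^sup>2 \<le> (\<Sum>n. ev n powr (- 2 * s) * (cmod (f (phi n)))\<^sup>2)"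
    using sum_le_suminf[OF assms[unfolded coord_summable_def], of "{n}"] by simp
  moreover have "ev n powr (- 2 * s) = (ev n powr (- s))\<^sup>2"
    by (simp add: power2_eq_square powr_add[symmetric])
  ultimately have "ev n powr (- s) * cmod (f (phi n)) \<le> Hneg_norm ev phi s f"
    unfolding Hneg_norm_def by (intro real_le_rsqrt) (simp add: power_mult_distrib)
  then have "ev n powr s * (ev n powr (- s) * cmod (f (phi n))) \<le> ev n powr s * Hneg_norm ev phi s f"
    by (intro mult_left_mono) auto
  then show ?thesis using ev_pos[of n] by (simp add: mult.assoc[symmetric] powr_add[symmetric])
qed

lemma tendsto_coord:
  assumes "eventually (\<lambda>x. coord_summable s (f x)) F" "((\<lambda>x. Hneg_norm ev phi s (f x)) \<longlongrightarrow> 0) F"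
  shows "((\<lambda>x. f x (phi n)) \<longlongrightarrow> 0) F"
proof (rule Lim_null_comparison)
  show "eventually (\<lambda>x. cmod (f x (phi n)) \<le> ev n powr s * Hneg_norm ev phi s (f x)) F"
    using assms(1) by eventually_elim (rule coord_le_Hneg_norm)
  show "((\<lambda>x. ev n powr s * Hneg_norm ev phi s (f x)) \<longlongrightarrow> 0) F"
    using tendsto_mult[OF tendsto_const assms(2), of "ev n powr s"] by simp
qed

lemma partial_sum_in_Hs: "(\<Sum>n<N. c n *\<^sub>C phi n) \<in> Hs ev phi s"
  and Hs_norm_partial_sum: "Hs_norm ev phi s (\<Sum>n<N. c n *\<^sub>C phi n) = sqrt (\<Sum>n<N. ev n powr (2 * s) * (cmod (c n))\<^sup>2)"
proof -
  have "(\<lambda>m. ev m powr (2 * s) * (cmod (cinner (\<Sum>n<N. c n *\<^sub>C phi n) (phi m)))\<^sup>2)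
     sums (\<Sum>m<N. ev m powr (2 * s) * (cmod (cinner (\<Sum>n<N. c n *\<^sub>C phi n) (phi m)))\<^sup>2)"
    by (rule sums_finite) (auto simp: cinner_partial_sum)
  also have "(\<Sum>m<N. ev m powr (2 * s) * (cmod (cinner (\<Sum>n<N. c n *\<^sub>C phi n) (phi m)))\<^sup>2)
     = (\<Sum>n<N. ev n powr (2 * s) * (cmod (c n))\<^sup>2)"
    by (auto simp: cinner_partial_sum intro!: sum.cong)
  finally show "(\<Sum>n<N. c n *\<^sub>C phi n) \<in> Hs ev phi s"
    and "Hs_norm ev phi s (\<Sum>n<N. c n *\<^sub>C phi n) = sqrt (\<Sum>n<N. ev n powr (2 * s) * (cmod (c n))\<^sup>2)"
    by (auto simp: Hs_def Hs_norm_def dest: sums_summable sums_unique)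
qed

lemma phi_in_Hs: "c *\<^sub>C phi n \<in> Hs ev phi s" "phi n \<in> Hs ev phi s"
proof -
  have *: "c *\<^sub>C phi n \<in> Hs ev phi s" for c
  proof -
    have "(\<Sum>m<Suc n. (if m = n then c else 0) *\<^sub>C phi m) = c *\<^sub>C phi n"
      by (simp add: lessThan_Suc)
    then show ?thesis using partial_sum_in_Hs[of "\<lambda>m. if m = n then c else 0" "Suc n" s] by simp
  qed
  show "c *\<^sub>C phi n \<in> Hs ev phi s" by (rule *)
  show "phi n \<in> Hs ev phi s" using *[of "complex_of_real 1"] unfolding scaleC_of_real by simp
qed

text \<open>Testing a functional on \<open>\<Sum>n<N. ev n powr (- 2 * s) * f (phi n) * phi n\<close> bounds the partial sums of
  the series defining its norm.\<close>

lemma Hneg_coord_summable: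
  assumes f: "f \<in> Hneg ev phi s"
  shows "coord_summable s f"
proof -
  define c where "c = (\<lambda>n. of_real (ev n powr (- 2 * s)) * f (phi n))"
  define A where "A = (\<lambda>N. \<Sum>n<N. ev n powr (- 2 * s) * (cmod (f (phi n)))\<^sup>2)"
  from f obtain K where add: "\<And>v w. v \<in> Hs ev phi s \<Longrightarrow> w \<in> Hs ev phi s \<Longrightarrow> f (v + w) = f v + f w"
    and scale: "\<And>c v. v \<in> Hs ev phi s \<Longrightarrow> f (c *\<^sub>C v) = cnj c * f v"
    and K: "\<And>v. v \<in> Hs ev phi s \<Longrightarrow> cmod (f v) \<le> K * Hs_norm ev phi s v"
    unfolding Hneg_def by blast
  have A0: "0 \<le> A N" for N unfolding A_def by (intro sum_nonneg) auto
  have fA: "f (\<Sum>n<N. c n *\<^sub>C phi n) = of_real (A N)" for N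
  proof (induction N)
    case 0
    then show ?case using scale[OF phi_in_Hs(2), of 0 0] by (simp add: A_def)
  next
    case (Suc N)
    have "f (\<Sum>n<Suc N. c n *\<^sub>C phi n) = of_real (A N) + cnj (c N) * f (phi N)"
      using Suc by (simp add: add partial_sum_in_Hs phi_in_Hs scale)
    also have "cnj (c N) * f (phi N) = of_real (ev N powr (- 2 * s) * (cmod (f (phi N)))\<^sup>2)"
      by (simp only: c_def complex_cnj_mult complex_cnj_complex_of_real of_real_mult complex_norm_square mult_ac)
    finally show ?case by (simp add: A_def)
  qed
  have nA: "Hs_norm ev phi s (\<Sum>n<N. c n *\<^sub>C phi n) = sqrt (A N)" for N
  proof -
    have "ev n powr (2 * s) * (cmod (c n))\<^sup>2 = ev n powr (- 2 * s) * (cmod (f (phi n)))\<^sup>2" for n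
    proof -
      have "ev n powr (2 * s) * (ev n powr (- 2 * s))\<^sup>2 = ev n powr (- 2 * s)"
        using ev_pos[of n] by (simp add: power2_eq_square powr_add[symmetric])
      then show ?thesis by (simp add: c_def norm_mult power_mult_distrib mult.assoc[symmetric])
    qed
    then show ?thesis unfolding Hs_norm_partial_sum A_def by simp
  qed
  have "A N \<le> K\<^sup>2" for N
  proof -
    have "A N \<le> K * sqrt (A N)"
      using K[OF partial_sum_in_Hs, of c N] A0[of N] unfolding fA nA by simp
    then have "sqrt (A N) * sqrt (A N) \<le> K * sqrt (A N)" using A0[of N] by simp
    then have "sqrt (A N) \<le> \<bar>K\<bar>"
    proof (cases "A N = 0")
      case False
      then have "0 < sqrt (A N)" using A0[of N] by simp
      from mult_right_le_imp_le[OF \<open>sqrt (A N) * sqrt (A N) \<le> K * sqrt (A N)\<close> this] show ?thesis by simp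
    qed simp
    then have "(sqrt (A N))\<^sup>2 \<le> \<bar>K\<bar>\<^sup>2" using A0[of N] by (intro power_mono) auto
    then show ?thesis using A0[of N] by simp
  qed
  then show ?thesis
    unfolding coord_summable_def A_def by (intro summableI_nonneg_bounded[of _ "K\<^sup>2"]) auto
qed

section \<open>Coordinates of the operator, of derivatives and of integrals in the dual\<close>

lemma Hneg_embed_coord [simp]: "Hneg_embed ev phi s u (phi n) = cinner u (phi n)"
  by (simp add: Hneg_embed_def phi_in_Hs)

lemma coord_summable_embed:
  assumes "0 \<le> s" shows "coord_summable s (Hneg_embed ev phi s u)"
  unfolding coord_summable_def
proof (rule summable_comparison_test')
  show "summable (\<lambda>n. ev 0 powr (- 2 * s) * (cmod (cinner u (phi n)))\<^sup>2)"
    by (intro summable_mult sums_summable[OF Parseval])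
  show "norm (ev n powr (- 2 * s) * (cmod (Hneg_embed ev phi s u (phi n)))\<^sup>2) \<le> ev 0 powr (- 2 * s) * (cmod (cinner u (phi n)))\<^sup>2" for n
    using ev0 ev_ge[of n] assms by (auto intro!: mult_right_mono powr_mono2')
qed

lemma Hneg_op_coord:
  assumes "Hneg_op ev phi s u y"
  shows "y (phi n) = - (of_real (ev n) * cinner u (phi n))"
proof -
  define S where "S = (\<lambda>N v. (- (\<Sum>n<N. complex_of_real (ev n) * cinner u (phi n) * Hneg_embed ev phi s (phi n) v)) - y v)"
  have yH: "y \<in> Hneg ev phi s" and lim: "(\<lambda>N. Hneg_norm ev phi s (S N)) \<longlonglongrightarrow> 0"
    using assms by (simp_all add: Hneg_op_def S_def)
  have S: "S N (phi m) = (if m < N then - (of_real (ev m) * cinner u (phi m)) else 0) - y (phi m)" for N m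
  proof -
    have "(\<Sum>n<N. complex_of_real (ev n) * cinner u (phi n) * Hneg_embed ev phi s (phi n) (phi m))
        = (\<Sum>n<N. if m = n then of_real (ev n) * cinner u (phi n) else 0)"
      by (auto simp: orthonormal mult_delta_right intro!: sum.cong)
    then show ?thesis by (simp add: S_def)
  qed
  have "coord_summable s (S N)" for N
  proof -
    have "coord_summable s (\<lambda>v. (\<Sum>n<N. complex_of_real (ev n) * cinner u (phi n) * Hneg_embed ev phi s (phi n) v))"
      unfolding coord_summable_def by (rule summable_finite[of "{..<N}"]) (auto simp: orthonormal intro!: sum.neutral)
    moreover have "coord_summable s (\<lambda>v. 0)" by (simp add: coord_summable_def)
    ultimately show ?thesis
      using coord_summable_diff[OF coord_summable_diff Hneg_coord_summable[OF yH]] by (fastforce simp: S_def)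
  qed
  then have "(\<lambda>N. S N (phi n)) \<longlonglongrightarrow> 0" using lim by (intro tendsto_coord[of s]) auto
  \<comment> \<open>By orthonormality the coordinate is constant in \<open>N\<close> from
    \<open>Suc n\<close> on.\<close>
  moreover have "(\<lambda>N. S N (phi n)) \<longlonglongrightarrow> - (of_real (ev n) * cinner u (phi n)) - y (phi n)"
    by (rule tendsto_eventually) (auto simp: S eventually_sequentially intro!: exI[of _ "Suc n"])
  ultimately have "- (of_real (ev n) * cinner u (phi n)) - y (phi n) = 0" by (rule LIMSEQ_unique[symmetric])
  then show ?thesis by simp
qed

lemma Hneg_has_derivative_coord:
  assumes "0 \<le> s" "Hneg_has_derivative ev phi s (\<lambda>r. Hneg_embed ev phi s (u r)) g r"
  shows "((\<lambda>r. cinner (u r) (phi n)) has_vector_derivative g (phi n)) (at r)"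
proof -
  have g: "g \<in> Hneg ev phi s"
    and lim: "((\<lambda>h. Hneg_norm ev phi s (\<lambda>v. (Hneg_embed ev phi s (u (r + h)) v - Hneg_embed ev phi s (u r) v) / complex_of_real h - g v)) \<longlongrightarrow> 0) (at 0)"
    using assms(2) by (simp_all add: Hneg_has_derivative_def)
  have "((\<lambda>h. (cinner (u (r + h)) (phi n) - cinner (u r) (phi n)) / complex_of_real h - g (phi n)) \<longlongrightarrow> 0) (at 0)"
    using tendsto_coord[OF always_eventually lim, of n] assms(1)
    by (simp add: coord_summable_diff coord_summable_divide coord_summable_embed Hneg_coord_summable[OF g])
  note lim0 = this
  show ?thesis
    unfolding has_vector_derivative_def has_derivative_at
  proof (intro conjI bounded_linear_scaleR_left)
    have "((\<lambda>h. cmod ((cinner (u (r + h)) (phi n) - cinner (u r) (phi n)) / complex_of_real h - g (phi n))) \<longlongrightarrow> 0) (at 0)"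
      using lim0 by (rule tendsto_norm_zero)
    moreover have e: "cmod (z / of_real h - w) = norm (z - h *\<^sub>R w) / norm h" if "h \<noteq> 0" for z w :: complex and h :: real
    proof -
      have "z / of_real h - w = (z - of_real h * w) / of_real h" using that by (simp add: diff_divide_distrib)
      then show ?thesis by (simp add: norm_divide scaleR_conv_of_real)
    qed
    then have "eventually (\<lambda>h. cmod ((cinner (u (r + h)) (phi n) - cinner (u r) (phi n)) / complex_of_real h - g (phi n))
       = norm (cinner (u (r + h)) (phi n) - cinner (u r) (phi n) - h *\<^sub>R g (phi n)) / norm h) (at 0)"
      unfolding eventually_at_filter
      by (intro always_eventually allI impI e)
    ultimately show "(\<lambda>h. norm (cinner (u (r + h)) (phi n) - cinner (u r) (phi n) - h *\<^sub>R g (phi n)) / norm h) \<midarrow>0\<rightarrow> 0"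
      by (simp add: filterlim_cong)
  qed
qed

text \<open>The formula for \<open>w\<close> is part of the definition. The work is in the
  measurability of the coordinate, which is an almost everywhere limit of the coordinates of the
  simple functions \<open>X k\<close>; integrability then follows from that of the norm.\<close>

lemma Hneg_has_integral_coord:
  assumes "Hneg_has_integral ev phi s S F w" and S: "S \<in> sets lebesgue"
  shows "set_integrable lebesgue S (\<lambda>t. F t (phi n))"
    and "w (phi n) = (LINT t:S|lebesgue. F t (phi n))"
proof -
  have FH: "AE t in lebesgue. t \<in> S \<longrightarrow> F t \<in> Hneg ev phi s"
    and sm: "Hneg_strongly_measurable ev phi s S F"
    and ni: "set_integrable lebesgue S (\<lambda>t. Hneg_norm ev phi s (F t))"
    using assms(1) by (auto simp: Hneg_has_integral_def)
  show "w (phi n) = (LINT t:S|lebesgue. F t (phi n))"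
    using assms(1) by (simp add: Hneg_has_integral_def)
  obtain X :: "nat \<Rightarrow> real \<Rightarrow> 'a \<Rightarrow> complex" where
    X: "\<And>k. finite (range (X k))" "\<And>k. range (X k) \<subseteq> Hneg ev phi s" "\<And>k g. X k -` {g} \<in> sets lebesgue"
    and lim: "AE t in lebesgue. t \<in> S \<longrightarrow> (\<lambda>k. Hneg_norm ev phi s (\<lambda>v. X k t v - F t v)) \<longlonglongrightarrow> 0"
    using sm unfolding Hneg_strongly_measurable_def by blast
  have Xm: "(\<lambda>t. X k t (phi n)) \<in> borel_measurable lebesgue" for k
  proof (rule measurableI)
    fix B :: "complex set"
    have "(\<lambda>t. X k t (phi n)) -` B = (\<Union>g\<in>{g \<in> range (X k). g (phi n) \<in> B}. X k -` {g})" by auto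
    moreover have "\<dots> \<in> sets lebesgue" using X by (intro sets.finite_UN) auto
    ultimately show "(\<lambda>t. X k t (phi n)) -` B \<inter> space lebesgue \<in> sets lebesgue" by simp
  qed simp
  \<comment> \<open>\<open>lim\<close> is defined everywhere and measurable, whether or not the
    sequence converges. The coordinate equals it almost everywhere, and completeness of
    \<open>lebesgue\<close> transfers measurability.\<close>
  define f' where "f' = (\<lambda>t. lim (\<lambda>k. indicat_real S t *\<^sub>R X k t (phi n)))"
  have f'm: "f' \<in> borel_measurable lebesgue"
    unfolding f'_def using Xm S by (intro borel_measurable_lim_metric borel_measurable_scaleR) auto
  have eq: "AE t in lebesgue. f' t = indicat_real S t *\<^sub>R F t (phi n)"
    using lim FH
  proof eventually_elim
    case (elim t)
    have "(\<lambda>k. indicat_real S t *\<^sub>R X k t (phi n)) \<longlonglongrightarrow> indicat_real S t *\<^sub>R F t (phi n)"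
    proof (cases "t \<in> S")
      case True
      have "(\<lambda>k. X k t (phi n) - F t (phi n)) \<longlonglongrightarrow> 0"
        using elim True X(2) by (intro tendsto_coord[of s "\<lambda>k v. X k t v - F t v"] always_eventually allI coord_summable_diff Hneg_coord_summable) auto
      then show ?thesis using True by (simp add: LIM_zero_iff)
    qed simp
    then show ?case unfolding f'_def by (rule limI)
  qed
  have m: "(\<lambda>t. indicat_real S t *\<^sub>R F t (phi n)) \<in> borel_measurable lebesgue"
  proof (rule measurableI)
    fix B :: "complex set" assume "B \<in> sets borel"
    then have B: "f' -` B \<in> sets lebesgue" using measurable_sets[OF f'm] by simp
    have ae: "AE t in lebesgue. t \<in> f' -` B \<longleftrightarrow> t \<in> (\<lambda>t. indicat_real S t *\<^sub>R F t (phi n)) -` B"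
      using eq by eventually_elim simp
    from completion.in_sets_AE[OF ae B]
    show "(\<lambda>t. indicat_real S t *\<^sub>R F t (phi n)) -` B \<inter> space lebesgue \<in> sets lebesgue" by simp
  qed simp
  show "set_integrable lebesgue S (\<lambda>t. F t (phi n))"
    unfolding set_integrable_def
  proof (rule Bochner_Integration.integrable_bound[OF _ m])
    show "integrable lebesgue (\<lambda>t. ev n powr s * (indicat_real S t *\<^sub>R Hneg_norm ev phi s (F t)))"
      using ni unfolding set_integrable_def by simp
    show "AE t in lebesgue. norm (indicat_real S t *\<^sub>R F t (phi n)) \<le> norm (ev n powr s * (indicat_real S t *\<^sub>R Hneg_norm ev phi s (F t)))"
      using FH
    proof eventually_elim
      case (elim t)
      then show ?case
        using coord_le_Hneg_norm[OF Hneg_coord_summable, of "F t" s n] by (cases "t \<in> S") auto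
    qed
  qed
qed

end

lemma caputo_solution_eq_ray_solution:
  assumes \<alpha>: "0 < \<alpha>" "\<alpha> < 1" and "0 < \<Lambda>" and cont: "continuous_on {0..T} y"
    and eq: "AE t in lebesgue. 0 < t \<and> t < T \<longrightarrow> (\<exists>g. caputo_eq_at \<alpha> (cis (- (pi * \<alpha> / 2)) * of_real \<Lambda>) y g t)"
    and T: "0 < T"
  shows "y T = y 0 * ray_solution \<alpha> (\<Lambda> powr (1 / \<alpha>) * T)"
proof -
  define \<nu> where "\<nu> = \<Lambda> powr (1 / \<alpha>)"
  define \<mu> where "\<mu> = cis (- (pi * \<alpha> / 2)) * of_real \<Lambda>"
  have \<nu>: "0 < \<nu>" "\<nu> powr \<alpha> = \<Lambda>" using assms by (auto simp: \<nu>_def powr_powr)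
  define z where "z = (\<lambda>t. y 0 * ray_solution \<alpha> (\<nu> * t))"
  have zc: "continuous_on {0..} z"
    unfolding z_def using \<nu> by (intro continuous_intros continuous_on_compose2[OF continuous_on_ray_solution[OF \<alpha>]]) auto
  have zV: "z t = y 0 + \<mu> * frac_int \<alpha> z t" if "0 \<le> t" for t
  proof -
    have "0 \<le> \<nu> * t" using \<nu> that by simp
    then have "z t = y 0 * (1 + cis (- (pi * \<alpha> / 2)) * frac_int \<alpha> (ray_solution \<alpha>) (\<nu> * t))"
      unfolding z_def using ray_solution_Volterra[OF \<alpha>] by simp
    also have "frac_int \<alpha> (ray_solution \<alpha>) (\<nu> * t) = frac_int \<alpha> (\<lambda>t. ray_solution \<alpha> (\<nu> * t)) t * of_real \<Lambda>"
      using frac_int_scale[of \<nu> \<alpha> "ray_solution \<alpha>" t] \<nu> by simp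
    finally show ?thesis by (simp add: z_def frac_int_cmult \<mu>_def algebra_simps)
  qed
  have yV: "y t = y 0 + \<mu> * frac_int \<alpha> y t" if "0 \<le> t" "t < T" for t
    using caputo_eq_imp_Volterra[OF \<alpha> cont eq, of t] that by (cases "t = 0") (auto simp: \<mu>_def)
  have eq_lt: "y t - z t = 0" if t: "0 \<le> t" "t < T" for t
  proof (rule Volterra_unique[OF \<alpha>(1), of t _ \<mu>])
    show "continuous_on {0..t} (\<lambda>t. y t - z t)"
      using t by (intro continuous_intros continuous_on_subset[OF cont] continuous_on_subset[OF zc]) auto
    fix s assume s: "0 \<le> s" "s \<le> t"
    have "frac_int \<alpha> (\<lambda>t. y t - z t) s = frac_int \<alpha> y s - frac_int \<alpha> z s"
      using s t by (intro frac_int_diff[OF \<alpha>(1)] continuous_on_subset[OF cont] continuous_on_subset[OF zc]) auto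
    then show "y s - z s = \<mu> * frac_int \<alpha> (\<lambda>t. y t - z t) s"
      using yV[of s] zV[of s] s t by (simp add: right_diff_distrib)
  qed (use t in auto)
  \<comment> \<open>Starts at 0, stays below \<open>T\<close> and tends to \<open>T\<close>.\<close>
  define a where "a = (\<lambda>n. T - T / real (Suc n))"
  have a: "0 \<le> a n" "a n < T" for n using T by (auto simp: a_def divide_le_eq mult_le_cancel_left1)
  have aT: "a \<longlonglongrightarrow> T" unfolding a_def by real_asymp
  have "(\<lambda>n. y (a n) - z (a n)) \<longlonglongrightarrow> y T - z T"
    using a T by (intro tendsto_intros continuous_on_tendsto_compose[OF cont aT] continuous_on_tendsto_compose[OF zc aT])
      (auto intro!: always_eventually less_imp_le)
  moreover have "(\<lambda>n. y (a n) - z (a n)) = (\<lambda>n. 0)" using eq_lt a by auto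
  ultimately have "y T - z T = 0" using LIMSEQ_unique by fastforce
  then show ?thesis by (simp add: z_def \<nu>_def)
qed

section \<open>Coordinates of weak solutions\<close>

context eigen_expansion
begin

lemma caputo_coord:
  assumes "0 \<le> s" "has_caputo_derivative ev phi s \<alpha> (\<lambda>r. Hneg_embed ev phi s (u r)) d t"
    and \<mu>: "d (phi n) = \<mu> * cinner (u t) (phi n)" and \<alpha>: "\<alpha> < 1"
  shows "\<exists>g. caputo_eq_at \<alpha> \<mu> (\<lambda>t. cinner (u t) (phi n)) g t"
proof -
  obtain G w where
    der: "AE r in lebesgue. 0 < r \<and> r < t \<longrightarrow> Hneg_has_derivative ev phi s (\<lambda>r. Hneg_embed ev phi s (u r)) (G r) r"
    and prim: "\<And>a b. 0 < a \<Longrightarrow> a \<le> b \<Longrightarrow> b < t \<Longrightarrow>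
       Hneg_has_integral ev phi s {a..b} G (\<lambda>v. Hneg_embed ev phi s (u b) v - Hneg_embed ev phi s (u a) v)"
    and int: "Hneg_has_integral ev phi s {0<..<t} (\<lambda>r v. complex_of_real ((t - r) powr (- \<alpha>)) * G r v) w"
    and d: "d = (\<lambda>v. complex_of_real (1 / Gamma (1 - \<alpha>)) * w v)"
    using assms(2) unfolding has_caputo_derivative_def by blast
  have G: "0 < Gamma (1 - \<alpha>)" using \<alpha> by (simp add: Gamma_real_pos)
  have "caputo_eq_at \<alpha> \<mu> (\<lambda>t. cinner (u t) (phi n)) (\<lambda>r. G r (phi n)) t"
    unfolding caputo_eq_at_def
  proof (intro conjI allI impI)
    show "AE r in lebesgue. 0 < r \<and> r < t \<longrightarrow> ((\<lambda>t. cinner (u t) (phi n)) has_vector_derivative G r (phi n)) (at r)"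
      using der by eventually_elim (blast intro: Hneg_has_derivative_coord[OF assms(1)])
    show "cinner (u b) (phi n) - cinner (u a) (phi n) = (LINT r:{a..b}|lebesgue. G r (phi n))"
      if "0 < a \<and> a \<le> b \<and> b < t" for a b
      using Hneg_has_integral_coord(2)[OF prim[of a b], of n] that by simp
    show "set_integrable lebesgue {0<..<t} (\<lambda>r. complex_of_real ((t - r) powr (- \<alpha>)) * G r (phi n))"
      using Hneg_has_integral_coord(1)[OF int, of n] by simp
    have "w (phi n) = of_real (Gamma (1 - \<alpha>)) * d (phi n)" using G by (simp add: d)
    then show "(LINT r:{0<..<t}|lebesgue. complex_of_real ((t - r) powr (- \<alpha>)) * G r (phi n))
       = of_real (Gamma (1 - \<alpha>)) * \<mu> * cinner (u t) (phi n)"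
      using Hneg_has_integral_coord(2)[OF int, of n] by (simp add: \<mu>)
  qed
  then show ?thesis by blast
qed

text \<open>Testing the equation with \<open>phi n\<close> gives
  \<open>i_power \<alpha> * d (phi n) = ev n * cinner (u t) (phi n)\<close>, since the operator
  contributes \<open>- ev n\<close>. Multiplication by \<open>cis (- (pi * \<alpha> / 2))\<close>,
  the inverse of \<open>i_power \<alpha>\<close>, yields the scalar coefficient.\<close>

lemma weak_solution_coord:
  assumes \<alpha>: "0 < \<alpha>" "\<alpha> < 1" and T: "0 < T" and w: "weak_solution ev phi \<alpha> T u0 u"
  shows "cinner (u T) (phi n) = cinner (u 0) (phi n) * ray_solution \<alpha> (ev n powr (1 / \<alpha>) * T)"
proof (rule caputo_solution_eq_ray_solution[OF \<alpha> ev_pos _ _ T])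
  have cu: "continuous_on {0..T} u" using w by (simp add: weak_solution_def)
  show "continuous_on {0..T} (\<lambda>t. cinner (u t) (phi n))"
    unfolding continuous_on_def
  proof
    fix x assume "x \<in> {0..T}"
    then have "(u \<longlongrightarrow> u x) (at x within {0..T})" using cu by (simp add: continuous_on_def)
    then have "((\<lambda>t. norm (u t - u x)) \<longlongrightarrow> 0) (at x within {0..T})"
      by (intro tendsto_norm_zero) (simp add: LIM_zero)
    then have "((\<lambda>t. cinner (u t) (phi n) - cinner (u x) (phi n)) \<longlongrightarrow> 0) (at x within {0..T})"
      by (rule Lim_null_comparison[rotated]) (simp add: cinner_diff_left[symmetric] coord_le_norm)
    then show "((\<lambda>t. cinner (u t) (phi n)) \<longlongrightarrow> cinner (u x) (phi n)) (at x within {0..T})"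
      by (simp add: LIM_zero_iff)
  qed
  have "AE t in lebesgue. 0 < t \<and> t < T \<longrightarrow>
        (\<exists>d y. has_caputo_derivative ev phi (1 / \<alpha>) \<alpha> (\<lambda>r. Hneg_embed ev phi (1 / \<alpha>) (u r)) d t \<and>
               Hneg_op ev phi (1 / \<alpha>) (u t) y \<and> (\<lambda>v. i_power \<alpha> * d v + y v) = (\<lambda>v. 0))"
    using w by (simp add: weak_solution_def)
  then show "AE t in lebesgue. 0 < t \<and> t < T \<longrightarrow>
     (\<exists>g. caputo_eq_at \<alpha> (cis (- (pi * \<alpha> / 2)) * of_real (ev n)) (\<lambda>t. cinner (u t) (phi n)) g t)"
  proof eventually_elim
    case (elim t)
    show ?case
    proof
      assume "0 < t \<and> t < T"
      then obtain d y where d: "has_caputo_derivative ev phi (1 / \<alpha>) \<alpha> (\<lambda>r. Hneg_embed ev phi (1 / \<alpha>) (u r)) d t"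
        and y: "Hneg_op ev phi (1 / \<alpha>) (u t) y" and e: "(\<lambda>v. i_power \<alpha> * d v + y v) = (\<lambda>v. 0)"
        using elim by blast
      have "i_power \<alpha> = cis (pi * \<alpha> / 2)" by (simp add: i_power_def cis_conv_exp)
      then have "cis (pi * \<alpha> / 2) * d (phi n) = of_real (ev n) * cinner (u t) (phi n)"
        using fun_cong[OF e, of "phi n"] Hneg_op_coord[OF y, of n] by simp
      then have "cis (- (pi * \<alpha> / 2)) * (cis (pi * \<alpha> / 2) * d (phi n)) = cis (- (pi * \<alpha> / 2)) * (of_real (ev n) * cinner (u t) (phi n))"
        by simp
      then have "d (phi n) = cis (- (pi * \<alpha> / 2)) * of_real (ev n) * cinner (u t) (phi n)"
        by (simp add: mult.assoc[symmetric] cis_mult)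
      from caputo_coord[OF _ d this \<alpha>(2)] \<alpha>
      show "\<exists>g. caputo_eq_at \<alpha> (cis (- (pi * \<alpha> / 2)) * of_real (ev n)) (\<lambda>t. cinner (u t) (phi n)) g t" by simp
    qed
  qed
qed

lemma norm_le_Hs_norm:
  assumes "v \<in> Hs ev phi \<epsilon>" "0 \<le> \<epsilon>"
  shows "ev 0 powr \<epsilon> * norm v \<le> Hs_norm ev phi \<epsilon> v"
proof -
  have "(ev 0 powr \<epsilon>)\<^sup>2 * (norm v)\<^sup>2 = (\<Sum>n. (ev 0 powr \<epsilon>)\<^sup>2 * (cmod (cinner v (phi n)))\<^sup>2)"
    using sums_unique[OF sums_mult[OF Parseval]] .
  also have "\<dots> \<le> (\<Sum>n. ev n powr (2 * \<epsilon>) * (cmod (cinner v (phi n)))\<^sup>2)"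
  proof (rule suminf_le)
    fix n
    have "(ev 0 powr \<epsilon>)\<^sup>2 \<le> (ev n powr \<epsilon>)\<^sup>2"
      using ev0 ev_ge[of n] assms(2) by (intro power_mono powr_mono2) auto
    also have "\<dots> = ev n powr (2 * \<epsilon>)" by (simp add: power2_eq_square powr_add[symmetric])
    finally show "(ev 0 powr \<epsilon>)\<^sup>2 * (cmod (cinner v (phi n)))\<^sup>2 \<le> ev n powr (2 * \<epsilon>) * (cmod (cinner v (phi n)))\<^sup>2"
      by (rule mult_right_mono) simp
  qed (use assms(1) in \<open>auto simp: Hs_def intro: summable_mult sums_summable[OF Parseval]\<close>)
  finally show ?thesis
    unfolding Hs_norm_def by (intro real_le_rsqrt) (simp add: power_mult_distrib)
qed

end

theorem theorem4p9:
  fixes D :: "'a::complex_hilbert set" and A :: "'a \<Rightarrow> 'a"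
    and ev :: "nat \<Rightarrow> real" and phi :: "nat \<Rightarrow> 'a" and \<alpha> :: real
  assumes "self_adjoint D A" and "negative_definite D A" and "compact_resolvent D A"
    and "eigenbasis D A ev phi"
    and "0 < \<alpha>" and "\<alpha> < 1"
  shows "\<exists>C>0. \<forall>T \<epsilon> M :: real. \<forall>\<beta> :: real. \<forall>u0 :: 'a. \<forall>u :: real \<Rightarrow> 'a.
           0 < T \<longrightarrow> 0 < \<epsilon> \<longrightarrow> 0 < M \<longrightarrow> \<beta> = \<epsilon> / (\<epsilon> + 1) \<longrightarrow>
           u0 \<in> admissible_data ev phi \<epsilon> M \<longrightarrow>
           weak_solution ev phi \<alpha> T u0 u \<longrightarrow>
           norm (u 0) \<le> C powr \<beta> * M powr (1 - \<beta>) * norm (u T) powr \<beta>"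
proof -
  note \<alpha> = assms(5,6)
  interpret eigen_expansion ev phi
    using assms(4) by unfold_locales (auto simp: eigenbasis_def)
  obtain \<kappa> where \<kappa>: "0 < \<kappa>" "\<And>t. 0 \<le> t \<Longrightarrow> \<kappa> \<le> cmod (ray_solution \<alpha> t)"
    using ray_solution_lower_bound[OF \<alpha>] by blast
  \<comment> \<open>The factor \<open>1 / \<kappa>\<close> comes from the lower bound for the
    solution, \<open>1 / ev 0\<close> from the a priori bound. So \<open>C\<close> depends on
    \<open>\<alpha>\<close> and the smallest eigenvalue, but not on \<open>T\<close>,
    \<open>\<epsilon>\<close>, \<open>M\<close> or the datum.\<close>
  define C where "C = 1 / (\<kappa> * ev 0)"
  have "norm (u 0) \<le> C powr \<beta> * M powr (1 - \<beta>) * norm (u T) powr \<beta>"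
    if T: "0 < T" and \<epsilon>: "0 < \<epsilon>" and M: "0 < M" and \<beta>: "\<beta> = \<epsilon> / (\<epsilon> + 1)"
      and u0: "u0 \<in> admissible_data ev phi \<epsilon> M" and w: "weak_solution ev phi \<alpha> T u0 u"
    for T \<epsilon> M \<beta> :: real and u0 :: 'a and u :: "real \<Rightarrow> 'a"
  proof -
    have "(\<kappa>\<^sup>2 * (norm (u 0))\<^sup>2) \<le> (norm (u T))\<^sup>2"
    proof (rule sums_le[OF _ sums_mult[OF Parseval] Parseval])
      fix n
      have "\<kappa> * cmod (cinner (u 0) (phi n)) \<le> cmod (cinner (u T) (phi n))"
        unfolding weak_solution_coord[OF \<alpha> T w] norm_mult
        using T by (subst mult.commute) (intro mult_left_mono \<kappa>(2); simp)
      then have "(\<kappa> * cmod (cinner (u 0) (phi n)))\<^sup>2 \<le> (cmod (cinner (u T) (phi n)))\<^sup>2"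
        using \<kappa> by (intro power_mono) auto
      then show "\<kappa>\<^sup>2 * (cmod (cinner (u 0) (phi n)))\<^sup>2 \<le> (cmod (cinner (u T) (phi n)))\<^sup>2"
        by (simp add: power_mult_distrib)
    qed
    then have "(\<kappa> * norm (u 0))\<^sup>2 \<le> (norm (u T))\<^sup>2" by (simp add: power_mult_distrib)
    then have "\<kappa> * norm (u 0) \<le> norm (u T)" by (rule power2_le_imp_le) simp
    then have low: "norm (u 0) \<le> norm (u T) / \<kappa>" using \<kappa> by (simp add: field_simps)
    \<comment> \<open>The initial condition is only a limit from the right; continuity of
      \<open>u\<close> on \<open>{0..T}\<close> identifies it with the value at 0.\<close>
    have "u 0 = u0"
    proof -
      have "(u \<longlongrightarrow> u0) (at_right 0)"
        using w unfolding weak_solution_def by (simp add: tendsto_norm_zero_iff LIM_zero_iff)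
      moreover have "continuous_on {0..T} u" using w by (simp add: weak_solution_def)
      then have "(u \<longlongrightarrow> u 0) (at 0 within {0..T})" using T by (simp add: continuous_on_def)
      then have "(u \<longlongrightarrow> u 0) (at_right 0)"
        using at_within_Icc_at_right[OF T] by simp
      ultimately show ?thesis using tendsto_unique[of "at_right 0"] by force
    qed
    then have up: "norm (u 0) \<le> M / ev 0 powr \<epsilon>"
      using norm_le_Hs_norm[of u0 \<epsilon>] u0 \<epsilon> ev0 by (simp add: admissible_data_def field_simps)
    \<comment> \<open>The choice of \<open>\<beta>\<close> amounts to
      \<open>\<epsilon> * (1 - \<beta>) = \<beta>\<close>: it gives \<open>ev 0\<close> the same
      power as \<open>\<kappa>\<close>, so that both fit into \<open>C powr \<beta>\<close>.\<close>
    have b: "0 < \<beta>" "0 < 1 - \<beta>" "\<epsilon> * (1 - \<beta>) = \<beta>" using \<epsilon> by (auto simp: \<beta> field_simps)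
    \<comment> \<open>Interpolation: one factor is bounded through \<open>norm (u T)\<close>, the
      other through \<open>M\<close>. The splitting also holds for \<open>u 0 = 0\<close>, where
      every power is 0.\<close>
    have "norm (u 0) = norm (u 0) powr \<beta> * norm (u 0) powr (1 - \<beta>)"
      by (simp add: powr_add[symmetric])
    also have "\<dots> \<le> (norm (u T) / \<kappa>) powr \<beta> * (M / ev 0 powr \<epsilon>) powr (1 - \<beta>)"
      using low up b by (intro mult_mono powr_mono2) auto
    also have "\<dots> = C powr \<beta> * M powr (1 - \<beta>) * norm (u T) powr \<beta>"
      using \<kappa> ev0 M b by (simp add: C_def powr_divide powr_mult powr_powr)
    finally show ?thesis .
  qed
  moreover have "0 < C" using \<kappa> ev0 by (simp add: C_def)
  ultimately show ?thesis by blast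
qed

end
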